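(* Let $\Bbbk$ be a field and let $\mathcal{P}$ be a locally finite operad over $\Bbbk$. Suppose that $\mathcal{P}$ is generated by finitely many elements and subject to a finite set of relations. Then the following hold. (1) The automorphism group $\operatorname{Aut}(\mathcal{P})$ is an algebraic group. (2) $H^i(\mathcal{P})$ is finite dimensional over $\Bbbk$ for $i=0,1,2$.
   Context: $\Bbbk$ is a field. An operad is a symmetric $\Bbbk$-linear operad $\mathcal{P}=(\mathcal{P}(n))_{n\ge 0}$: right $\Bbbk\mathbb{S}_n$-modules $\mathcal{P}(n)$ (action written $\ast$), an identity $\mathbf{1}\in\mathcal{P}(1)$, and partial compositions $-\circ_i-:\mathcal{P}(m)\otimes\mathcal{P}(n)\to\mathcal{P}(m+n-1)$ ($m\ge1$, $n\ge0$, $1\le i\le m$) satisfying the usual identity, associativity and equivariance axioms; equivariance reads $\mu\circ_i(\nu\ast\sigma)=(\mu\circ_i\nu)\ast\sigma'$ and $(\mu\ast\phi)\circ_i\nu=(\mu\circ_{\phi(i)}\nu)\ast\phi''$ for suitable permutations $\sigma',\phi''\in\mathbb{S}_{m+n-1}$. $\mathcal{P}$ is locally finite if every $\mathcal{P}(n)$ is finite dimensional. $\operatorname{Aut}(\mathcal{P})$ is the group of invertible endomorphisms of $\mathcal{P}$, i.e. arity-preserving linear bijections preserving $\mathbf{1}$, the $\mathbb{S}_n$-actions and partial compositions. "Algebraic group" is meant in the classical sense: a Zariski closed subgroup of some $GL_N(\Bbbk)$. For $\lambda\in\mathcal{P}(1)$ put $\operatorname{ad}_\lambda(\theta)=\lambda\circ_1\theta-\sum_{i=1}^n\theta\circ_i\lambda$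 ($\theta\in\mathcal{P}(n)$). Then $H^0(\mathcal{P}):=\{\lambda\in\mathcal{P}(1):\operatorname{ad}_\lambda=0\}$ and $H^1(\mathcal{P}):=\operatorname{der}(\mathcal{P})/\{\operatorname{ad}_\lambda:\lambda\in\mathcal{P}(1)\}$, where $\operatorname{der}(\mathcal{P})$ is the space of derivations: arity-preserving linear maps $\partial$ commuting with $\mathbb{S}_n$-actions with $\partial(\mu\circ_i\nu)=\partial(\mu)\circ_i\nu+\mu\circ_i\partial(\nu)$. $H^2(\mathcal{P}):=Z^2(\mathcal{P})/B^2(\mathcal{P})$, where $Z^2(\mathcal{P})$ is the space of collections of linear maps $\wp_i:\mathcal{P}(m)\otimes\mathcal{P}(n)\to\mathcal{P}(m+n-1)$ (all $m\ge1,n\ge0,1\le i\le m$) such that for $\lambda\in\mathcal{P}(l)$, $\mu\in\mathcal{P}(m)$, $\nu\in\mathcal{P}(n)$, $\phi\in\mathbb{S}_m$, $\sigma\in\mathbb{S}_n$: $\wp_{i-1+j}(\lambda\circ_i\mu,\nu)+\wp_i(\lambda,\mu)\circ_{i-1+j}\nu=\wp_i(\lambda,\mu\circ_j\nu)+\lambda\circ_i\wp_j(\mu,\nu)$ for $1\le i\le l$, $1\le j\le m$; $\wp_{k-1+m}(\lambda\circ_i\mu,\nu)+\wp_i(\lambda,\mu)\circ_{k-1+m}\nu=\wp_i(\lambda\circ_k\nu,\mu)+\wp_k(\lambda,\nu)\circ_i\mu$ for $1\le i<k\le l$; $\wp_i(\mu,\nu\ast\sigma)=\wp_i(\mu,\nu)\ast\sigma'$;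 $\wp_i(\mu\ast\phi,\nu)=\wp_{\phi(i)}(\mu,\nu)\ast\phi''$, with $\sigma',\phi''$ the same permutations as in the equivariance axioms. $B^2(\mathcal{P})$ is the subspace of those of the form $\wp_i(\mu,\nu)=\partial(\mu\circ_i\nu)-\partial(\mu)\circ_i\nu-\mu\circ_i\partial(\nu)$ for an arity-preserving linear map $\partial:\mathcal{P}\to\mathcal{P}$ with $\partial(\mu\ast\sigma)=\partial(\mu)\ast\sigma$. *)

theory Defs
  imports
    "HOL-Library.Function_Algebras"
    "HOL-Library.Poly_Mapping"
    "HOL-Library.FuncSet"
    "HOL-Combinatorics.Permutations"
    "Jordan_Normal_Form.Matrix"
begin

section \<open>Symmetric operads over a field\<close>

text \<open>
  The components of an operad are subspaces \<^term>\<open>op_space P n\<close> of one ambient vector space.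
  Nothing is assumed about how the components for different arities meet; therefore every operation
  carries the arities of its arguments.  The values of the operations outside their domains are
  irrelevant.  Permutations of \<^term>\<open>{1..n}\<close> act on the right.
  \<^term>\<open>op_comp P m n i \<mu> \<nu>\<close> is the partial composition of \<open>\<mu>\<close> (arity \<open>m\<close>) with \<open>\<nu>\<close> (arity \<open>n\<close>)
  at input \<open>i\<close>, where inputs are numbered from 1.
\<close>

record ('k, 'p) operad_data =
  op_scale :: "'k \<Rightarrow> 'p \<Rightarrow> 'p"
  op_space :: "nat \<Rightarrow> 'p set"
  op_act :: "nat \<Rightarrow> 'p \<Rightarrow> (nat \<Rightarrow> nat) \<Rightarrow> 'p"
  op_id :: "'p"
  op_comp :: "nat \<Rightarrow> nat \<Rightarrow> nat \<Rightarrow> 'p \<Rightarrow> 'p \<Rightarrow> 'p"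

text \<open>
  The permutations in the equivariance axioms.  Conventions: input \<open>k\<close> of \<open>\<mu> * \<phi>\<close> is input \<open>\<phi> k\<close> of
  \<open>\<mu>\<close>.  In the composite of \<open>\<mu>\<close> and \<open>\<nu>\<close> at \<open>i\<close>, with \<open>\<nu>\<close> of arity \<open>n\<close>, input \<open>j\<close> of \<open>\<nu>\<close> becomes
  input \<open>i - 1 + j\<close>, and an input \<open>a \<noteq> i\<close> of \<open>\<mu>\<close> becomes input \<^term>\<open>outer_slot n i a\<close>.
\<close>

definition outer_slot :: "nat \<Rightarrow> nat \<Rightarrow> nat \<Rightarrow> nat" where
  "outer_slot n i a = (if a < i then a else a + n - 1)"

definition inner_perm :: "nat \<Rightarrow> nat \<Rightarrow> (nat \<Rightarrow> nat) \<Rightarrow> nat \<Rightarrow> nat" where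
  "inner_perm n i \<sigma> k =
     (if i \<le> k \<and> k < i + n then i - 1 + \<sigma> (k + 1 - i) else k)"

definition outer_perm :: "nat \<Rightarrow> nat \<Rightarrow> (nat \<Rightarrow> nat) \<Rightarrow> nat \<Rightarrow> nat" where
  "outer_perm n i \<phi> k =
     (if k < i then outer_slot n (\<phi> i) (\<phi> k)
      else if k < i + n then \<phi> i + (k - i)
      else outer_slot n (\<phi> i) (\<phi> (k + 1 - n)))"

definition linear_between ::
  "('k \<Rightarrow> 'a \<Rightarrow> 'a) \<Rightarrow> ('k \<Rightarrow> 'b \<Rightarrow> 'b) \<Rightarrow> 'a set \<Rightarrow> 'b set
    \<Rightarrow> ('a::ab_group_add \<Rightarrow> 'b::ab_group_add) \<Rightarrow> bool" where
  "linear_between s t V W f \<longleftrightarrow>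
     f ` V \<subseteq> W \<and>
     (\<forall>x\<in>V. \<forall>y\<in>V. f (x + y) = f x + f y) \<and>
     (\<forall>c. \<forall>x\<in>V. f (s c x) = t c (f x))"

locale operad = vector_space "op_scale P"
  for P :: "('k::field, 'p::ab_group_add) operad_data" +
  assumes space_subspace: "subspace (op_space P n)"
    and id_closed: "op_id P \<in> op_space P 1"
    and act_linear: "\<sigma> permutes {1..n} \<Longrightarrow>
      linear_between (op_scale P) (op_scale P) (op_space P n) (op_space P n) (\<lambda>\<mu>. op_act P n \<mu> \<sigma>)"
    and act_id: "\<mu> \<in> op_space P n \<Longrightarrow> op_act P n \<mu> id = \<mu>"
    and act_act: "\<lbrakk>\<mu> \<in> op_space P n; \<sigma> permutes {1..n}; \<tau> permutes {1..n}\<rbrakk> \<Longrightarrow>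
      op_act P n (op_act P n \<mu> \<sigma>) \<tau> = op_act P n \<mu> (\<sigma> \<circ> \<tau>)"
    and comp_linear_left: "\<lbrakk>1 \<le> i; i \<le> m; \<nu> \<in> op_space P n\<rbrakk> \<Longrightarrow>
      linear_between (op_scale P) (op_scale P) (op_space P m) (op_space P (m + n - 1))
        (\<lambda>\<mu>. op_comp P m n i \<mu> \<nu>)"
    and comp_linear_right: "\<lbrakk>1 \<le> i; i \<le> m; \<mu> \<in> op_space P m\<rbrakk> \<Longrightarrow>
      linear_between (op_scale P) (op_scale P) (op_space P n) (op_space P (m + n - 1))
        (\<lambda>\<nu>. op_comp P m n i \<mu> \<nu>)"
    and id_left: "\<nu> \<in> op_space P n \<Longrightarrow> op_comp P 1 n 1 (op_id P) \<nu> = \<nu>"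
    and id_right: "\<lbrakk>1 \<le> i; i \<le> m; \<mu> \<in> op_space P m\<rbrakk> \<Longrightarrow> op_comp P m 1 i \<mu> (op_id P) = \<mu>"
    and assoc_sequential:
      "\<lbrakk>\<kappa> \<in> op_space P l; \<mu> \<in> op_space P m; \<nu> \<in> op_space P n; 1 \<le> i; i \<le> l; 1 \<le> j; j \<le> m\<rbrakk> \<Longrightarrow>
        op_comp P (l + m - 1) n (i - 1 + j) (op_comp P l m i \<kappa> \<mu>) \<nu> =
        op_comp P l (m + n - 1) i \<kappa> (op_comp P m n j \<mu> \<nu>)"
    and assoc_parallel:
      "\<lbrakk>\<kappa> \<in> op_space P l; \<mu> \<in> op_space P m; \<nu> \<in> op_space P n; 1 \<le> i; i < k; k \<le> l\<rbrakk> \<Longrightarrow>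
        op_comp P (l + m - 1) n (k - 1 + m) (op_comp P l m i \<kappa> \<mu>) \<nu> =
        op_comp P (l + n - 1) m i (op_comp P l n k \<kappa> \<nu>) \<mu>"
    and equivariant_inner:
      "\<lbrakk>\<mu> \<in> op_space P m; \<nu> \<in> op_space P n; 1 \<le> i; i \<le> m; \<sigma> permutes {1..n}\<rbrakk> \<Longrightarrow>
        op_comp P m n i \<mu> (op_act P n \<nu> \<sigma>) =
        op_act P (m + n - 1) (op_comp P m n i \<mu> \<nu>) (inner_perm n i \<sigma>)"
    and equivariant_outer:
      "\<lbrakk>\<mu> \<in> op_space P m; \<nu> \<in> op_space P n; 1 \<le> i; i \<le> m; \<phi> permutes {1..m}\<rbrakk> \<Longrightarrow>
        op_comp P m n i (op_act P m \<mu> \<phi>) \<nu> =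
        op_act P (m + n - 1) (op_comp P m n (\<phi> i) \<mu> \<nu>) (outer_perm n i \<phi>)"

definition finite_dimensional :: "('k::field \<Rightarrow> 'v::ab_group_add \<Rightarrow> 'v) \<Rightarrow> 'v set \<Rightarrow> bool" where
  "finite_dimensional s V \<longleftrightarrow> (\<exists>S. finite S \<and> S \<subseteq> V \<and> V \<subseteq> Modules.module.span s S)"

text \<open>For subspaces \<open>B \<subseteq> Z\<close>: the quotient space \<open>Z/B\<close> is spanned by finitely many cosets
  \<open>s + B\<close>, \<open>s \<in> S \<subseteq> Z\<close>.\<close>

definition finite_dimensional_quotient ::
  "('k::field \<Rightarrow> 'v::ab_group_add \<Rightarrow> 'v) \<Rightarrow> 'v set \<Rightarrow> 'v set \<Rightarrow> bool" where
  "finite_dimensional_quotient s Z B \<longleftrightarrow>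
     (\<exists>S. finite S \<and> S \<subseteq> Z \<and> (\<forall>z\<in>Z. \<exists>c. z - (\<Sum>v\<in>S. s (c v) v) \<in> B))"

definition locally_finite :: "('k::field, 'p::ab_group_add) operad_data \<Rightarrow> bool" where
  "locally_finite P \<longleftrightarrow> (\<forall>n. finite_dimensional (op_scale P) (op_space P n))"

definition operad_hom ::
  "('k::field, 'q::ab_group_add) operad_data \<Rightarrow> ('k, 'p::ab_group_add) operad_data
    \<Rightarrow> (nat \<Rightarrow> 'q \<Rightarrow> 'p) \<Rightarrow> bool" where
  "operad_hom Q P f \<longleftrightarrow>
     (\<forall>n. linear_between (op_scale Q) (op_scale P) (op_space Q n) (op_space P n) (f n)) \<and>
     f 1 (op_id Q) = op_id P \<and>
     (\<forall>n. \<forall>\<mu>\<in>op_space Q n. \<forall>\<sigma>. \<sigma> permutes {1..n} \<longrightarrow>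
        f n (op_act Q n \<mu> \<sigma>) = op_act P n (f n \<mu>) \<sigma>) \<and>
     (\<forall>m n i. \<forall>\<mu>\<in>op_space Q m. \<forall>\<nu>\<in>op_space Q n. 1 \<le> i \<and> i \<le> m \<longrightarrow>
        f (m + n - 1) (op_comp Q m n i \<mu> \<nu>) = op_comp P m n i (f m \<mu>) (f n \<nu>))"


section \<open>Finite presentations\<close>

text \<open>The operadic ideal generated by a set of homogeneous elements (given with their arities).\<close>

inductive operad_ideal ::
  "('k::field, 'p::ab_group_add) operad_data \<Rightarrow> (nat \<times> 'p) set \<Rightarrow> nat \<Rightarrow> 'p \<Rightarrow> bool"
  for P R where
    generator: "(n, r) \<in> R \<Longrightarrow> operad_ideal P R n r"
  | zero: "operad_ideal P R n 0"
  | add: "\<lbrakk>operad_ideal P R n x; operad_ideal P R n y\<rbrakk> \<Longrightarrow> operad_ideal P R n (x + y)"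
  | scale: "operad_ideal P R n x \<Longrightarrow> operad_ideal P R n (op_scale P c x)"
  | act: "\<lbrakk>operad_ideal P R n x; \<sigma> permutes {1..n}\<rbrakk> \<Longrightarrow> operad_ideal P R n (op_act P n x \<sigma>)"
  | comp_left: "\<lbrakk>operad_ideal P R m x; y \<in> op_space P n; 1 \<le> i; i \<le> m\<rbrakk> \<Longrightarrow>
      operad_ideal P R (m + n - 1) (op_comp P m n i x y)"
  | comp_right: "\<lbrakk>x \<in> op_space P m; operad_ideal P R n y; 1 \<le> i; i \<le> m\<rbrakk> \<Longrightarrow>
      operad_ideal P R (m + n - 1) (op_comp P m n i x y)"

text \<open>
  The free symmetric operad on the generators \<open>0, \<dots>, g - 1\<close>, where generator \<open>x\<close> has arity \<open>ar x\<close>: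
  its component of arity \<open>n\<close> has as basis the planar rooted trees whose inner vertices are decorated
  by generators, a vertex decorated by \<open>x\<close> having \<open>ar x\<close> ordered children, and whose leaves are
  labelled bijectively by \<open>1, \<dots>, n\<close>.  A leaf labelled \<open>i\<close> is input \<open>i\<close>.
\<close>

datatype tree = Leaf nat | Node nat "tree list"

primrec tree_leaves :: "tree \<Rightarrow> nat list" where
  "tree_leaves (Leaf j) = [j]"
| "tree_leaves (Node x ts) = concat (map tree_leaves ts)"

primrec tree_over :: "nat \<Rightarrow> (nat \<Rightarrow> nat) \<Rightarrow> tree \<Rightarrow> bool" where
  "tree_over g ar (Leaf j) \<longleftrightarrow> True"
| "tree_over g ar (Node x ts) \<longleftrightarrow> x < g \<and> length ts = ar x \<and> list_all (tree_over g ar) ts"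

primrec tree_subst :: "(nat \<Rightarrow> tree) \<Rightarrow> tree \<Rightarrow> tree" where
  "tree_subst f (Leaf j) = f j"
| "tree_subst f (Node x ts) = Node x (map (tree_subst f) ts)"

definition tree_relabel :: "(nat \<Rightarrow> nat) \<Rightarrow> tree \<Rightarrow> tree" where
  "tree_relabel h = tree_subst (\<lambda>j. Leaf (h j))"

definition trees :: "nat \<Rightarrow> (nat \<Rightarrow> nat) \<Rightarrow> nat \<Rightarrow> tree set" where
  "trees g ar n =
     {t. tree_over g ar t \<and> distinct (tree_leaves t) \<and> set (tree_leaves t) = {1..n}}"

definition tree_act :: "tree \<Rightarrow> (nat \<Rightarrow> nat) \<Rightarrow> tree" where
  "tree_act t \<sigma> = tree_relabel (inv_into UNIV \<sigma>) t"

definition tree_graft :: "nat \<Rightarrow> nat \<Rightarrow> tree \<Rightarrow> tree \<Rightarrow> tree" where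
  "tree_graft n i t u =
     tree_subst (\<lambda>j. if j = i then tree_relabel (\<lambda>k. i - 1 + k) u else Leaf (outer_slot n i j)) t"

definition free_operad ::
  "nat \<Rightarrow> (nat \<Rightarrow> nat) \<Rightarrow> ('k::field, tree \<Rightarrow>\<^sub>0 'k) operad_data" where
  "free_operad g ar =
     \<lparr>op_scale = (\<lambda>c p. Poly_Mapping.map (\<lambda>a. c * a) p),
      op_space = (\<lambda>n. {p. Poly_Mapping.keys p \<subseteq> trees g ar n}),
      op_act = (\<lambda>n p \<sigma>. \<Sum>t\<in>Poly_Mapping.keys p.
        Poly_Mapping.single (tree_act t \<sigma>) (Poly_Mapping.lookup p t)),
      op_id = Poly_Mapping.single (Leaf 1) 1,
      op_comp = (\<lambda>m n i p q. \<Sum>t\<in>Poly_Mapping.keys p. \<Sum>u\<in>Poly_Mapping.keys q.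
        Poly_Mapping.single (tree_graft n i t u)
          (Poly_Mapping.lookup p t * Poly_Mapping.lookup q u))\<rparr>"

text \<open>\<open>P\<close> is isomorphic to the quotient of the free operad on finitely many generators by the ideal
  generated by finitely many relations.\<close>

definition finitely_presented :: "('k::field, 'p::ab_group_add) operad_data \<Rightarrow> bool" where
  "finitely_presented P \<longleftrightarrow>
     (\<exists>(g::nat) (ar :: nat \<Rightarrow> nat) (R :: (nat \<times> (tree \<Rightarrow>\<^sub>0 'k)) set) \<pi>.
        finite R \<and>
        (\<forall>(n, r)\<in>R. r \<in> op_space (free_operad g ar) n) \<and>
        operad_hom (free_operad g ar) P \<pi> \<and>
        (\<forall>n. \<pi> n ` op_space (free_operad g ar) n = op_space P n) \<and>
        (\<forall>n. \<forall>p\<in>op_space (free_operad g ar) n.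
           \<pi> n p = 0 \<longleftrightarrow> operad_ideal (free_operad g ar) R n p))"


section \<open>Automorphisms and algebraic groups\<close>

definition Aut :: "('k::field, 'p::ab_group_add) operad_data \<Rightarrow> (nat \<Rightarrow> 'p \<Rightarrow> 'p) monoid" where
  "Aut P =
     \<lparr>carrier = {f. operad_hom P P f \<and>
        (\<forall>n. bij_betw (f n) (op_space P n) (op_space P n) \<and> f n \<in> extensional (op_space P n))},
      monoid.mult = (\<lambda>f g n. compose (op_space P n) (f n) (g n)),
      one = (\<lambda>n. \<lambda>x\<in>op_space P n. x)\<rparr>"

definition GL :: "nat \<Rightarrow> ('k::field mat) monoid" where
  "GL N = units_of (ring_mat TYPE('k) N ())"

inductive_set polynomial_functions :: "nat \<Rightarrow> ('k::field mat \<Rightarrow> 'k) set" for N where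
    const: "(\<lambda>A. c) \<in> polynomial_functions N"
  | entry: "\<lbrakk>i < N; j < N\<rbrakk> \<Longrightarrow> (\<lambda>A. A $$ (i, j)) \<in> polynomial_functions N"
  | add: "\<lbrakk>p \<in> polynomial_functions N; q \<in> polynomial_functions N\<rbrakk> \<Longrightarrow>
      (\<lambda>A. p A + q A) \<in> polynomial_functions N"
  | mult: "\<lbrakk>p \<in> polynomial_functions N; q \<in> polynomial_functions N\<rbrakk> \<Longrightarrow>
      (\<lambda>A. p A * q A) \<in> polynomial_functions N"

definition zariski_closed_in_GL :: "nat \<Rightarrow> 'k::field mat set \<Rightarrow> bool" where
  "zariski_closed_in_GL N H \<longleftrightarrow>
     (\<exists>S \<subseteq> polynomial_functions N. H = {A \<in> carrier (GL N). \<forall>p\<in>S. p A = 0})"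

text \<open>\<open>G\<close> is a group, and \<open>\<rho>\<close> identifies it with a Zariski closed subgroup of \<open>GL\<^sub>N\<close>.\<close>

definition closed_linear_embedding ::
  "('g, 'b) monoid_scheme \<Rightarrow> nat \<Rightarrow> ('g \<Rightarrow> 'k::field mat) \<Rightarrow> bool" where
  "closed_linear_embedding G N \<rho> \<longleftrightarrow>
     group G \<and> \<rho> \<in> hom G (GL N) \<and> inj_on \<rho> (carrier G) \<and> zariski_closed_in_GL N (\<rho> ` carrier G)"

text \<open>\<open>b 0, \<dots>, b (N - 1)\<close>, with \<open>b j\<close> of arity \<open>d j\<close>, is a homogeneous basis of the direct sum of
  the components of arity at most \<open>M\<close>.\<close>

definition homogeneous_basis ::
  "('k::field, 'p::ab_group_add) operad_data \<Rightarrow> nat \<Rightarrow> nat \<Rightarrow> (nat \<Rightarrow> nat) \<Rightarrow> (nat \<Rightarrow> 'p) \<Rightarrow> bool" where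
  "homogeneous_basis P M N d b \<longleftrightarrow>
     (\<forall>j<N. d j \<le> M) \<and>
     (\<forall>n\<le>M. inj_on b {j. j < N \<and> d j = n} \<and>
        \<not> Modules.module.dependent (op_scale P) (b ` {j. j < N \<and> d j = n}) \<and>
        Modules.module.span (op_scale P) (b ` {j. j < N \<and> d j = n}) = op_space P n)"

text \<open>The matrix, in such a basis, of the map induced by an arity-preserving family \<open>f\<close>;
  it is block diagonal and its columns are the coordinates of the images of basis vectors.\<close>

definition action_matrix ::
  "('k::field, 'p::ab_group_add) operad_data \<Rightarrow> nat \<Rightarrow> (nat \<Rightarrow> nat) \<Rightarrow> (nat \<Rightarrow> 'p)
    \<Rightarrow> (nat \<Rightarrow> 'p \<Rightarrow> 'p) \<Rightarrow> 'k mat" where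
  "action_matrix P N d b f = mat N N (\<lambda>(i, j).
     if d i = d j
     then Modules.module.representation (op_scale P) (b ` {l. l < N \<and> d l = d j}) (f (d j) (b j)) (b i)
     else 0)"


section \<open>Cohomology in degrees 0, 1 and 2\<close>

text \<open>Families of maps are normalised to be 0 outside their domains, so that they are determined by
  their restrictions to the components.  Scalars act on them pointwise.\<close>

definition ad :: "('k::field, 'p::ab_group_add) operad_data \<Rightarrow> 'p \<Rightarrow> nat \<Rightarrow> 'p \<Rightarrow> 'p" where
  "ad P \<kappa> n \<theta> =
     (if \<theta> \<in> op_space P n
      then op_comp P 1 n 1 \<kappa> \<theta> - (\<Sum>i = 1..n. op_comp P n 1 i \<theta> \<kappa>) else 0)"

definition H0 :: "('k::field, 'p::ab_group_add) operad_data \<Rightarrow> 'p set" where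
  "H0 P = {\<kappa> \<in> op_space P 1. ad P \<kappa> = 0}"

definition equivariant_endo ::
  "('k::field, 'p::ab_group_add) operad_data \<Rightarrow> (nat \<Rightarrow> 'p \<Rightarrow> 'p) set" where
  "equivariant_endo P = {D. \<forall>n.
     linear_between (op_scale P) (op_scale P) (op_space P n) (op_space P n) (D n) \<and>
     (\<forall>\<mu>. \<mu> \<notin> op_space P n \<longrightarrow> D n \<mu> = 0) \<and>
     (\<forall>\<mu>\<in>op_space P n. \<forall>\<sigma>. \<sigma> permutes {1..n} \<longrightarrow>
        D n (op_act P n \<mu> \<sigma>) = op_act P n (D n \<mu>) \<sigma>)}"

definition der :: "('k::field, 'p::ab_group_add) operad_data \<Rightarrow> (nat \<Rightarrow> 'p \<Rightarrow> 'p) set" where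
  "der P = {D \<in> equivariant_endo P.
     \<forall>m n i. \<forall>\<mu>\<in>op_space P m. \<forall>\<nu>\<in>op_space P n. 1 \<le> i \<and> i \<le> m \<longrightarrow>
       D (m + n - 1) (op_comp P m n i \<mu> \<nu>) =
       op_comp P m n i (D m \<mu>) \<nu> + op_comp P m n i \<mu> (D n \<nu>)}"

definition inner_der :: "('k::field, 'p::ab_group_add) operad_data \<Rightarrow> (nat \<Rightarrow> 'p \<Rightarrow> 'p) set" where
  "inner_der P = ad P ` op_space P 1"

definition scale_endo ::
  "('k::field, 'p::ab_group_add) operad_data \<Rightarrow> 'k \<Rightarrow> (nat \<Rightarrow> 'p \<Rightarrow> 'p) \<Rightarrow> nat \<Rightarrow> 'p \<Rightarrow> 'p" where
  "scale_endo P c D n \<mu> = op_scale P c (D n \<mu>)"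

type_synonym 'p cochain2 = "nat \<Rightarrow> nat \<Rightarrow> nat \<Rightarrow> 'p \<Rightarrow> 'p \<Rightarrow> 'p"

text \<open>Linear maps out of the tensor product are rendered as bilinear maps; \<^term>\<open>w m n i \<mu> \<nu>\<close> is the
  value at \<open>\<mu> \<otimes> \<nu>\<close> of the map of index \<open>i\<close>.\<close>

definition cochains2 :: "('k::field, 'p::ab_group_add) operad_data \<Rightarrow> 'p cochain2 set" where
  "cochains2 P = {w.
     (\<forall>m n i \<mu> \<nu>. \<not> (1 \<le> i \<and> i \<le> m \<and> \<mu> \<in> op_space P m \<and> \<nu> \<in> op_space P n) \<longrightarrow>
        w m n i \<mu> \<nu> = 0) \<and>
     (\<forall>m n i. 1 \<le> i \<and> i \<le> m \<longrightarrow>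
        (\<forall>\<nu>\<in>op_space P n. linear_between (op_scale P) (op_scale P)
           (op_space P m) (op_space P (m + n - 1)) (\<lambda>\<mu>. w m n i \<mu> \<nu>)) \<and>
        (\<forall>\<mu>\<in>op_space P m. linear_between (op_scale P) (op_scale P)
           (op_space P n) (op_space P (m + n - 1)) (\<lambda>\<nu>. w m n i \<mu> \<nu>)))}"

definition Z2 :: "('k::field, 'p::ab_group_add) operad_data \<Rightarrow> 'p cochain2 set" where
  "Z2 P = {w \<in> cochains2 P.
     (\<forall>l m n i j. \<forall>\<kappa>\<in>op_space P l. \<forall>\<mu>\<in>op_space P m. \<forall>\<nu>\<in>op_space P n.
        1 \<le> i \<and> i \<le> l \<and> 1 \<le> j \<and> j \<le> m \<longrightarrow>
        w (l + m - 1) n (i - 1 + j) (op_comp P l m i \<kappa> \<mu>) \<nu>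
          + op_comp P (l + m - 1) n (i - 1 + j) (w l m i \<kappa> \<mu>) \<nu> =
        w l (m + n - 1) i \<kappa> (op_comp P m n j \<mu> \<nu>)
          + op_comp P l (m + n - 1) i \<kappa> (w m n j \<mu> \<nu>)) \<and>
     (\<forall>l m n i k. \<forall>\<kappa>\<in>op_space P l. \<forall>\<mu>\<in>op_space P m. \<forall>\<nu>\<in>op_space P n.
        1 \<le> i \<and> i < k \<and> k \<le> l \<longrightarrow>
        w (l + m - 1) n (k - 1 + m) (op_comp P l m i \<kappa> \<mu>) \<nu>
          + op_comp P (l + m - 1) n (k - 1 + m) (w l m i \<kappa> \<mu>) \<nu> =
        w (l + n - 1) m i (op_comp P l n k \<kappa> \<nu>) \<mu>
          + op_comp P (l + n - 1) m i (w l n k \<kappa> \<nu>) \<mu>) \<and>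
     (\<forall>m n i \<sigma>. \<forall>\<mu>\<in>op_space P m. \<forall>\<nu>\<in>op_space P n.
        1 \<le> i \<and> i \<le> m \<and> \<sigma> permutes {1..n} \<longrightarrow>
        w m n i \<mu> (op_act P n \<nu> \<sigma>) =
        op_act P (m + n - 1) (w m n i \<mu> \<nu>) (inner_perm n i \<sigma>)) \<and>
     (\<forall>m n i \<phi>. \<forall>\<mu>\<in>op_space P m. \<forall>\<nu>\<in>op_space P n.
        1 \<le> i \<and> i \<le> m \<and> \<phi> permutes {1..m} \<longrightarrow>
        w m n i (op_act P m \<mu> \<phi>) \<nu> =
        op_act P (m + n - 1) (w m n (\<phi> i) \<mu> \<nu>) (outer_perm n i \<phi>))}"

definition coboundary2 ::
  "('k::field, 'p::ab_group_add) operad_data \<Rightarrow> (nat \<Rightarrow> 'p \<Rightarrow> 'p) \<Rightarrow> 'p cochain2" where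
  "coboundary2 P D m n i \<mu> \<nu> =
     (if 1 \<le> i \<and> i \<le> m \<and> \<mu> \<in> op_space P m \<and> \<nu> \<in> op_space P n
      then D (m + n - 1) (op_comp P m n i \<mu> \<nu>)
           - op_comp P m n i (D m \<mu>) \<nu> - op_comp P m n i \<mu> (D n \<nu>)
      else 0)"

definition B2 :: "('k::field, 'p::ab_group_add) operad_data \<Rightarrow> 'p cochain2 set" where
  "B2 P = coboundary2 P ` equivariant_endo P"

definition scale_cochain2 ::
  "('k::field, 'p::ab_group_add) operad_data \<Rightarrow> 'k \<Rightarrow> 'p cochain2 \<Rightarrow> 'p cochain2" where
  "scale_cochain2 P c w m n i \<mu> \<nu> = op_scale P c (w m n i \<mu> \<nu>)"

end

theory Submission
  imports Defs "HOL-Library.Product_Plus"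
begin

text \<open>
  Everything about \<open>P\<close> is read off from its generators and relations, through the universal property
  of the free operad: each choice of elements of an operad \<open>Q\<close>, one of the right arity for each
  generator, extends to a unique homomorphism from the free operad to \<open>Q\<close> (\<open>free_extension_hom\<close>,
  \<open>free_hom_unique\<close>).  A planar tree is evaluated by iterated partial composition, a tree with
  numbered leaves by letting the numbering act on the value of the planar tree; the associativity and
  equivariance axioms turn grafting into composition.  Uniqueness holds because grafting produces
  every tree from trees with one inner vertex (\<open>tree_generation\<close>).

  Degrees 0 and 1: \<open>H0 P\<close> lies in the finite-dimensional space of unary operations, and a derivation
  is determined by its values on the finitely many generators.

  Degree 2: for a cocycle \<open>w\<close>, deforming the composition of \<open>P\<close> by \<open>\<epsilon>w\<close> gives an operad
  \<open>P + \<epsilon>P\<close> with \<open>\<epsilon>\<^sup>2 = 0\<close> (\<open>deformed_operad_is_operad\<close>).  The presentation \<open>\<pi>\<close> lifts to a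
  homomorphism \<open>\<pi> + \<epsilon>\<delta>\<close> from the free operad to this operad.  If \<open>\<delta>\<close> vanishes on the relations, then
  it vanishes on the ideal that they generate and descends to \<open>P\<close>; the resulting endomorphism has
  coboundary \<open>w\<close>.  Hence the class of \<open>w\<close> is controlled by the finitely many values of \<open>\<delta>\<close> on the
  relations, each of which lies in a finite-dimensional space.

  Automorphisms: choose \<open>M\<close> at least as large as the arities of the generators.  An automorphism is
  determined by its matrix on the components of arity at most \<open>M\<close>.  Conversely, a matrix \<open>A\<close> moves the
  generators, hence defines a homomorphism from the free operad to \<open>P\<close> whose values are polynomial in
  \<open>A\<close> (\<open>moved_hom_polynomial\<close>).  The matrix comes from an endomorphism of \<open>P\<close> as soon as this
  homomorphism kills the kernel of \<open>\<pi>\<close> and acts on the chosen basis as \<open>A\<close> does, and these are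
  polynomial equations.  When \<open>A\<close> is invertible the endomorphism is surjective, because it reaches the
  generators, and therefore bijective, because the components are finite-dimensional.
\<close>

section \<open>Linear algebra on subspaces\<close>

lemma linear_between_closed: "\<lbrakk>linear_between s t V W f; x \<in> V\<rbrakk> \<Longrightarrow> f x \<in> W"
  and linear_between_add: "\<lbrakk>linear_between s t V W f; x \<in> V; y \<in> V\<rbrakk> \<Longrightarrow> f (x + y) = f x + f y"
  and linear_between_scale: "\<lbrakk>linear_between s t V W f; x \<in> V\<rbrakk> \<Longrightarrow> f (s c x) = t c (f x)"
  by (auto simp: linear_between_def)

lemma linear_between_zero:
  assumes "linear_between s t V W f" "0 \<in> V"
  shows "f 0 = 0"
  using linear_between_add[OF assms(1) assms(2) assms(2)] by simp

context vector_space
begin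

lemma linear_between_diff:
  assumes "linear_between scale t V W f" "subspace V" "x \<in> V" "y \<in> V"
  shows "f (x - y) = f x - f y"
proof -
  have "f (x - y + y) = f (x - y) + f y"
    using assms by (intro linear_between_add[OF assms(1)]) (auto intro: subspace_diff)
  then show ?thesis by simp
qed

lemma linear_between_sum:
  assumes f: "linear_between scale t V W f" and V: "subspace V"
    and x: "\<And>v. v \<in> S \<Longrightarrow> x v \<in> V"
  shows "f (\<Sum>v\<in>S. scale (c v) (x v)) = (\<Sum>v\<in>S. t (c v) (f (x v)))"
  using x
proof (induction S rule: infinite_finite_induct)
  case (insert a S)
  have "f (scale (c a) (x a) + (\<Sum>v\<in>S. scale (c v) (x v)))
      = f (scale (c a) (x a)) + f (\<Sum>v\<in>S. scale (c v) (x v))"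
    using insert.prems V
    by (intro linear_between_add[OF f]) (auto intro!: subspace_sum subspace_scale)
  with insert show ?case by (simp add: linear_between_scale[OF f])
qed (use linear_between_zero[OF f] subspace_0[OF V] in auto)

lemma finite_spanning_subset:
  assumes "finite F" "Y \<subseteq> span F"
  obtains S where "finite S" "S \<subseteq> Y" "Y \<subseteq> span S"
  using maximal_independent_subset[of Y] independent_span_bound[OF assms(1)] assms(2)
  by (metis order_trans)

lemma finite_dimensional_subset:
  assumes "finite_dimensional scale V" "Y \<subseteq> V"
  shows "finite_dimensional scale Y"
  using assms finite_spanning_subset unfolding finite_dimensional_def by (metis order_trans)

lemma finite_basis_exists:
  assumes "finite_dimensional scale V" "subspace V"
  obtains B where "finite B" "independent B" "span B = V"
proof -
  obtain F where F: "finite F" "F \<subseteq> V" "V \<subseteq> span F"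
    using assms(1) by (auto simp: finite_dimensional_def)
  obtain B where B: "B \<subseteq> V" "independent B" "V \<subseteq> span B"
    using maximal_independent_subset by blast
  have "finite B" using independent_span_bound[OF F(1) B(2)] B(1) F(3) by blast
  with B that span_minimal[OF B(1) assms(2)] show ?thesis by blast
qed

text \<open>Preimages of a basis together with a nonzero element of the kernel would be independent,
  and more numerous than the basis.\<close>

lemma surjective_endomorphism_injective:
  assumes f: "linear_between scale scale V V f" and V: "subspace V"
    and fd: "finite_dimensional scale V" and surj: "V \<subseteq> f ` V"
  shows "inj_on f V"
proof -
  obtain B where B: "finite B" "independent B" "span B = V"
    using finite_basis_exists[OF fd V] .
  have BV: "B \<subseteq> V" using B span_superset by blast
  then have "\<forall>b\<in>B. \<exists>x. x \<in> V \<and> f x = b" using surj by blast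
  then obtain h where h: "\<And>b. b \<in> B \<Longrightarrow> h b \<in> V" "\<And>b. b \<in> B \<Longrightarrow> f (h b) = b"
    unfolding bchoice_iff by blast
  have inj: "inj_on h B" using h(2) by (rule inj_on_inverseI)
  have f_sum: "f (\<Sum>b\<in>B. scale (c b) (h b)) = (\<Sum>b\<in>B. scale (c b) b)" for c
    using linear_between_sum[OF f V, of B h c] h by simp
  have zero: "c b = 0" if "f (\<Sum>b\<in>B. scale (c b) (h b)) = 0" "b \<in> B" for c b
    using independentD[OF B(2) B(1) subset_refl, of c] that f_sum by simp
  have span_h: "\<exists>c. x = (\<Sum>b\<in>B. scale (c b) (h b))" if "x \<in> span (h ` B)" for x
    using that B(1) by (auto simp: span_finite sum.reindex[OF inj])
  have indep: "independent (h ` B)"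
  proof (rule independent_if_scalars_zero)
    fix c x assume "(\<Sum>x\<in>h ` B. scale (c x) x) = 0" "x \<in> h ` B"
    then show "c x = 0"
      using zero[of "c \<circ> h"] linear_between_zero[OF f subspace_0[OF V]]
      by (auto simp: sum.reindex[OF inj])
  qed (use B in auto)
  have kernel: "x = 0" if x: "x \<in> V" "f x = 0" for x
  proof (rule ccontr)
    assume "x \<noteq> 0"
    have "x \<notin> span (h ` B)"
    proof
      assume "x \<in> span (h ` B)"
      then obtain c where c: "x = (\<Sum>b\<in>B. scale (c b) (h b))" using span_h by blast
      then have "x = 0" using zero[of c] x(2) by simp
      with \<open>x \<noteq> 0\<close> show False by simp
    qed
    moreover from this have "x \<notin> h ` B" using span_base by blast
    ultimately have "independent (insert x (h ` B))" "card (insert x (h ` B)) = Suc (card B)"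
      using indep B(1) by (simp_all add: independent_insert card_image[OF inj])
    moreover have "insert x (h ` B) \<subseteq> span B" using x h B(3) by auto
    ultimately show False using independent_span_bound[OF B(1), of "insert x (h ` B)"] by simp
  qed
  show ?thesis
  proof (rule inj_onI)
    fix x y assume "x \<in> V" "y \<in> V" "f x = f y"
    then have "f (x - y) = 0" "x - y \<in> V"
      using linear_between_diff[OF f V] V by (auto intro: subspace_diff)
    then have "x - y = 0" by (rule kernel[rotated])
    then show "x = y" by simp
  qed
qed

text \<open>The vectors \<open>(\<phi> z x)\<^sub>x\<close> lie in the direct sum of the \<open>W x\<close>, so finitely many of them span
  all the others; the corresponding \<open>z\<close> span \<open>Z\<close> modulo \<open>B\<close>.  The function \<open>\<phi>\<close> may be
  built from choices; the last hypothesis, on linear dependences, is the form in which linearity and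
  knowledge of the kernel enter.\<close>

lemma finite_dimensional_quotientI:
  fixes \<phi> :: "'z::ab_group_add \<Rightarrow> 'i \<Rightarrow> 'b"
  assumes X: "finite X" and W: "\<And>x. x \<in> X \<Longrightarrow> finite_dimensional scale (W x)"
    and \<phi>: "\<And>z x. \<lbrakk>z \<in> Z; x \<in> X\<rbrakk> \<Longrightarrow> \<phi> z x \<in> W x"
    and B: "\<And>z S c. \<lbrakk>z \<in> Z; finite S; S \<subseteq> Z; \<forall>x\<in>X. \<phi> z x = (\<Sum>v\<in>S. scale (c v) (\<phi> v x))\<rbrakk>
      \<Longrightarrow> z - (\<Sum>v\<in>S. sz (c v) v) \<in> B"
  shows "finite_dimensional_quotient sz Z B"
proof -
  define sf :: "'a \<Rightarrow> ('i \<Rightarrow> 'b) \<Rightarrow> 'i \<Rightarrow> 'b" where "sf c h x = scale c (h x)" for c h x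
  interpret F: vector_space sf
    by standard (auto simp: sf_def fun_eq_iff scale_right_distrib scale_left_distrib)
  define r where "r z x = (if x \<in> X then \<phi> z x else 0)" for z x
  have "\<forall>x\<in>X. \<exists>F. finite F \<and> W x \<subseteq> span F" using W unfolding finite_dimensional_def by blast
  then obtain G where G: "\<And>x. x \<in> X \<Longrightarrow> finite (G x)" "\<And>x. x \<in> X \<Longrightarrow> W x \<subseteq> span (G x)"
    by metis
  define e :: "'i \<Rightarrow> 'b \<Rightarrow> 'i \<Rightarrow> 'b" where "e x y = (\<lambda>x'. if x' = x then y else 0)" for x y
  define E where "E = (\<Union>x\<in>X. e x ` G x)"
  have "finite E" using X G by (auto simp: E_def)
  have "e x y \<in> F.span E" if "x \<in> X" "y \<in> span (G x)" for x y
    using that(2)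
  proof (induction rule: span_induct_alt)
    case base
    have "e x 0 = 0" by (auto simp: e_def)
    then show ?case by (simp only: F.span_zero)
  next
    case (step c u y)
    have "e x (scale c u + y) = sf c (e x u) + e x y" by (auto simp: e_def sf_def)
    moreover have "e x u \<in> E" using step that by (auto simp: E_def)
    ultimately show ?case using F.span_add[OF F.span_scale[OF F.span_base]] step(2) by metis
  qed
  moreover have "r z = (\<Sum>x\<in>X. e x (\<phi> z x))" for z
  proof
    fix x
    have "(\<Sum>x'\<in>X. e x' (\<phi> z x')) x = (\<Sum>x'\<in>X. e x' (\<phi> z x') x)"
      by (induction X rule: infinite_finite_induct) auto
    then show "r z x = (\<Sum>x\<in>X. e x (\<phi> z x)) x" using X by (simp add: r_def e_def)
  qed
  ultimately have "r ` Z \<subseteq> F.span E" using \<phi> G by (fastforce intro!: F.span_sum)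
  then obtain Y where Y: "finite Y" "Y \<subseteq> r ` Z" "r ` Z \<subseteq> F.span Y"
    using F.finite_spanning_subset[OF \<open>finite E\<close>] by metis
  obtain S where S: "S \<subseteq> Z" "inj_on r S" "Y = r ` S"
    using Y(2) by (meson subset_image_inj)
  have "finite S" using S Y finite_imageD by blast
  have "\<exists>c. z - (\<Sum>v\<in>S. sz (c v) v) \<in> B" if z: "z \<in> Z" for z
  proof -
    have "r z \<in> F.span Y" using Y z by auto
    then obtain u where "r z = (\<Sum>v\<in>S. sf (u (r v)) (r v))"
      using Y(1) S by (auto simp: F.span_finite sum.reindex)
    moreover have "(\<Sum>v\<in>S. sf (c v) (r v)) x = (\<Sum>v\<in>S. scale (c v) (r v x))" for c x
      by (induction S rule: infinite_finite_induct) (auto simp: sf_def)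
    ultimately have "\<forall>x\<in>X. \<phi> z x = (\<Sum>v\<in>S. scale (u (r v)) (\<phi> v x))"
      by (auto simp: r_def fun_eq_iff split: if_splits)
    from B[OF z \<open>finite S\<close> S(1), of "u \<circ> r"] this show ?thesis by (auto simp: comp_def)
  qed
  then show ?thesis unfolding finite_dimensional_quotient_def using \<open>finite S\<close> S by blast
qed

end

section \<open>Trees\<close>

lemma tree_leaves_subst: "tree_leaves (tree_subst f t) = concat (map (\<lambda>j. tree_leaves (f j)) (tree_leaves t))"
proof (induction t)
  case (Node x ts)
  then have "map (\<lambda>t. tree_leaves (tree_subst f t)) ts
      = map (\<lambda>t. concat (map (\<lambda>j. tree_leaves (f j)) (tree_leaves t))) ts" by simp
  then show ?case by (simp add: comp_def map_concat) (induction ts; simp)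
qed simp

lemma tree_over_subst:
  assumes "tree_over g ar t" "\<And>j. j \<in> set (tree_leaves t) \<Longrightarrow> tree_over g ar (f j)"
  shows "tree_over g ar (tree_subst f t)"
  using assms by (induction t) (auto simp: list_all_iff)

lemma tree_subst_cong:
  assumes "\<And>j. j \<in> set (tree_leaves t) \<Longrightarrow> f j = f' j"
  shows "tree_subst f t = tree_subst f' t"
  using assms by (induction t) auto

lemma tree_subst_subst: "tree_subst f (tree_subst h t) = tree_subst (\<lambda>j. tree_subst f (h j)) t"
  by (induction t) auto

lemma tree_subst_Leaf: "tree_subst Leaf t = t"
  by (induction t) (auto simp: map_idI)

lemma tree_relabel_simps [simp]:
  "tree_relabel h (Leaf j) = Leaf (h j)"
  "tree_relabel h (Node x ts) = Node x (map (tree_relabel h) ts)"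
  by (simp_all add: tree_relabel_def)

lemma tree_leaves_relabel: "tree_leaves (tree_relabel h t) = map h (tree_leaves t)"
  by (simp add: tree_relabel_def tree_leaves_subst)

lemma tree_over_relabel: "tree_over g ar t \<Longrightarrow> tree_over g ar (tree_relabel h t)"
  by (simp add: tree_relabel_def tree_over_subst)

lemma tree_relabel_relabel: "tree_relabel h (tree_relabel h' t) = tree_relabel (h \<circ> h') t"
  by (simp add: tree_relabel_def tree_subst_subst comp_def)

lemma size_tree_relabel: "size (tree_relabel h t) = size t"
  by (induction t) (auto simp: size_list_conv_sum_list comp_def cong: map_cong)

lemma tree_leaves_act: "tree_leaves (tree_act t \<sigma>) = map (inv_into UNIV \<sigma>) (tree_leaves t)"
  by (simp add: tree_act_def tree_leaves_relabel)

lemma tree_act_in_trees: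
  assumes "t \<in> trees g ar n" "\<sigma> permutes {1..n}"
  shows "tree_act t \<sigma> \<in> trees g ar n"
proof -
  have "inv_into UNIV \<sigma> permutes {1..n}" using assms(2) by (rule permutes_inv)
  then have "inv_into UNIV \<sigma> ` {1..n} = {1..n}" "inj_on (inv_into UNIV \<sigma>) {1..n}"
    by (auto simp: permutes_image permutes_inj_on)
  with assms(1) show ?thesis
    by (simp add: trees_def tree_leaves_act distinct_map tree_act_def tree_over_relabel tree_leaves_relabel)
qed

lemma length_trees: "t \<in> trees g ar n \<Longrightarrow> length (tree_leaves t) = n"
  using distinct_card[of "tree_leaves t"] by (auto simp: trees_def)

lemma concat_map_single: "(\<And>x. x \<in> set xs \<Longrightarrow> f x = [h x]) \<Longrightarrow> concat (map f xs) = map h xs"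
  by (induction xs) auto

lemma tree_leaves_graft:
  assumes "distinct (tree_leaves t)" "tree_leaves t = L1 @ i # L2"
  shows "tree_leaves (tree_graft n i t u)
    = map (outer_slot n i) L1 @ map (\<lambda>k. i - 1 + k) (tree_leaves u) @ map (outer_slot n i) L2"
proof -
  have "i \<notin> set L1" "i \<notin> set L2" using assms by auto
  then have "concat (map (\<lambda>j. tree_leaves (if j = i then tree_relabel (\<lambda>k. i - 1 + k) u
      else Leaf (outer_slot n i j))) L) = map (outer_slot n i) L" if "L \<in> {L1, L2}" for L
    using that by (intro concat_map_single) auto
  then show ?thesis
    using assms by (simp add: tree_graft_def tree_leaves_subst tree_leaves_relabel)
qed

lemma outer_slot_image:
  assumes "1 \<le> i" "i \<le> m"
  shows "outer_slot n i ` ({1..m} - {i}) = {1..<i} \<union> {i + n..<m + n}"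
proof (intro equalityI subsetI)
  fix k assume k: "k \<in> {1..<i} \<union> {i + n..<m + n}"
  show "k \<in> outer_slot n i ` ({1..m} - {i})"
  proof (cases "k < i")
    case True
    with k assms show ?thesis by (auto intro!: image_eqI[of _ _ k] simp: outer_slot_def)
  next
    case False
    with k assms show ?thesis by (auto intro!: image_eqI[of _ _ "k + 1 - n"] simp: outer_slot_def)
  qed
qed (use assms in \<open>auto simp: outer_slot_def\<close>)

lemma tree_graft_in_trees:
  assumes t: "t \<in> trees g ar m" and u: "u \<in> trees g ar n" and i: "1 \<le> i" "i \<le> m"
  shows "tree_graft n i t u \<in> trees g ar (m + n - 1)"
proof -
  have dt: "distinct (tree_leaves t)" and st: "set (tree_leaves t) = {1..m}" using t by (auto simp: trees_def)
  have "i \<in> set (tree_leaves t)" using st i by auto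
  then obtain L1 L2 where L: "tree_leaves t = L1 @ i # L2" by (meson split_list)
  have i_notin: "i \<notin> set L1" "i \<notin> set L2" "set L1 \<inter> set L2 = {}" using dt L by auto
  have sets: "set L1 \<union> set L2 = {1..m} - {i}" using st L dt by auto
  note leaves = tree_leaves_graft[OF dt L, of n u]
  have shift: "(\<lambda>k. i - 1 + k) ` {1..n} = {i..<i + n}"
    using i image_add_atLeastAtMost[of "i - 1" 1 n] by auto
  have "set (tree_leaves (tree_graft n i t u)) = outer_slot n i ` ({1..m} - {i}) \<union> {i..<i + n}"
    using u shift unfolding leaves sets[symmetric] by (auto simp: trees_def)
  also have "\<dots> = {1..m + n - 1}" unfolding outer_slot_image[OF i] using i by auto
  finally have 1: "set (tree_leaves (tree_graft n i t u)) = {1..m + n - 1}" .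
  have "length (tree_leaves (tree_graft n i t u)) = m + n - 1"
    using length_trees[OF t] length_trees[OF u] L unfolding leaves by simp
  \<comment> \<open>As many leaves as labels, so no label occurs twice.\<close>
  then have 2: "distinct (tree_leaves (tree_graft n i t u))" using 1 by (intro card_distinct) simp
  have "tree_over g ar (tree_graft n i t u)" using t u
    unfolding tree_graft_def by (intro tree_over_subst) (auto simp: trees_def tree_over_relabel)
  with 1 2 show ?thesis by (simp add: trees_def)
qed

section \<open>The free operad and its generation by corollas\<close>

definition corolla :: "(nat \<Rightarrow> nat) \<Rightarrow> nat \<Rightarrow> tree" where
  "corolla ar x = Node x (map Leaf [1..<Suc (ar x)])"

abbreviation tree_monomial :: "tree \<Rightarrow> tree \<Rightarrow>\<^sub>0 'k::field" where
  "tree_monomial t \<equiv> Poly_Mapping.single t 1"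

lemma tree_leaves_corolla: "tree_leaves (corolla ar x) = [1..<Suc (ar x)]"
  by (simp add: corolla_def comp_def concat_map_single[of _ _ "\<lambda>x. x"] del: upt_Suc)

lemma corolla_in_trees: "x < g \<Longrightarrow> corolla ar x \<in> trees g ar (ar x)"
  using tree_leaves_corolla[of ar x] by (auto simp: trees_def corolla_def list_all_iff simp del: upt_Suc)

lemma free_space_iff: "p \<in> op_space (free_operad g ar) n \<longleftrightarrow> Poly_Mapping.keys p \<subseteq> trees g ar n"
  by (simp add: free_operad_def)

lemma free_act: "op_act (free_operad g ar) n p \<sigma> = (\<Sum>t\<in>Poly_Mapping.keys p.
        Poly_Mapping.single (tree_act t \<sigma>) (Poly_Mapping.lookup p t))"
  by (simp add: free_operad_def)

lemma free_comp: "op_comp (free_operad g ar) m n i p q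
    = (\<Sum>t\<in>Poly_Mapping.keys p. \<Sum>u\<in>Poly_Mapping.keys q.
        Poly_Mapping.single (tree_graft n i t u)
          (Poly_Mapping.lookup p t * Poly_Mapping.lookup q u))"
  by (simp add: free_operad_def)

lemma lookup_free_scale:
  "Poly_Mapping.lookup (op_scale (free_operad g ar) c p) t = c * Poly_Mapping.lookup p t"
  by (auto simp: free_operad_def Poly_Mapping.map.rep_eq when_def)

lemma free_scale_single:
  "op_scale (free_operad g ar) c (Poly_Mapping.single t a) = Poly_Mapping.single t (c * a)"
  by (intro poly_mapping_eqI) (simp add: lookup_free_scale lookup_single when_def)

lemma free_vector_space: "vector_space (op_scale (free_operad g ar))"
  by standard
    (auto intro!: poly_mapping_eqI simp: lookup_free_scale lookup_add algebra_simps)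

lemma sum_monomials:
  "(\<Sum>t\<in>Poly_Mapping.keys p. Poly_Mapping.single t (Poly_Mapping.lookup p t)) = p"
  by (intro poly_mapping_eqI) (auto simp: lookup_sum lookup_single when_def in_keys_iff)

lemma free_space_0: "0 \<in> op_space (free_operad g ar) n"
  and free_space_add: "\<lbrakk>p \<in> op_space (free_operad g ar) n; q \<in> op_space (free_operad g ar) n\<rbrakk>
    \<Longrightarrow> p + q \<in> op_space (free_operad g ar) n"
  and free_space_scale: "p \<in> op_space (free_operad g ar) n
    \<Longrightarrow> op_scale (free_operad g ar) c p \<in> op_space (free_operad g ar) n"
  and free_space_single: "t \<in> trees g ar n \<Longrightarrow> Poly_Mapping.single t a \<in> op_space (free_operad g ar) n"
  using Poly_Mapping.keys_add[of p q]
  by (auto simp: free_space_iff in_keys_iff lookup_free_scale lookup_single when_def split: if_splits)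

lemma free_subspace: "module.subspace (op_scale (free_operad g ar)) (op_space (free_operad g ar) n)"
proof -
  interpret vector_space "op_scale (free_operad g ar)" by (rule free_vector_space)
  show ?thesis
    by (auto simp: subspace_def free_space_0 free_space_add free_space_scale)
qed

lemma free_space_sum:
  "(\<And>x. x \<in> X \<Longrightarrow> f x \<in> op_space (free_operad g ar) n) \<Longrightarrow> sum f X \<in> op_space (free_operad g ar) n"
  by (induction X rule: infinite_finite_induct) (auto simp: free_space_0 free_space_add)

lemma free_space_act:
  "\<lbrakk>p \<in> op_space (free_operad g ar) n; \<sigma> permutes {1..n}\<rbrakk>
    \<Longrightarrow> op_act (free_operad g ar) n p \<sigma> \<in> op_space (free_operad g ar) n"
  unfolding free_act
  by (intro free_space_sum free_space_single tree_act_in_trees) (auto simp: free_space_iff)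

lemma free_space_comp:
  "\<lbrakk>p \<in> op_space (free_operad g ar) m; q \<in> op_space (free_operad g ar) n; 1 \<le> i; i \<le> m\<rbrakk>
    \<Longrightarrow> op_comp (free_operad g ar) m n i p q \<in> op_space (free_operad g ar) (m + n - 1)"
  unfolding free_comp
  by (intro free_space_sum free_space_single tree_graft_in_trees) (auto simp: free_space_iff)

lemma free_ideal_in_space:
  assumes "\<forall>(n, r)\<in>R. r \<in> op_space (free_operad g ar) n" "operad_ideal (free_operad g ar) R n p"
  shows "p \<in> op_space (free_operad g ar) n"
  using assms(2)
  by induction (use assms(1) in \<open>auto simp: free_space_0 free_space_add free_space_scale
      free_space_act intro!: free_space_comp[simplified]\<close>)

lemma free_act_monomial:
  "op_act (free_operad g ar) n (tree_monomial t) \<sigma> = tree_monomial (tree_act t \<sigma>)"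
  by (simp add: free_act)

lemma free_comp_monomial:
  "op_comp (free_operad g ar) m n i (tree_monomial t) (tree_monomial u)
    = tree_monomial (tree_graft n i t u)"
  by (simp add: free_comp)

text \<open>Only the values of \<open>h\<close> on the labels of \<open>t\<close> matter, and there it is a permutation.\<close>

lemma relabel_eq_act:
  assumes t: "t \<in> trees g ar n" and t': "tree_relabel h t \<in> trees g ar n"
  obtains \<sigma> where "\<sigma> permutes {1..n}" "t = tree_act (tree_relabel h t) \<sigma>"
proof -
  define \<sigma> where "\<sigma> j = (if j \<in> {1..n} then h j else j)" for j
  have "inj_on h {1..n}" "h ` {1..n} = {1..n}"
    using t t' by (auto simp: trees_def tree_leaves_relabel distinct_map)
  then have "bij_betw h {1..n} {1..n}" by (simp add: bij_betw_def)
  moreover have "\<And>j. j \<in> {1..n} \<Longrightarrow> h j = \<sigma> j" by (simp add: \<sigma>_def)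
  ultimately have "bij_betw \<sigma> {1..n} {1..n}" by (metis bij_betw_cong)
  then have \<sigma>: "\<sigma> permutes {1..n}" by (rule bij_imp_permutes) (auto simp: \<sigma>_def)
  have "tree_relabel h t = tree_relabel \<sigma> t"
    unfolding tree_relabel_def using t by (intro tree_subst_cong) (auto simp: trees_def \<sigma>_def)
  then have "tree_act (tree_relabel h t) \<sigma> = tree_relabel (inv_into UNIV \<sigma> \<circ> \<sigma>) t"
    by (simp add: tree_act_def tree_relabel_relabel)
  also have "\<dots> = t"
    using permutes_inv_o(2)[OF \<sigma>] by (simp add: tree_relabel_def tree_subst_Leaf)
  finally show ?thesis using that \<sigma> by simp
qed

lemma exists_numbering:
  assumes "finite A" "card A = n"
  obtains h :: "nat \<Rightarrow> nat" where "bij_betw h A {1..n}"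
  using assms finite_same_card_bij[of A "{1..n}"] by auto

lemma numbered_in_trees:
  assumes "tree_over g ar t" "distinct (tree_leaves t)" "bij_betw h (set (tree_leaves t)) {1..n}"
  shows "tree_relabel h t \<in> trees g ar n"
  using assms by (auto simp: trees_def tree_over_relabel tree_leaves_relabel distinct_map bij_betw_def)

text \<open>A tree with a child that is not a leaf arises, up to the numbering of its leaves, by grafting
  that child into the smaller tree where it is cut off.  So grafting and renumbering produce all trees
  from corollas.\<close>

lemma tree_generation:
  assumes leaf: "S 1 (Leaf 1)"
    and corolla: "\<And>x. x < g \<Longrightarrow> S (ar x) (corolla ar x)"
    and act: "\<And>n t \<sigma>. \<lbrakk>t \<in> trees g ar n; S n t; \<sigma> permutes {1..n}\<rbrakk> \<Longrightarrow> S n (tree_act t \<sigma>)"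
    and graft: "\<And>m n i t u. \<lbrakk>t \<in> trees g ar m; u \<in> trees g ar n; S m t; S n u; 1 \<le> i; i \<le> m\<rbrakk>
      \<Longrightarrow> S (m + n - 1) (tree_graft n i t u)"
    and t: "t \<in> trees g ar n"
  shows "S n t"
  using t
proof (induction "size t" arbitrary: t n rule: less_induct)
  case less
  have relabel: "S n t" if "tree_relabel h t \<in> trees g ar n" "S n (tree_relabel h t)" for h
    using relabel_eq_act[OF less.prems that(1)] act that by metis
  show ?case
  proof (cases t)
    case (Leaf j)
    then have "{1..n} = {j}" using less.prems by (auto simp: trees_def)
    then have "n = 1" "j = 1" by (auto simp: atLeastAtMost_singleton_iff)
    with leaf Leaf show ?thesis by simp
  next
    case (Node x ts)
    have x: "x < g" "length ts = ar x" and over: "list_all (tree_over g ar) ts"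
      and dist: "distinct (tree_leaves t)" and labels: "set (tree_leaves t) = {1..n}"
      using less.prems Node by (auto simp: trees_def)
    show ?thesis
    proof (cases "\<exists>t0\<in>set ts. size t0 \<noteq> 0")
      case False
      then have "\<exists>j. t0 = Leaf j" if "t0 \<in> set ts" for t0 using that by (cases t0) auto
      then have "\<exists>js. ts = map Leaf js" unfolding ex_map_conv by blast
      then obtain js where js: "ts = map Leaf js" by blast
      then have leaves: "tree_leaves t = js"
        using Node by (simp add: comp_def concat_map_single[of _ _ "\<lambda>x. x"])
      then have n: "ar x = n" using length_trees[OF less.prems] js x by simp
      define h where "h j = Suc (the_inv_into {..<length js} ((!) js) j)" for j
      have "corolla ar x = tree_relabel h t"
      proof -
        have "inj_on ((!) js) {..<length js}" using dist leaves by (auto simp: inj_on_nth)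
        then have "map h js = [1..<Suc (length js)]"
          by (intro nth_equalityI) (auto simp: h_def the_inv_into_f_f simp del: upt_Suc)
        from this[symmetric] show ?thesis using Node js x by (simp add: corolla_def comp_def del: upt_Suc)
      qed
      from this[symmetric] show ?thesis
        using relabel[of h] corolla[OF x(1)] corolla_in_trees[OF x(1), of ar] n by simp
    next
      case True
      then obtain xs t0 ys where ts: "ts = xs @ t0 # ys" and t0: "size t0 \<noteq> 0"
        using split_list by metis
      define K where "K = set (tree_leaves t0)"
      define L1 where "L1 = concat (map tree_leaves xs)"
      define L2 where "L2 = concat (map tree_leaves ys)"
      have leaves: "tree_leaves t = L1 @ tree_leaves t0 @ L2" by (simp add: Node ts L1_def L2_def)
      \<comment> \<open>The leaves of \<open>t\<close> carry positive labels, so 0 can mark the place where \<open>t0\<close> was cut off.\<close>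
      define s0 where "s0 = Node x (xs @ Leaf 0 # ys)"
      have s0_leaves: "tree_leaves s0 = L1 @ 0 # L2" by (simp add: s0_def L1_def L2_def)
      have "0 \<notin> set (tree_leaves t)" using labels by simp
      then have zero: "0 \<notin> set L1" "0 \<notin> set L2" "0 \<notin> K" using leaves by (auto simp: K_def)
      have s0_dist: "distinct (tree_leaves s0)" using dist zero unfolding s0_leaves leaves by auto
      obtain h where h: "bij_betw h (set (tree_leaves s0)) {1..card (set (tree_leaves s0))}"
        using exists_numbering[OF _ refl] by blast
      obtain h0 where h0: "bij_betw h0 K {1..card K}"
        using exists_numbering[OF _ refl, of K] K_def by blast
      define m where "m = card (set (tree_leaves s0))"
      define s where "s = tree_relabel h s0"
      define u where "u = tree_relabel h0 t0"
      define i where "i = h 0"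
      have s: "s \<in> trees g ar m" unfolding s_def m_def
        by (rule numbered_in_trees[OF _ s0_dist h])
          (use over x in \<open>auto simp: s0_def ts list_all_iff\<close>)
      have u: "u \<in> trees g ar (card K)" unfolding u_def
        by (rule numbered_in_trees)
          (use over dist h0 in \<open>auto simp: ts leaves list_all_iff K_def\<close>)
      have i: "1 \<le> i" "i \<le> m" using h by (auto simp: i_def m_def bij_betw_def s0_leaves)
      have m: "m = Suc (length L1 + length L2)"
        using distinct_card[OF s0_dist] by (simp add: m_def s0_leaves)
      have K: "card K = length (tree_leaves t0)"
        using distinct_card[of "tree_leaves t0"] dist leaves by (simp add: K_def)
      have n: "m + card K - 1 = n" using length_trees[OF less.prems] m K leaves by simp
      have "size s0 < size t" using t0 by (simp add: s0_def Node ts)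
      then have size_s: "size s < size t" by (simp add: s_def size_tree_relabel)
      have size_u: "size u < size t" by (simp add: u_def Node ts size_tree_relabel)
      \<comment> \<open>The renumbering that turns \<open>t\<close> into the result of grafting \<open>u\<close> into \<open>s\<close>.\<close>
      define \<rho> where "\<rho> a = (if a \<in> K then i - 1 + h0 a else outer_slot (card K) i (h a))" for a
      have h_ne: "h a \<noteq> i" "a \<notin> K" if "a \<in> set L1 \<union> set L2" for a
        using that h zero dist leaves
        by (auto simp: i_def bij_betw_def s0_leaves inj_on_def K_def)
      have sub: "tree_subst (\<lambda>j. if j = i then tree_relabel ((+) (i - 1)) u
            else Leaf (outer_slot (card K) i j)) (tree_relabel h r) = tree_relabel \<rho> r"
        if "r \<in> set xs \<union> set ys" for r
      proof -
        have "set (tree_leaves r) \<subseteq> set L1 \<union> set L2" using that by (auto simp: L1_def L2_def)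
        then show ?thesis unfolding tree_relabel_def tree_subst_subst
          by (intro tree_subst_cong) (use h_ne in \<open>auto simp: \<rho>_def\<close>)
      qed
      have "tree_relabel ((+) (i - 1)) u = tree_relabel \<rho> t0"
        unfolding u_def tree_relabel_relabel unfolding tree_relabel_def
        by (intro tree_subst_cong) (auto simp: \<rho>_def K_def)
      then have "tree_graft (card K) i s u = tree_relabel \<rho> t"
        using sub by (simp add: tree_graft_def s_def s0_def Node ts i_def[symmetric])
      moreover have "S n (tree_graft (card K) i s u)"
        using graft[OF s u less.hyps[OF size_s s] less.hyps[OF size_u u] i] n by simp
      moreover have "tree_graft (card K) i s u \<in> trees g ar n"
        using tree_graft_in_trees[OF s u i] n by simp
      ultimately show ?thesis using relabel[of \<rho>] by simp
    qed
  qed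
qed

text \<open>This principle reduces statements about the free operad to the operad operations and
  makes the trees invisible from here on, except in the construction of homomorphisms.\<close>

lemma free_operad_induct [consumes 1, case_names zero add scale id corolla act comp]:
  assumes p: "p \<in> op_space (free_operad g ar) n"
    and zero: "\<And>n. S n 0"
    and add: "\<And>n p q. \<lbrakk>p \<in> op_space (free_operad g ar) n; q \<in> op_space (free_operad g ar) n; S n p; S n q\<rbrakk>
      \<Longrightarrow> S n (p + q)"
    and scale: "\<And>n c p. \<lbrakk>p \<in> op_space (free_operad g ar) n; S n p\<rbrakk> \<Longrightarrow> S n (op_scale (free_operad g ar) c p)"
    and id: "S 1 (op_id (free_operad g ar))"
    and corolla: "\<And>x. x < g \<Longrightarrow> S (ar x) (tree_monomial (corolla ar x))"
    and act: "\<And>n p \<sigma>. \<lbrakk>p \<in> op_space (free_operad g ar) n; S n p; \<sigma> permutes {1..n}\<rbrakk>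
      \<Longrightarrow> S n (op_act (free_operad g ar) n p \<sigma>)"
    and comp: "\<And>m n i p q. \<lbrakk>p \<in> op_space (free_operad g ar) m; q \<in> op_space (free_operad g ar) n;
        S m p; S n q; 1 \<le> i; i \<le> m\<rbrakk> \<Longrightarrow> S (m + n - 1) (op_comp (free_operad g ar) m n i p q)"
  shows "S n p"
proof -
  have mono: "S n (tree_monomial t)" if "t \<in> trees g ar n" for n t
  proof (rule tree_generation[where S = "\<lambda>n t. S n (tree_monomial t)", OF _ _ _ _ that])
    show "S 1 (tree_monomial (Leaf 1))" using id by (simp add: free_operad_def)
    show "S n (tree_monomial (tree_act t \<sigma>))"
      if "t \<in> trees g ar n" "S n (tree_monomial t)" "\<sigma> permutes {1..n}" for n t \<sigma>
      using act[OF free_space_single[OF that(1)] that(2,3)] by (simp add: free_act_monomial)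
    show "S (m + n - 1) (tree_monomial (tree_graft n i t u))"
      if "t \<in> trees g ar m" "u \<in> trees g ar n" "S m (tree_monomial t)" "S n (tree_monomial u)"
        "1 \<le> i" "i \<le> m" for m n i t u
      using comp[OF free_space_single[OF that(1)] free_space_single[OF that(2)] that(3-6)]
      by (simp add: free_comp_monomial)
  qed (use corolla in auto)
  have sums: "sum f X \<in> op_space (free_operad g ar) n \<and> S n (sum f X)"
    if "\<And>x. x \<in> X \<Longrightarrow> f x \<in> op_space (free_operad g ar) n \<and> S n (f x)" for f and X :: "tree set"
    using that
  proof (induction X rule: infinite_finite_induct)
    case (insert a X)
    then have "f a \<in> op_space (free_operad g ar) n" "S n (f a)"
      "sum f X \<in> op_space (free_operad g ar) n" "S n (sum f X)" by blast+
    then show ?case unfolding sum.insert[OF insert.hyps] by (blast intro: add free_space_add)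
  next
    case (infinite X)
    have "S n (sum f X)" unfolding sum.infinite[OF infinite(1)] by (rule zero)
    moreover have "sum f X \<in> op_space (free_operad g ar) n" unfolding sum.infinite[OF infinite(1)] by (rule free_space_0)
    ultimately show ?case by blast
  next
    case empty
    show ?case unfolding sum.empty using zero free_space_0 by blast
  qed
  have "Poly_Mapping.single t (Poly_Mapping.lookup p t) \<in> op_space (free_operad g ar) n
      \<and> S n (Poly_Mapping.single t (Poly_Mapping.lookup p t))" if "t \<in> Poly_Mapping.keys p" for t
  proof -
    have t: "t \<in> trees g ar n" using that p by (auto simp: free_space_iff)
    show ?thesis
      using free_space_single[OF t] scale[OF free_space_single[OF t] mono[OF t], of "Poly_Mapping.lookup p t"]
      by (simp add: free_scale_single)
  qed
  from sums[OF this] have "S n (\<Sum>t\<in>Poly_Mapping.keys p. Poly_Mapping.single t (Poly_Mapping.lookup p t))"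
    by simp
  then show ?thesis by (simp only: sum_monomials)
qed

section \<open>Evaluation of trees in an operad\<close>

context operad
begin

lemmas act_closed = linear_between_closed[OF act_linear]
lemmas act_add = linear_between_add[OF act_linear]
lemmas act_scale = linear_between_scale[OF act_linear]
lemmas comp_add_left = linear_between_add[OF comp_linear_left]
lemmas comp_scale_left = linear_between_scale[OF comp_linear_left]
lemmas comp_add_right = linear_between_add[OF comp_linear_right]
lemmas comp_scale_right = linear_between_scale[OF comp_linear_right]
lemmas act_sum = linear_between_sum[OF act_linear space_subspace]
lemmas comp_sum_left = linear_between_sum[OF comp_linear_left space_subspace]
lemmas comp_sum_right = linear_between_sum[OF comp_linear_right space_subspace]

lemma comp_closed:
  "\<lbrakk>1 \<le> i; i \<le> m; \<mu> \<in> op_space P m; \<nu> \<in> op_space P n\<rbrakk> \<Longrightarrow> op_comp P m n i \<mu> \<nu> \<in> op_space P (m + n - 1)"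
  by (rule linear_between_closed[OF comp_linear_left])

lemmas space_0 = subspace_0[OF space_subspace]
lemmas space_add = subspace_add[OF space_subspace]
lemmas space_diff = subspace_diff[OF space_subspace]
lemmas space_scale = subspace_scale[OF space_subspace]
lemmas space_sum = subspace_sum[OF space_subspace]

end

subsection \<open>Planar trees\<close>

text \<open>The last inputs of \<open>q\<close> are filled with the given operations, which leaves the first \<open>a\<close> inputs
  free.  Working from right to left keeps the positions of the inputs still to be filled.\<close>

fun graft_last :: "('k, 'p) operad_data \<Rightarrow> nat \<Rightarrow> 'p \<Rightarrow> (nat \<times> 'p) list \<Rightarrow> 'p" where
  "graft_last P a q [] = q"
| "graft_last P a q ((n, r) # rs) =
     op_comp P (a + 1 + sum_list (map fst rs)) n (a + 1) (graft_last P (a + 1) q rs) r"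

text \<open>The arity and the value of a tree whose leaves are numbered from left to right.\<close>

primrec planar_value :: "('k, 'p) operad_data \<Rightarrow> (nat \<Rightarrow> 'p) \<Rightarrow> tree \<Rightarrow> nat \<times> 'p" where
  "planar_value P v (Leaf j) = (1, op_id P)"
| "planar_value P v (Node x ts) =
     (sum_list (map fst (map (planar_value P v) ts)), graft_last P 0 (v x) (map (planar_value P v) ts))"

lemma fst_planar_value: "fst (planar_value P v t) = length (tree_leaves t)"
  by (induction t) (auto simp: length_concat comp_def intro!: arg_cong[where f = sum_list])

lemma planar_value_subst_leaves:
  "(\<And>j. j \<in> set (tree_leaves t) \<Longrightarrow> \<exists>k. f j = Leaf k) \<Longrightarrow> planar_value P v (tree_subst f t) = planar_value P v t"
proof (induction t)
  case (Leaf j)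
  then obtain k where "f j = Leaf k" by auto
  then show ?case by simp
next
  case (Node x ts)
  then have "map (planar_value P v) (map (tree_subst f) ts) = map (planar_value P v) ts" by auto
  then show ?case by (simp del: map_map)
qed

lemma planar_value_relabel: "planar_value P v (tree_relabel h t) = planar_value P v t"
  by (simp add: tree_relabel_def planar_value_subst_leaves)

lemma concat_eq_split:
  assumes "concat (map f ts) = L1 @ j # L2"
  obtains xs t ys K1 K2 where "ts = xs @ t # ys" "f t = K1 @ j # K2"
    "L1 = concat (map f xs) @ K1" "L2 = K2 @ concat (map f ys)"
  using assms
proof (induction ts arbitrary: L1 thesis)
  case (Cons t ts)
  show ?case
  proof (cases "length (f t) \<le> length L1")
    case True
    then obtain L' where L': "L1 = f t @ L'" "concat (map f ts) = L' @ j # L2"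
      using Cons.prems(2) by (auto simp: append_eq_append_conv2)
    show ?thesis
    proof (rule Cons.IH[OF _ L'(2)])
      fix xs t0 ys K1 K2
      assume "ts = xs @ t0 # ys" "f t0 = K1 @ j # K2" "L' = concat (map f xs) @ K1"
        "L2 = K2 @ concat (map f ys)"
      then show ?thesis using L'(1) by (intro Cons.prems(1)[of "t # xs" t0 ys K1 K2]) auto
    qed
  next
    case False
    then obtain us where us: "f t = L1 @ us" "us \<noteq> []" "us @ concat (map f ts) = j # L2"
      using Cons.prems(2) by (auto simp: append_eq_append_conv2)
    then obtain K2 where "f t = L1 @ j # K2" "L2 = K2 @ concat (map f ts)"
      by (cases us) auto
    then show ?thesis by (intro Cons.prems(1)[of "[]" t ts L1 K2]) auto
  qed
qed simp

context operad
begin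

lemma graft_last_closed:
  assumes "q \<in> op_space P (a + length rs)" "\<And>n r. (n, r) \<in> set rs \<Longrightarrow> r \<in> op_space P n"
  shows "graft_last P a q rs \<in> op_space P (a + sum_list (map fst rs))"
  using assms
proof (induction rs arbitrary: a)
  case (Cons x rs)
  obtain n r where x: "x = (n, r)" by fastforce
  have "graft_last P (a + 1) q rs \<in> op_space P (a + 1 + sum_list (map fst rs))"
    using Cons.prems by (intro Cons.IH) auto
  moreover have "r \<in> op_space P n" using Cons.prems x by simp
  ultimately show ?case
    using comp_closed[of "a + 1" "a + 1 + sum_list (map fst rs)" "graft_last P (a + 1) q rs" r n]
    by (simp add: x add.commute add.left_commute)
qed simp

lemma graft_last_identities: "q \<in> op_space P (a + k) \<Longrightarrow> graft_last P a q (replicate k (1, op_id P)) = q"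
proof (induction k arbitrary: a)
  case (Suc k)
  then show ?case using id_right[of "a + 1" "a + 1 + k" q] by (simp add: sum_list_replicate)
qed simp

text \<open>Both associativity axioms enter: the sequential one moves a composition out of the operation
  that it concerns, the parallel one moves it past the operations to the left.\<close>

lemma graft_last_comp:
  assumes "q \<in> op_space P (a + Suc (length xs + length ys))"
    and "\<And>n r. (n, r) \<in> set xs \<union> set ys \<Longrightarrow> r \<in> op_space P n"
    and r: "r \<in> op_space P m" and u: "u \<in> op_space P n" and j: "1 \<le> j" "j \<le> m"
  shows "graft_last P a q (xs @ (m + n - 1, op_comp P m n j r u) # ys)
    = op_comp P (a + sum_list (map fst xs) + m + sum_list (map fst ys)) n (a + sum_list (map fst xs) + j)
        (graft_last P a q (xs @ (m, r) # ys)) u"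
  using assms(1,2)
proof (induction xs arbitrary: a)
  case Nil
  define Y where "Y = sum_list (map fst ys)"
  have "graft_last P (a + 1) q ys \<in> op_space P (a + 1 + Y)"
    unfolding Y_def using Nil by (intro graft_last_closed) auto
  from assoc_sequential[OF this r u, of "a + 1" j] j
  show ?case by (simp add: Y_def[symmetric] add.commute add.left_commute)
next
  case (Cons x xs)
  obtain n0 r0 where x: "x = (n0, r0)" by fastforce
  define X Y where "X = sum_list (map fst xs)" and "Y = sum_list (map fst ys)"
  let ?G = "graft_last P (a + 1) q (xs @ (m, r) # ys)"
  have IH: "graft_last P (a + 1) q (xs @ (m + n - 1, op_comp P m n j r u) # ys)
      = op_comp P (a + 1 + X + m + Y) n (a + 1 + X + j) ?G u"
    unfolding X_def Y_def using Cons.prems by (intro Cons.IH) auto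
  have G: "?G \<in> op_space P (a + 1 + X + m + Y)"
    using graft_last_closed[of q "a + 1" "xs @ (m, r) # ys"] Cons.prems r
    by (auto simp: X_def Y_def add.assoc)
  have r0: "r0 \<in> op_space P n0" using Cons.prems(2) x by simp
  have "op_comp P (a + 1 + X + m + Y + n0 - 1) n (a + 1 + X + j - 1 + n0)
      (op_comp P (a + 1 + X + m + Y) n0 (a + 1) ?G r0) u =
    op_comp P (a + 1 + X + m + Y + n - 1) n0 (a + 1)
      (op_comp P (a + 1 + X + m + Y) n (a + 1 + X + j) ?G u) r0"
    using j by (intro assoc_parallel[OF G r0 u]) auto
  moreover have "a + 1 + X + m + Y + n - 1 = a + 1 + (X + (m + n - 1 + Y))" using j by simp
  moreover have "a + 1 + X + m + Y + n0 - 1 = a + n0 + X + m + Y" "a + 1 + X + j - 1 + n0 = a + n0 + X + j"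
    "a + 1 + X + m + Y = a + 1 + (X + (m + Y))" by auto
  ultimately show ?case
    using IH by (simp add: x X_def[symmetric] Y_def[symmetric] del: One_nat_def add_Suc_right)
      (simp add: add.assoc add.commute add.left_commute)
qed

end

locale operad_with_generators = operad P
  for P :: "('k::field, 'p::ab_group_add) operad_data" +
  fixes g :: nat and ar :: "nat \<Rightarrow> nat" and v :: "nat \<Rightarrow> 'p"
  assumes generator_closed: "x < g \<Longrightarrow> v x \<in> op_space P (ar x)"
begin

abbreviation pv :: "tree \<Rightarrow> 'p" where "pv t \<equiv> snd (planar_value P v t)"

lemma planar_value_eq: "planar_value P v t = (length (tree_leaves t), pv t)"
  by (metis fst_planar_value prod.collapse)

lemma planar_value_closed: "tree_over g ar t \<Longrightarrow> pv t \<in> op_space P (length (tree_leaves t))"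
proof (induction t)
  case (Node x ts)
  have "graft_last P 0 (v x) (map (planar_value P v) ts)
      \<in> op_space P (0 + sum_list (map fst (map (planar_value P v) ts)))"
  proof (rule graft_last_closed)
    show "v x \<in> op_space P (0 + length (map (planar_value P v) ts))"
      using Node.prems generator_closed by simp
    fix n r assume "(n, r) \<in> set (map (planar_value P v) ts)"
    then obtain t where t: "t \<in> set ts" "planar_value P v t = (n, r)" by auto
    have "pv t \<in> op_space P (length (tree_leaves t))"
      using Node.IH[OF t(1)] Node.prems t(1) by (auto simp: list_all_iff)
    moreover have "n = length (tree_leaves t)" "r = pv t" using planar_value_eq[of t] t by auto
    ultimately show "r \<in> op_space P n" by simp
  qed
  then show ?case using fst_planar_value[of P v "Node x ts"] by (simp del: tree_leaves.simps)
qed (use id_closed in simp)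

lemma planar_value_corolla:
  assumes "x < g" shows "pv (corolla ar x) = v x"
  using graft_last_identities[of "v x" 0 "ar x"] generator_closed[OF assms]
  by (simp add: corolla_def comp_def map_replicate_const del: upt_Suc)

text \<open>The other leaves may be renamed but stay leaves, so that only the leaf at position
  \<open>length L1 + 1\<close> grows.  The inductive step is \<open>graft_last_comp\<close>, applied to the child that contains
  this leaf.\<close>

lemma planar_value_subst:
  assumes "tree_over g ar t" "tree_leaves t = L1 @ j # L2"
    and "\<And>k. k \<in> set L1 \<union> set L2 \<Longrightarrow> \<exists>l. f k = Leaf l" and u: "tree_over g ar (f j)"
  shows "pv (tree_subst f t) = op_comp P (length (tree_leaves t)) (length (tree_leaves (f j)))
    (length L1 + 1) (pv t) (pv (f j))"
  using assms(1-3)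
proof (induction t arbitrary: L1 L2)
  case (Leaf k)
  then have "L1 = []" "L2 = []" "k = j" by (auto simp: Cons_eq_append_conv)
  then show ?case using id_left[OF planar_value_closed[OF u]] by simp
next
  case (Node x ts)
  have "concat (map tree_leaves ts) = L1 @ j # L2" using Node.prems(2) by simp
  then obtain xs t0 ys K1 K2 where ts: "ts = xs @ t0 # ys" and t0: "tree_leaves t0 = K1 @ j # K2"
    and L: "L1 = concat (map tree_leaves xs) @ K1" "L2 = K2 @ concat (map tree_leaves ys)"
    by (rule concat_eq_split)
  have over: "x < g" "length ts = ar x" "\<And>t. t \<in> set ts \<Longrightarrow> tree_over g ar t"
    using Node.prems(1) by (auto simp: list_all_iff)
  have IH: "pv (tree_subst f t0) = op_comp P (length (tree_leaves t0)) (length (tree_leaves (f j)))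
      (length K1 + 1) (pv t0) (pv (f j))"
    by (rule Node.IH[OF _ over(3) t0]) (use Node.prems(3) L in \<open>auto simp: ts\<close>)
  have unchanged: "map (planar_value P v \<circ> tree_subst f) zs = map (planar_value P v) zs" if "zs \<in> {xs, ys}" for zs
    using that Node.prems(3) L by (auto intro!: planar_value_subst_leaves)
  have len: "length (tree_leaves (tree_subst f t0)) = length (tree_leaves t0) + length (tree_leaves (f j)) - 1"
  proof -
    have "length (concat (map (\<lambda>k. tree_leaves (f k)) K)) = length K" if "K \<in> {K1, K2}" for K
    proof -
      have "\<forall>k\<in>set K. length (tree_leaves (f k)) = 1"
        using that Node.prems(3) L by fastforce
      then show ?thesis by (induction K) auto
    qed
    then show ?thesis by (simp add: tree_leaves_subst t0)
  qed
  have value_t0: "planar_value P v (tree_subst f t0) =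
      (length (tree_leaves t0) + length (tree_leaves (f j)) - 1,
       op_comp P (length (tree_leaves t0)) (length (tree_leaves (f j))) (length K1 + 1) (pv t0) (pv (f j)))"
    by (subst planar_value_eq) (simp only: len IH)
  have "pv (tree_subst f (Node x ts)) = graft_last P 0 (v x) (map (planar_value P v) xs @
      (length (tree_leaves t0) + length (tree_leaves (f j)) - 1,
       op_comp P (length (tree_leaves t0)) (length (tree_leaves (f j))) (length K1 + 1) (pv t0) (pv (f j)))
      # map (planar_value P v) ys)"
    using unchanged[of xs] unchanged[of ys] value_t0 by (simp add: ts del: map_eq_conv)
  also have "\<dots> = op_comp P (0 + sum_list (map fst (map (planar_value P v) xs)) + length (tree_leaves t0)
        + sum_list (map fst (map (planar_value P v) ys)))
      (length (tree_leaves (f j))) (0 + sum_list (map fst (map (planar_value P v) xs)) + (length K1 + 1))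
      (graft_last P 0 (v x) (map (planar_value P v) xs @ (length (tree_leaves t0), pv t0)
        # map (planar_value P v) ys)) (pv (f j))"
  proof (rule graft_last_comp)
    show "v x \<in> op_space P (0 + Suc (length (map (planar_value P v) xs) + length (map (planar_value P v) ys)))"
      using generator_closed[OF over(1)] over(2) by (simp add: ts)
    show "pv t0 \<in> op_space P (length (tree_leaves t0))" "pv (f j) \<in> op_space P (length (tree_leaves (f j)))"
      using over(3) u by (auto intro!: planar_value_closed simp: ts)
    show "length K1 + 1 \<le> length (tree_leaves t0)" using t0 by simp
    fix n r assume "(n, r) \<in> set (map (planar_value P v) xs) \<union> set (map (planar_value P v) ys)"
    then have "(n, r) \<in> planar_value P v ` set ts" by (auto simp: ts)
    then obtain t where t: "t \<in> set ts" "(n, r) = planar_value P v t" by blast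
    then show "r \<in> op_space P n"
      using planar_value_closed[OF over(3)[OF t(1)]] fst_planar_value[of P v t] by (simp flip: t(2))
  qed simp
  also have "graft_last P 0 (v x) (map (planar_value P v) xs @ (length (tree_leaves t0), pv t0)
        # map (planar_value P v) ys) = pv (Node x ts)"
    by (simp add: ts flip: planar_value_eq)
  finally show ?case by (simp add: ts L length_concat comp_def fst_planar_value add.assoc)
qed

end

subsection \<open>Numberings of the leaves\<close>

lemma permutesI_inverse:
  assumes "\<And>k. k \<notin> A \<Longrightarrow> f k = k" "\<And>k. f' (f k) = k" "\<And>k. f (f' k) = k"
  shows "f permutes A"
  unfolding permutes_def
proof (intro conjI allI impI)
  show "\<exists>!x. f x = y" for y by (rule ex1I[of _ "f' y"]) (use assms in auto)
qed (rule assms(1))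

lemma inner_perm_inverse:
  assumes "\<sigma> permutes {1..n}" "1 \<le> i"
  shows "inner_perm n i (inv_into UNIV \<sigma>) (inner_perm n i \<sigma> k) = k"
proof (cases "i \<le> k \<and> k < i + n")
  case True
  then have "1 \<le> k + 1 - i" "k + 1 - i \<le> n" by linarith+
  then have "k + 1 - i \<in> {1..n}" by simp
  then have "\<sigma> (k + 1 - i) \<in> {1..n}" using permutes_in_image[OF assms(1)] by blast
  with True assms(2) permutes_inverses(2)[OF assms(1)] show ?thesis
    by (auto simp: inner_perm_def)
qed (auto simp: inner_perm_def)

lemma inner_perm_permutes:
  assumes \<sigma>: "\<sigma> permutes {1..n}" and i: "1 \<le> i" "i \<le> m"
  shows "inner_perm n i \<sigma> permutes {1..m + n - 1}"
proof (rule permutesI_inverse)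
  show "inner_perm n i \<sigma> (inner_perm n i (inv_into UNIV \<sigma>) k) = k" for k
    using inner_perm_inverse[OF permutes_inv[OF \<sigma>] i(1)] by (simp add: permutes_inv_inv[OF \<sigma>])
qed (use inner_perm_inverse[OF \<sigma> i(1)] i in \<open>auto simp: inner_perm_def\<close>)

text \<open>The inverse has the same shape, with the block inserted at \<open>\<phi> i\<close> instead of \<open>i\<close>; being an
  inverse on both sides therefore follows from this one identity.\<close>

lemma outer_perm_inverse:
  assumes \<phi>: "\<phi> permutes {1..m}" and i: "1 \<le> i" "i \<le> m"
  shows "outer_perm n (\<phi> i) (inv_into UNIV \<phi>) (outer_perm n i \<phi> k) = k"
proof -
  have inv: "inv_into UNIV \<phi> (\<phi> j) = j" for j by (rule permutes_inverses(2)[OF \<phi>])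
  have neq: "\<phi> j \<noteq> \<phi> i" if "j \<noteq> i" for j using that inv by metis
  \<comment> \<open>Inputs outside the inserted block move as \<open>\<phi>\<close> prescribes, up to the shift behind the block.\<close>
  have slot: "outer_perm n (\<phi> i) (inv_into UNIV \<phi>) (outer_slot n (\<phi> i) (\<phi> j)) = outer_slot n i j"
    if "j \<noteq> i" for j
  proof (cases "\<phi> j < \<phi> i")
    case True
    then show ?thesis using inv by (simp add: outer_perm_def outer_slot_def)
  next
    case False
    then have "\<phi> i < \<phi> j" using neq[OF that(1)] by simp
    then have "\<not> \<phi> j + n - 1 < \<phi> i" "\<not> \<phi> j + n - 1 < \<phi> i + n" "\<phi> j + n - 1 + 1 - n = \<phi> j" by linarith+
    with False show ?thesis using inv by (simp only: outer_perm_def outer_slot_def if_False)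
  qed
  consider "k < i" | "i \<le> k" "k < i + n" | "i + n \<le> k" by linarith
  then show ?thesis
  proof cases
    case 1
    then show ?thesis using slot[of k] by (simp add: outer_perm_def[of n i] outer_slot_def[of n i])
  next
    case 2
    then have "outer_perm n i \<phi> k = \<phi> i + (k - i)" by (simp add: outer_perm_def)
    moreover have "\<not> \<phi> i + (k - i) < \<phi> i" "\<phi> i + (k - i) < \<phi> i + n" using 2 by linarith+
    ultimately show ?thesis using 2 inv by (simp only: outer_perm_def[of n "\<phi> i"] if_False if_True)
  next
    case 3
    define j where "j = k + 1 - n"
    have j: "i < j" "k = j + n - 1" using 3 i by (auto simp: j_def)
    have "outer_perm n i \<phi> k = outer_slot n (\<phi> i) (\<phi> j)" using 3 by (simp add: outer_perm_def j_def)
    moreover have "outer_slot n i j = k" using j by (simp add: outer_slot_def)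
    ultimately show ?thesis using slot[of j] j by simp
  qed
qed

lemma outer_perm_permutes:
  assumes \<phi>: "\<phi> permutes {1..m}" and i: "1 \<le> i" "i \<le> m"
  shows "outer_perm n i \<phi> permutes {1..m + n - 1}"
proof (rule permutesI_inverse)
  have "\<phi> i \<in> {1..m}" using permutes_in_image[OF \<phi>] i by auto
  then show "outer_perm n i \<phi> (outer_perm n (\<phi> i) (inv_into UNIV \<phi>) k) = k" for k
    using outer_perm_inverse[OF permutes_inv[OF \<phi>], of "\<phi> i"]
    by (simp add: permutes_inv_inv[OF \<phi>] permutes_inverses(2)[OF \<phi>])
  show "outer_perm n i \<phi> k = k" if k: "k \<notin> {1..m + n - 1}" for k
  proof (cases "k = 0")
    case True
    then show ?thesis using i \<open>\<phi> i \<in> {1..m}\<close> permutes_not_in[OF \<phi>, of 0]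
      by (auto simp: outer_perm_def outer_slot_def)
  next
    case False
    then have k': "m + n \<le> k" using k by simp
    then have "m < k + 1 - n" "i + n \<le> k" using i by linarith+
    moreover from this have "k + 1 - n \<notin> {1..m}" by simp
    ultimately show ?thesis using permutes_not_in[OF \<phi>, of "k + 1 - n"] \<open>\<phi> i \<in> {1..m}\<close>
      by (simp add: outer_perm_def outer_slot_def)
  qed
qed (rule outer_perm_inverse[OF \<phi> i])

definition label_perm :: "nat list \<Rightarrow> nat \<Rightarrow> nat" where
  "label_perm L k = (if k \<in> {1..length L} then L ! (k - 1) else k)"

text \<open>Sends a label to the position of the leaf that carries it; a tree is its planar version acted
  on by this permutation.\<close>

definition leaf_perm :: "tree \<Rightarrow> nat \<Rightarrow> nat" where
  "leaf_perm t = inv_into UNIV (label_perm (tree_leaves t))"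

lemma label_perm_permutes:
  assumes "t \<in> trees g ar n" shows "label_perm (tree_leaves t) permutes {1..n}"
proof (rule bij_imp_permutes)
  have len: "length (tree_leaves t) = n" by (rule length_trees[OF assms])
  have "bij_betw ((!) (tree_leaves t)) {..<n} {1..n}"
    using assms len by (intro bij_betw_nth) (auto simp: trees_def)
  moreover have "bij_betw (\<lambda>k. k - 1) {1..n} {..<n}"
    by (rule bij_betw_byWitness[where f' = Suc]) auto
  ultimately have "bij_betw ((!) (tree_leaves t) \<circ> (\<lambda>k. k - 1)) {1..n} {1..n}"
    by (rule bij_betw_trans[rotated])
  moreover have "((!) (tree_leaves t) \<circ> (\<lambda>k. k - 1)) k = label_perm (tree_leaves t) k" if "k \<in> {1..n}" for k
    using that by (simp add: label_perm_def len)
  ultimately show "bij_betw (label_perm (tree_leaves t)) {1..n} {1..n}" by (simp only: cong: bij_betw_cong)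
  show "label_perm (tree_leaves t) k = k" if "k \<notin> {1..n}" for k using that len by (auto simp: label_perm_def)
qed

lemma leaf_perm_permutes: "t \<in> trees g ar n \<Longrightarrow> leaf_perm t permutes {1..n}"
  unfolding leaf_perm_def by (intro permutes_inv label_perm_permutes)

lemma leaf_perm_nth:
  assumes "t \<in> trees g ar n" "q < n"
  shows "leaf_perm t (tree_leaves t ! q) = Suc q"
proof -
  have "tree_leaves t ! q = label_perm (tree_leaves t) (Suc q)"
    using assms by (simp add: label_perm_def length_trees)
  then show ?thesis
    using permutes_inverses(2)[OF label_perm_permutes[OF assms(1)]] by (simp add: leaf_perm_def)
qed

lemma leaf_permI:
  assumes t: "t \<in> trees g ar n" and "\<And>q. q < n \<Longrightarrow> \<psi> (tree_leaves t ! q) = Suc q"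
    and "\<And>k. k \<notin> {1..n} \<Longrightarrow> \<psi> k = k"
  shows "leaf_perm t = \<psi>"
proof
  fix k
  show "leaf_perm t k = \<psi> k"
  proof (cases "k \<in> {1..n}")
    case True
    then have "k \<in> set (tree_leaves t)" using t by (simp add: trees_def)
    then obtain q where "q < n" "k = tree_leaves t ! q" using length_trees[OF t] by (metis in_set_conv_nth)
    then show ?thesis using leaf_perm_nth[OF t] assms(2) by simp
  next
    case False
    then show ?thesis using permutes_not_in[OF leaf_perm_permutes[OF t]] assms(3) by simp
  qed
qed

lemma leaf_perm_act:
  assumes t: "t \<in> trees g ar n" and \<sigma>: "\<sigma> permutes {1..n}"
  shows "leaf_perm (tree_act t \<sigma>) = leaf_perm t \<circ> \<sigma>"
proof (rule leaf_permI[OF tree_act_in_trees[OF t \<sigma>]])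
  show "(leaf_perm t \<circ> \<sigma>) (tree_leaves (tree_act t \<sigma>) ! q) = Suc q" if "q < n" for q
    using that length_trees[OF t] leaf_perm_nth[OF t that] permutes_inverses(1)[OF \<sigma>]
    by (simp add: tree_leaves_act)
  show "(leaf_perm t \<circ> \<sigma>) k = k" if "k \<notin> {1..n}" for k
    using permutes_not_in[OF permutes_compose[OF \<sigma> leaf_perm_permutes[OF t]] that] .
qed

lemma leaf_perm_planar:
  assumes "t \<in> trees g ar n" "tree_leaves t = [1..<Suc n]"
  shows "leaf_perm t = id"
  by (rule leaf_permI[OF assms(1)]) (use assms(2) in \<open>auto simp del: upt_Suc\<close>)

text \<open>The permutation that appears when the numberings of \<open>t\<close> and \<open>u\<close> are pulled out of a
  composite by the two equivariance axioms.\<close>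

lemma leaf_perm_graft:
  assumes t: "t \<in> trees g ar m" and u: "u \<in> trees g ar n" and i: "1 \<le> i" "i \<le> m"
  shows "leaf_perm (tree_graft n i t u) = outer_perm n i (leaf_perm t) \<circ> inner_perm n i (leaf_perm u)"
    (is "_ = ?\<psi>")
proof (rule leaf_permI[OF tree_graft_in_trees[OF t u i]])
  note perm_t = leaf_perm_permutes[OF t] and perm_u = leaf_perm_permutes[OF u]
  show "?\<psi> k = k" if "k \<notin> {1..m + n - 1}" for k
    using permutes_not_in[OF permutes_compose[OF inner_perm_permutes[OF perm_u i]
        outer_perm_permutes[OF perm_t i]] that] .
  have dist: "distinct (tree_leaves t)" and labels: "set (tree_leaves t) = {1..m}" using t by (auto simp: trees_def)
  then obtain L1 L2 where L: "tree_leaves t = L1 @ i # L2" using i split_list[of i "tree_leaves t"] by auto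
  have len: "length L1 + Suc (length L2) = m" "length (tree_leaves u) = n"
    using length_trees[OF t] length_trees[OF u] L by auto
  define p where "p = Suc (length L1)"
  have p: "leaf_perm t i = p"
    using leaf_perm_nth[OF t, of "length L1"] len L by (simp add: p_def)
  \<comment> \<open>The leaves of \<open>t\<close> other than \<open>i\<close> lie outside the block that the inner permutation moves.\<close>
  have outer: "?\<psi> (outer_slot n i a) = outer_slot n p (leaf_perm t a)" if "a \<noteq> i" for a
  proof (cases "a < i")
    case True
    then show ?thesis using p by (simp add: inner_perm_def outer_slot_def[of n i] outer_perm_def)
  next
    case False
    then have "\<not> a + n - 1 < i" "\<not> a + n - 1 < i + n" "a + n - 1 + 1 - n = a" using that by linarith+
    with False show ?thesis
      using p by (simp only: inner_perm_def outer_slot_def[of n i] outer_perm_def comp_apply if_False simp_thms)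
  qed
  fix q assume q: "q < m + n - 1"
  consider "q < length L1" | "length L1 \<le> q" "q < length L1 + n" | "length L1 + n \<le> q" by linarith
  then show "?\<psi> (tree_leaves (tree_graft n i t u) ! q) = Suc q"
  proof cases
    case 1
    then have "L1 ! q = tree_leaves t ! q" by (simp add: L nth_append)
    then have "leaf_perm t (L1 ! q) = Suc q" using leaf_perm_nth[OF t, of q] 1 len by simp
    moreover have "L1 ! q \<noteq> i" using 1 dist L by auto
    moreover have "outer_slot n p (Suc q) = Suc q" using 1 by (simp add: outer_slot_def p_def)
    ultimately show ?thesis using 1 outer[of "L1 ! q"] unfolding tree_leaves_graft[OF dist L]
      by (simp add: nth_append)
  next
    case 2
    define r where "r = q - length L1"
    have r: "r < n" "q = length L1 + r" using 2 by (auto simp: r_def)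
    have "tree_leaves (tree_graft n i t u) ! q = i - 1 + tree_leaves u ! r"
      unfolding tree_leaves_graft[OF dist L] using r len by (simp add: nth_append)
    moreover have "tree_leaves u ! r \<in> {1..n}"
      using u r len nth_mem[of r "tree_leaves u"] by (simp add: trees_def)
    then have "i \<le> i - 1 + tree_leaves u ! r" "i - 1 + tree_leaves u ! r < i + n"
      "i - 1 + tree_leaves u ! r + 1 - i = tree_leaves u ! r" using i by auto
    then have "inner_perm n i (leaf_perm u) (i - 1 + tree_leaves u ! r) = i + r"
      using leaf_perm_nth[OF u r(1)] i by (simp add: inner_perm_def)
    moreover have "outer_perm n i (leaf_perm t) (i + r) = p + r"
      using r p by (simp add: outer_perm_def)
    ultimately show ?thesis using r by (simp add: p_def)
  next
    case 3
    define r where "r = q - length L1 - n"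
    have r: "r < length L2" "q = length L1 + n + r" using 3 q len by (auto simp: r_def)
    then have "L2 ! r = tree_leaves t ! (length L1 + Suc r)" by (simp add: L nth_append)
    then have "leaf_perm t (L2 ! r) = Suc (length L1 + Suc r)"
      using leaf_perm_nth[OF t, of "length L1 + Suc r"] r len by simp
    moreover have "L2 ! r \<noteq> i" using r dist L by auto
    moreover have "outer_slot n p (Suc (length L1 + Suc r)) = Suc q"
      using r by (simp add: outer_slot_def p_def)
    ultimately show ?thesis using r len outer[of "L2 ! r"] unfolding tree_leaves_graft[OF dist L]
      by (simp add: nth_append)
  qed
qed

subsection \<open>The universal property of the free operad\<close>

definition tree_value :: "('k, 'p) operad_data \<Rightarrow> (nat \<Rightarrow> 'p) \<Rightarrow> nat \<Rightarrow> tree \<Rightarrow> 'p" where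
  "tree_value P v n t = op_act P n (snd (planar_value P v t)) (leaf_perm t)"

definition free_extension ::
  "('k::field, 'p::ab_group_add) operad_data \<Rightarrow> (nat \<Rightarrow> 'p) \<Rightarrow> nat \<Rightarrow> (tree \<Rightarrow>\<^sub>0 'k) \<Rightarrow> 'p" where
  "free_extension P v n p =
     (\<Sum>t\<in>Poly_Mapping.keys p. op_scale P (Poly_Mapping.lookup p t) (tree_value P v n t))"

lemma operad_hom_linear: "operad_hom Q P f
    \<Longrightarrow> linear_between (op_scale Q) (op_scale P) (op_space Q n) (op_space P n) (f n)"
  and operad_hom_id: "operad_hom Q P f \<Longrightarrow> f 1 (op_id Q) = op_id P"
  and operad_hom_act: "\<lbrakk>operad_hom Q P f; \<mu> \<in> op_space Q n; \<sigma> permutes {1..n}\<rbrakk>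
    \<Longrightarrow> f n (op_act Q n \<mu> \<sigma>) = op_act P n (f n \<mu>) \<sigma>"
  and operad_hom_comp: "\<lbrakk>operad_hom Q P f; \<mu> \<in> op_space Q m; \<nu> \<in> op_space Q n; 1 \<le> i; i \<le> m\<rbrakk>
    \<Longrightarrow> f (m + n - 1) (op_comp Q m n i \<mu> \<nu>) = op_comp P m n i (f m \<mu>) (f n \<nu>)"
  unfolding operad_hom_def by blast+

lemmas operad_hom_closed = linear_between_closed[OF operad_hom_linear]
lemmas operad_hom_add = linear_between_add[OF operad_hom_linear]
lemmas operad_hom_scale = linear_between_scale[OF operad_hom_linear]
lemmas operad_hom_zero = linear_between_zero[OF operad_hom_linear]

context operad_with_generators
begin

lemma planar_value_in_space: "t \<in> trees g ar n \<Longrightarrow> pv t \<in> op_space P n"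
  using planar_value_closed[of t] length_trees[of t g ar n] by (simp add: trees_def)

lemma tree_value_closed: "t \<in> trees g ar n \<Longrightarrow> tree_value P v n t \<in> op_space P n"
  unfolding tree_value_def by (intro act_closed leaf_perm_permutes planar_value_in_space)

lemma tree_value_act:
  assumes t: "t \<in> trees g ar n" and \<sigma>: "\<sigma> permutes {1..n}"
  shows "tree_value P v n (tree_act t \<sigma>) = op_act P n (tree_value P v n t) \<sigma>"
  using act_act[OF planar_value_in_space[OF t] leaf_perm_permutes[OF t] \<sigma>]
  by (simp add: tree_value_def leaf_perm_act[OF t \<sigma>]) (simp add: tree_act_def planar_value_relabel)

text \<open>Once both numberings are pulled out of the composite, planar trees remain, to which
  \<open>planar_value_subst\<close> applies at the position of the leaf \<open>i\<close>.\<close>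

lemma tree_value_graft:
  assumes t: "t \<in> trees g ar m" and u: "u \<in> trees g ar n" and i: "1 \<le> i" "i \<le> m"
  shows "tree_value P v (m + n - 1) (tree_graft n i t u)
    = op_comp P m n i (tree_value P v m t) (tree_value P v n u)"
proof -
  note perm_t = leaf_perm_permutes[OF t] and perm_u = leaf_perm_permutes[OF u]
  note val_t = planar_value_in_space[OF t] and val_u = planar_value_in_space[OF u]
  have dist: "distinct (tree_leaves t)" and labels: "set (tree_leaves t) = {1..m}" using t by (auto simp: trees_def)
  then obtain L1 L2 where L: "tree_leaves t = L1 @ i # L2" using i split_list[of i "tree_leaves t"] by auto
  have p: "leaf_perm t i = length L1 + 1"
    using leaf_perm_nth[OF t, of "length L1"] length_trees[OF t] L by simp
  have pi: "1 \<le> leaf_perm t i" "leaf_perm t i \<le> m" using p length_trees[OF t] L by auto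
  have "pv (tree_graft n i t u) = op_comp P (length (tree_leaves t))
      (length (tree_leaves (tree_relabel (\<lambda>k. i - 1 + k) u))) (length L1 + 1) (pv t)
      (pv (tree_relabel (\<lambda>k. i - 1 + k) u))"
    unfolding tree_graft_def
    by (subst planar_value_subst[where j = i]) (use t u L dist in \<open>auto simp: trees_def tree_over_relabel\<close>)
  then have graft: "pv (tree_graft n i t u) = op_comp P m n (leaf_perm t i) (pv t) (pv u)"
    by (simp add: length_trees[OF t] length_trees[OF u] p tree_leaves_relabel planar_value_relabel)
  have "op_comp P m n i (tree_value P v m t) (tree_value P v n u)
      = op_act P (m + n - 1) (op_comp P m n i (tree_value P v m t) (pv u)) (inner_perm n i (leaf_perm u))"
    unfolding tree_value_def[of P v n]
    by (rule equivariant_inner[OF tree_value_closed[OF t] val_u i perm_u])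
  also have "op_comp P m n i (tree_value P v m t) (pv u)
      = op_act P (m + n - 1) (op_comp P m n (leaf_perm t i) (pv t) (pv u)) (outer_perm n i (leaf_perm t))"
    unfolding tree_value_def by (rule equivariant_outer[OF val_t val_u i perm_t])
  also have "op_act P (m + n - 1) \<dots> (inner_perm n i (leaf_perm u)) = op_act P (m + n - 1)
      (op_comp P m n (leaf_perm t i) (pv t) (pv u)) (outer_perm n i (leaf_perm t) \<circ> inner_perm n i (leaf_perm u))"
    by (intro act_act comp_closed pi val_t val_u outer_perm_permutes inner_perm_permutes perm_t perm_u i)
  finally show ?thesis by (simp add: tree_value_def graft leaf_perm_graft[OF t u i])
qed

lemma free_extension_eq_sum:
  assumes "finite A" "Poly_Mapping.keys p \<subseteq> A"
  shows "free_extension P v n p = (\<Sum>t\<in>A. op_scale P (Poly_Mapping.lookup p t) (tree_value P v n t))"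
  unfolding free_extension_def using assms
  by (intro sum.mono_neutral_left) (auto simp: in_keys_iff)

lemma free_extension_add: "free_extension P v n (p + q) = free_extension P v n p + free_extension P v n q"
  using Poly_Mapping.keys_add[of p q]
    free_extension_eq_sum[of "Poly_Mapping.keys p \<union> Poly_Mapping.keys q" _ n]
  by (simp add: lookup_add scale_left_distrib sum.distrib)

lemma free_extension_scale:
  "free_extension P v n (op_scale (free_operad g ar) c p) = op_scale P c (free_extension P v n p)"
  by (subst (1 2) free_extension_eq_sum[of "Poly_Mapping.keys p"])
    (auto simp: in_keys_iff lookup_free_scale scale_sum_right)

lemma free_extension_zero: "free_extension P v n 0 = 0"
  by (simp add: free_extension_def)

lemma free_extension_sum: "free_extension P v n (sum f X) = (\<Sum>x\<in>X. free_extension P v n (f x))"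
  by (induction X rule: infinite_finite_induct) (auto simp: free_extension_add free_extension_zero)

lemma free_extension_single:
  "free_extension P v n (Poly_Mapping.single t a) = op_scale P a (tree_value P v n t)"
  by (simp add: free_extension_def)

lemma free_extension_closed:
  "p \<in> op_space (free_operad g ar) n \<Longrightarrow> free_extension P v n p \<in> op_space P n"
  unfolding free_extension_def by (intro space_sum space_scale tree_value_closed) (auto simp: free_space_iff)

lemma free_extension_corolla:
  assumes "x < g" shows "free_extension P v (ar x) (tree_monomial (corolla ar x)) = v x"
  using leaf_perm_planar[OF corolla_in_trees[OF assms] tree_leaves_corolla]
  by (simp add: free_extension_single tree_value_def planar_value_corolla[OF assms]
      act_id generator_closed[OF assms])

theorem free_extension_hom: "operad_hom (free_operad g ar) P (free_extension P v)"
proof -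
  have linear: "linear_between (op_scale (free_operad g ar)) (op_scale P)
      (op_space (free_operad g ar) n) (op_space P n) (free_extension P v n)" for n
    by (auto simp: linear_between_def free_extension_closed free_extension_add free_extension_scale)
  have "Leaf 1 \<in> trees g ar 1" by (auto simp: trees_def)
  then have "leaf_perm (Leaf 1) = id" by (rule leaf_perm_planar) simp
  then have id: "free_extension P v 1 (op_id (free_operad g ar)) = op_id P"
    using act_id[OF id_closed] by (simp add: free_operad_def free_extension_single tree_value_def)
  have act: "free_extension P v n (op_act (free_operad g ar) n p \<sigma>) = op_act P n (free_extension P v n p) \<sigma>"
    if "p \<in> op_space (free_operad g ar) n" "\<sigma> permutes {1..n}" for n p \<sigma>
  proof -
    have t: "t \<in> trees g ar n" if "t \<in> Poly_Mapping.keys p" for t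
      using that \<open>p \<in> _\<close> by (auto simp: free_space_iff)
    have "op_act P n (free_extension P v n p) \<sigma> = (\<Sum>t\<in>Poly_Mapping.keys p.
        op_scale P (Poly_Mapping.lookup p t) (op_act P n (tree_value P v n t) \<sigma>))"
      unfolding free_extension_def by (rule act_sum[OF that(2) tree_value_closed[OF t]])
    then show ?thesis unfolding free_act free_extension_sum free_extension_single
      by (simp add: tree_value_act[OF t that(2)])
  qed
  have comp: "free_extension P v (m + n - 1) (op_comp (free_operad g ar) m n i p q)
      = op_comp P m n i (free_extension P v m p) (free_extension P v n q)"
    if p: "p \<in> op_space (free_operad g ar) m" and q: "q \<in> op_space (free_operad g ar) n"
      and i: "1 \<le> i" "i \<le> m" for m n i p q
  proof -
    have t: "t \<in> trees g ar m" if "t \<in> Poly_Mapping.keys p" for t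
      using that p by (auto simp: free_space_iff)
    have u: "u \<in> trees g ar n" if "u \<in> Poly_Mapping.keys q" for u
      using that q by (auto simp: free_space_iff)
    have "op_comp P m n i (free_extension P v m p) (free_extension P v n q)
      = (\<Sum>t\<in>Poly_Mapping.keys p. op_scale P (Poly_Mapping.lookup p t)
          (op_comp P m n i (tree_value P v m t) (free_extension P v n q)))"
      unfolding free_extension_def[of P v m]
      by (rule comp_sum_left[OF i free_extension_closed[OF q] tree_value_closed[OF t]])
    also have "\<dots> = (\<Sum>t\<in>Poly_Mapping.keys p. op_scale P (Poly_Mapping.lookup p t)
        (\<Sum>u\<in>Poly_Mapping.keys q. op_scale P (Poly_Mapping.lookup q u)
          (op_comp P m n i (tree_value P v m t) (tree_value P v n u))))"
      unfolding free_extension_def[of P v n]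
      by (intro sum.cong refl arg_cong[where f = "op_scale P _"])
        (rule comp_sum_right[OF i tree_value_closed[OF t] tree_value_closed[OF u]])
    also have "\<dots> = free_extension P v (m + n - 1) (op_comp (free_operad g ar) m n i p q)"
      unfolding free_comp free_extension_sum free_extension_single
      by (intro sum.cong refl) (simp add: scale_sum_right tree_value_graft[OF t u i, simplified])
    finally show ?thesis by simp
  qed
  show ?thesis unfolding operad_hom_def using linear id act comp by blast
qed

end

lemma free_hom_unique:
  assumes f: "operad_hom (free_operad g ar) P f" and f': "operad_hom (free_operad g ar) P f'"
    and "\<And>x. x < g \<Longrightarrow> f (ar x) (tree_monomial (corolla ar x)) = f' (ar x) (tree_monomial (corolla ar x))"
    and "p \<in> op_space (free_operad g ar) n"
  shows "f n p = f' n p"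
  using assms(4)
proof (induction rule: free_operad_induct)
  case (zero n)
  show ?case using operad_hom_zero[OF f free_space_0] operad_hom_zero[OF f' free_space_0] by simp
next
  case (add n p q)
  then show ?case by (simp add: operad_hom_add[OF f] operad_hom_add[OF f'])
next
  case (scale n c p)
  then show ?case by (simp add: operad_hom_scale[OF f] operad_hom_scale[OF f'])
next
  case id
  show ?case by (simp only: operad_hom_id[OF f] operad_hom_id[OF f'])
next
  case (act n p \<sigma>)
  then show ?case by (simp only: operad_hom_act[OF f] operad_hom_act[OF f'])
next
  case (comp m n i p q)
  then show ?case by (simp only: operad_hom_comp[OF f] operad_hom_comp[OF f'])
qed (rule assms(3))

section \<open>Finitely generated operads\<close>

locale generated_operad = operad P
  for P :: "('k::field, 'p::ab_group_add) operad_data" +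
  fixes g :: nat and ar :: "nat \<Rightarrow> nat" and \<pi> :: "nat \<Rightarrow> (tree \<Rightarrow>\<^sub>0 'k) \<Rightarrow> 'p"
  assumes presentation_hom: "operad_hom (free_operad g ar) P \<pi>"
    and presentation_surj: "\<pi> n ` op_space (free_operad g ar) n = op_space P n"
begin

definition gen :: "nat \<Rightarrow> 'p" where
  "gen x = \<pi> (ar x) (tree_monomial (corolla ar x))"

lemma gen_closed: "x < g \<Longrightarrow> gen x \<in> op_space P (ar x)"
  unfolding gen_def
  by (intro operad_hom_closed[OF presentation_hom] free_space_single corolla_in_trees)

lemma presentation_closed: "p \<in> op_space (free_operad g ar) n \<Longrightarrow> \<pi> n p \<in> op_space P n"
  by (rule operad_hom_closed[OF presentation_hom])

lemma presentation_preimage: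
  assumes "\<mu> \<in> op_space P n"
  obtains p where "p \<in> op_space (free_operad g ar) n" "\<mu> = \<pi> n p"
  using assms presentation_surj[of n] by blast

lemma generated_induct [consumes 1, case_names zero add scale id gen act comp]:
  assumes \<mu>: "\<mu> \<in> op_space P n"
    and zero: "\<And>n. S n 0"
    and add: "\<And>n \<mu> \<nu>. \<lbrakk>\<mu> \<in> op_space P n; \<nu> \<in> op_space P n; S n \<mu>; S n \<nu>\<rbrakk> \<Longrightarrow> S n (\<mu> + \<nu>)"
    and scale: "\<And>n c \<mu>. \<lbrakk>\<mu> \<in> op_space P n; S n \<mu>\<rbrakk> \<Longrightarrow> S n (op_scale P c \<mu>)"
    and id: "S 1 (op_id P)"
    and gen: "\<And>x. x < g \<Longrightarrow> S (ar x) (gen x)"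
    and act: "\<And>n \<mu> \<sigma>. \<lbrakk>\<mu> \<in> op_space P n; S n \<mu>; \<sigma> permutes {1..n}\<rbrakk> \<Longrightarrow> S n (op_act P n \<mu> \<sigma>)"
    and comp: "\<And>m n i \<mu> \<nu>. \<lbrakk>\<mu> \<in> op_space P m; \<nu> \<in> op_space P n; S m \<mu>; S n \<nu>; 1 \<le> i; i \<le> m\<rbrakk>
      \<Longrightarrow> S (m + n - 1) (op_comp P m n i \<mu> \<nu>)"
  shows "S n \<mu>"
proof -
  obtain p where p: "p \<in> op_space (free_operad g ar) n" "\<mu> = \<pi> n p"
    using presentation_preimage[OF \<mu>] .
  note hom = presentation_hom
  from p(1) have "S n (\<pi> n p)"
  proof (induction rule: free_operad_induct)
    case (zero n)
    show ?case using assms(2) by (simp only: operad_hom_zero[OF hom free_space_0])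
  next
    case (add n p q)
    then show ?case using assms(3) presentation_closed by (simp only: operad_hom_add[OF hom])
  next
    case (scale n c p)
    then show ?case using assms(4) presentation_closed by (simp only: operad_hom_scale[OF hom])
  next
    case id
    show ?case using assms(5) by (simp only: operad_hom_id[OF hom])
  next
    case (corolla x)
    then show ?case using assms(6) by (simp only: gen_def)
  next
    case (act n p \<sigma>)
    then show ?case using assms(7) presentation_closed by (simp only: operad_hom_act[OF hom])
  next
    case (comp m n i p q)
    then show ?case using assms(8) presentation_closed by (simp only: operad_hom_comp[OF hom])
  qed
  with p show ?thesis by simp
qed

text \<open>The factorization of linear maps through \<open>\<pi>\<close>; it serves for endomorphisms of \<open>P\<close> and
  for cochains with prescribed coboundary alike.\<close>

lemma descend_along_presentation:
  assumes lin: "\<And>n. linear_between (op_scale (free_operad g ar)) t (op_space (free_operad g ar) n) (W n) (\<delta> n)"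
    and kernel: "\<And>n p. \<lbrakk>p \<in> op_space (free_operad g ar) n; \<pi> n p = 0\<rbrakk> \<Longrightarrow> \<delta> n p = 0"
  obtains D where "\<And>n p. p \<in> op_space (free_operad g ar) n \<Longrightarrow> D n (\<pi> n p) = \<delta> n p"
    "\<And>n. linear_between (op_scale P) t (op_space P n) (W n) (D n)"
proof -
  interpret F: vector_space "op_scale (free_operad g ar) :: 'k \<Rightarrow> _" by (rule free_vector_space)
  define D where "D n \<mu> = \<delta> n (SOME p. p \<in> op_space (free_operad g ar) n \<and> \<pi> n p = \<mu>)" for n \<mu>
  have D: "D n (\<pi> n p) = \<delta> n p" if p: "p \<in> op_space (free_operad g ar) n" for n p
  proof -
    define q where "q = (SOME q. q \<in> op_space (free_operad g ar) n \<and> \<pi> n q = \<pi> n p)"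
    have q: "q \<in> op_space (free_operad g ar) n" "\<pi> n q = \<pi> n p"
      using someI[of "\<lambda>q. q \<in> op_space (free_operad g ar) n \<and> \<pi> n q = \<pi> n p" p] p
      unfolding q_def by blast+
    have "\<pi> n (q - p) = 0"
      using F.linear_between_diff[OF operad_hom_linear[OF presentation_hom] free_subspace q(1) p] q(2) by simp
    then have "\<delta> n (q - p) = 0" by (rule kernel[OF F.subspace_diff[OF free_subspace q(1) p]])
    then show ?thesis
      using F.linear_between_diff[OF lin free_subspace q(1) p] by (simp add: D_def q_def)
  qed
  have "linear_between (op_scale P) t (op_space P n) (W n) (D n)" for n
  proof -
    note hom = presentation_hom
    have "D n \<mu> \<in> W n" if \<mu>: "\<mu> \<in> op_space P n" for \<mu>
    proof -
      obtain p where p: "p \<in> op_space (free_operad g ar) n" "\<mu> = \<pi> n p"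
        using presentation_preimage[OF \<mu>] .
      show ?thesis unfolding p(2) D[OF p(1)] by (rule linear_between_closed[OF lin p(1)])
    qed
    moreover have "D n (\<mu> + \<nu>) = D n \<mu> + D n \<nu>" if \<mu>: "\<mu> \<in> op_space P n" and \<nu>: "\<nu> \<in> op_space P n" for \<mu> \<nu>
    proof -
      obtain p where p: "p \<in> op_space (free_operad g ar) n" "\<mu> = \<pi> n p"
        using presentation_preimage[OF \<mu>] .
      obtain q where q: "q \<in> op_space (free_operad g ar) n" "\<nu> = \<pi> n q"
        using presentation_preimage[OF \<nu>] .
      note pq = p(1) q(1) and eq = p(2) q(2)
      have "D n (\<pi> n p + \<pi> n q) = D n (\<pi> n (p + q))" by (simp only: operad_hom_add[OF hom pq])
      also have "\<dots> = \<delta> n p + \<delta> n q"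
        by (simp only: D[OF free_space_add[OF pq]] linear_between_add[OF lin pq])
      finally show ?thesis by (simp only: eq D[OF pq(1)] D[OF pq(2)])
    qed
    moreover have "D n (op_scale P c \<mu>) = t c (D n \<mu>)" if \<mu>: "\<mu> \<in> op_space P n" for c \<mu>
    proof -
      obtain p where p: "p \<in> op_space (free_operad g ar) n" and eq: "\<mu> = \<pi> n p"
        using presentation_preimage[OF \<mu>] .
      have "D n (op_scale P c (\<pi> n p)) = D n (\<pi> n (op_scale (free_operad g ar) c p))"
        by (simp only: operad_hom_scale[OF hom p])
      also have "\<dots> = t c (\<delta> n p)"
        by (simp only: D[OF free_space_scale[OF p]] linear_between_scale[OF lin p])
      finally show ?thesis by (simp only: eq D[OF p])
    qed
    ultimately show ?thesis by (auto simp: linear_between_def)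
  qed
  with D that show ?thesis by blast
qed

end

section \<open>Cohomology in degrees 0 and 1\<close>

lemma sum_fun_apply: "(\<Sum>v\<in>S. f v) x = (\<Sum>v\<in>S. f v x)"
  by (induction S rule: infinite_finite_induct) auto

context operad
begin

lemma H0_finite_dimensional:
  "locally_finite P \<Longrightarrow> finite_dimensional (op_scale P) (H0 P)"
  by (rule finite_dimensional_subset[of "op_space P 1"]) (auto simp: locally_finite_def H0_def)

lemma comp_zero_left: "\<lbrakk>1 \<le> i; i \<le> m; \<nu> \<in> op_space P n\<rbrakk> \<Longrightarrow> op_comp P m n i 0 \<nu> = 0"
  by (rule linear_between_zero[OF comp_linear_left space_0])

lemma comp_zero_right: "\<lbrakk>1 \<le> i; i \<le> m; \<mu> \<in> op_space P m\<rbrakk> \<Longrightarrow> op_comp P m n i \<mu> 0 = 0"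
  by (rule linear_between_zero[OF comp_linear_right space_0])

lemma zero_in_inner_der: "0 \<in> inner_der P"
proof -
  have "ad P 0 n \<theta> = 0" for n \<theta>
    using comp_zero_left[of 1 1 \<theta> n] comp_zero_right[of _ n \<theta> 1] by (simp add: ad_def)
  then have "ad P 0 = 0" by (simp add: fun_eq_iff)
  then show ?thesis using space_0 unfolding inner_der_def by (metis image_eqI)
qed

end

lemma derD:
  assumes "D \<in> der P"
  shows "linear_between (op_scale P) (op_scale P) (op_space P n) (op_space P n) (D n)"
    and "\<mu> \<notin> op_space P n \<Longrightarrow> D n \<mu> = 0"
    and "\<lbrakk>\<mu> \<in> op_space P n; \<sigma> permutes {1..n}\<rbrakk> \<Longrightarrow> D n (op_act P n \<mu> \<sigma>) = op_act P n (D n \<mu>) \<sigma>"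
    and "\<lbrakk>\<mu> \<in> op_space P m; \<nu> \<in> op_space P n; 1 \<le> i; i \<le> m\<rbrakk> \<Longrightarrow> D (m + n - 1) (op_comp P m n i \<mu> \<nu>) =
       op_comp P m n i (D m \<mu>) \<nu> + op_comp P m n i \<mu> (D n \<nu>)"
  using assms unfolding der_def equivariant_endo_def by blast+

context generated_operad
begin

lemma der_id:
  assumes D: "D \<in> der P" shows "D 1 (op_id P) = 0"
proof -
  have c: "D 1 (op_id P) \<in> op_space P 1" by (rule linear_between_closed[OF derD(1)[OF D] id_closed])
  \<comment> \<open>Differentiate the identity composed with itself.\<close>
  have "D (1 + 1 - 1) (op_comp P 1 1 1 (op_id P) (op_id P)) = D 1 (op_id P) + D 1 (op_id P)"
    using derD(4)[OF D id_closed id_closed, of 1] id_left[OF c] id_right[of 1 1, OF _ _ c] by simp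
  then show ?thesis using id_left[OF id_closed] by simp
qed

text \<open>Restriction to the generators embeds the derivations into a finite-dimensional space: the
  elements on which a linear relation between derivations holds form a suboperad.\<close>

lemma der_eq_lincomb:
  assumes D: "D \<in> der P" and S: "S \<subseteq> der P"
    and gens: "\<And>x. x < g \<Longrightarrow> D (ar x) (gen x) = (\<Sum>v\<in>S. op_scale P (c v) (v (ar x) (gen x)))"
    and \<mu>: "\<mu> \<in> op_space P n"
  shows "D n \<mu> = (\<Sum>v\<in>S. op_scale P (c v) (v n \<mu>))"
proof -
  have v: "v \<in> der P" if "v \<in> S" for v using S that by blast
  have closed: "v n \<mu> \<in> op_space P n" if "v \<in> S" "\<mu> \<in> op_space P n" for v n \<mu>
    using linear_between_closed[OF derD(1)[OF v[OF that(1)]] that(2)] .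
  note D_lin = derD(1)[OF D] and v_lin = derD(1)[OF v]
  from \<mu> show ?thesis
  proof (induction rule: generated_induct)
    case (zero n)
    have "(\<Sum>v\<in>S. op_scale P (c v) (v n 0)) = 0"
      by (intro sum.neutral ballI) (simp only: linear_between_zero[OF v_lin space_0] scale_zero_right)
    then show ?case using linear_between_zero[OF D_lin space_0] by simp
  next
    case (add n \<mu> \<nu>)
    have "(\<Sum>v\<in>S. op_scale P (c v) (v n (\<mu> + \<nu>)))
        = (\<Sum>v\<in>S. op_scale P (c v) (v n \<mu>) + op_scale P (c v) (v n \<nu>))"
      by (intro sum.cong refl) (simp only: linear_between_add[OF v_lin add(1,2)] scale_right_distrib)
    then show ?case using add by (simp add: linear_between_add[OF D_lin add(1,2)] sum.distrib)
  next
    case (scale n a \<mu>)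
    have "(\<Sum>v\<in>S. op_scale P (c v) (v n (op_scale P a \<mu>)))
        = (\<Sum>v\<in>S. op_scale P a (op_scale P (c v) (v n \<mu>)))"
      by (intro sum.cong refl) (simp add: linear_between_scale[OF v_lin scale(1)] mult.commute)
    then show ?case using scale(2) by (simp add: linear_between_scale[OF D_lin scale(1)] scale_sum_right)
  next
    case id
    have "(\<Sum>v\<in>S. op_scale P (c v) (v 1 (op_id P))) = 0"
      by (intro sum.neutral ballI) (simp only: der_id[OF v] scale_zero_right)
    then show ?case using der_id[OF D] by simp
  next
    case (gen x)
    then show ?case by (rule gens)
  next
    case (act n \<mu> \<sigma>)
    have "(\<Sum>v\<in>S. op_scale P (c v) (v n (op_act P n \<mu> \<sigma>)))
        = (\<Sum>v\<in>S. op_scale P (c v) (op_act P n (v n \<mu>) \<sigma>))"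
      by (intro sum.cong refl) (simp only: derD(3)[OF v act(1,2)])
    also have "\<dots> = op_act P n (\<Sum>v\<in>S. op_scale P (c v) (v n \<mu>)) \<sigma>"
      by (rule act_sum[symmetric, OF act(2) closed[OF _ act(1)]])
    finally show ?case by (simp only: derD(3)[OF D act(1,2)] act(3))
  next
    case (comp m n i \<mu> \<nu>)
    have "(\<Sum>v\<in>S. op_scale P (c v) (v (m + n - 1) (op_comp P m n i \<mu> \<nu>)))
        = (\<Sum>v\<in>S. op_scale P (c v) (op_comp P m n i (v m \<mu>) \<nu>))
          + (\<Sum>v\<in>S. op_scale P (c v) (op_comp P m n i \<mu> (v n \<nu>)))"
      unfolding sum.distrib[symmetric]
      by (intro sum.cong refl) (simp only: derD(4)[OF v comp(1,2,3,4)] scale_right_distrib)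
    also have "(\<Sum>v\<in>S. op_scale P (c v) (op_comp P m n i (v m \<mu>) \<nu>))
        = op_comp P m n i (\<Sum>v\<in>S. op_scale P (c v) (v m \<mu>)) \<nu>"
      by (rule comp_sum_left[symmetric, OF comp(3,4,2) closed[OF _ comp(1)]])
    also have "(\<Sum>v\<in>S. op_scale P (c v) (op_comp P m n i \<mu> (v n \<nu>)))
        = op_comp P m n i \<mu> (\<Sum>v\<in>S. op_scale P (c v) (v n \<nu>))"
      by (rule comp_sum_right[symmetric, OF comp(3,4,1) closed[OF _ comp(2)]])
    finally show ?case by (simp only: derD(4)[OF D comp(1,2,3,4)] comp(5,6))
  qed
qed

lemma H1_finite_dimensional:
  assumes "locally_finite P"
  shows "finite_dimensional_quotient (scale_endo P) (der P) (inner_der P)"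
proof (rule finite_dimensional_quotientI[where X = "{..<g}" and W = "\<lambda>x. op_space P (ar x)"
      and \<phi> = "\<lambda>D x. D (ar x) (gen x)"])
  show "D (ar x) (gen x) \<in> op_space P (ar x)" if "D \<in> der P" "x \<in> {..<g}" for D x
    using linear_between_closed[OF derD(1)[OF that(1)] gen_closed] that(2) by simp
  show "D - (\<Sum>v\<in>S. scale_endo P (c v) v) \<in> inner_der P"
    if "D \<in> der P" "S \<subseteq> der P" "\<forall>x\<in>{..<g}. D (ar x) (gen x) = (\<Sum>v\<in>S. op_scale P (c v) (v (ar x) (gen x)))"
    for D S c
  proof -
    have "D n \<mu> = (\<Sum>v\<in>S. op_scale P (c v) (v n \<mu>))" for n \<mu>
    proof (cases "\<mu> \<in> op_space P n")
      case False
      have "(\<Sum>v\<in>S. op_scale P (c v) (v n \<mu>)) = 0"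
      proof (intro sum.neutral ballI)
        fix v assume "v \<in> S"
        with that(2) have "v \<in> der P" by blast
        from derD(2)[OF this False] show "op_scale P (c v) (v n \<mu>) = 0" by simp
      qed
      with derD(2)[OF that(1) False] show ?thesis by simp
    next
      case True
      then show ?thesis using der_eq_lincomb[OF that(1,2) _ True, of c] that(3) by simp
    qed
    then have "D - (\<Sum>v\<in>S. scale_endo P (c v) v) = 0"
      by (simp add: fun_eq_iff sum_fun_apply scale_endo_def)
    then show ?thesis using zero_in_inner_der by (simp only:)
  qed
qed (use assms in \<open>auto simp: locally_finite_def\<close>)

end

section \<open>Infinitesimal deformations and cohomology in degree 2\<close>

lemma Z2_cochain:
  assumes "w \<in> Z2 P"
  shows Z2_outside: "\<not> (1 \<le> i \<and> i \<le> m \<and> \<mu> \<in> op_space P m \<and> \<nu> \<in> op_space P n) \<Longrightarrow> w m n i \<mu> \<nu> = 0"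
    and Z2_linear_left: "\<lbrakk>1 \<le> i; i \<le> m; \<nu> \<in> op_space P n\<rbrakk> \<Longrightarrow> linear_between (op_scale P) (op_scale P)
       (op_space P m) (op_space P (m + n - 1)) (\<lambda>\<mu>. w m n i \<mu> \<nu>)"
    and Z2_linear_right: "\<lbrakk>1 \<le> i; i \<le> m; \<mu> \<in> op_space P m\<rbrakk> \<Longrightarrow> linear_between (op_scale P) (op_scale P)
       (op_space P n) (op_space P (m + n - 1)) (\<lambda>\<nu>. w m n i \<mu> \<nu>)"
proof -
  have "w \<in> cochains2 P" using assms by (simp add: Z2_def)
  then show "\<not> (1 \<le> i \<and> i \<le> m \<and> \<mu> \<in> op_space P m \<and> \<nu> \<in> op_space P n) \<Longrightarrow> w m n i \<mu> \<nu> = 0"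
    "\<lbrakk>1 \<le> i; i \<le> m; \<nu> \<in> op_space P n\<rbrakk> \<Longrightarrow> linear_between (op_scale P) (op_scale P)
       (op_space P m) (op_space P (m + n - 1)) (\<lambda>\<mu>. w m n i \<mu> \<nu>)"
    "\<lbrakk>1 \<le> i; i \<le> m; \<mu> \<in> op_space P m\<rbrakk> \<Longrightarrow> linear_between (op_scale P) (op_scale P)
       (op_space P n) (op_space P (m + n - 1)) (\<lambda>\<nu>. w m n i \<mu> \<nu>)"
    by (simp_all add: cochains2_def)
qed

lemma Z2_cocycle:
  assumes "w \<in> Z2 P"
  shows Z2_sequential: "\<lbrakk>\<kappa> \<in> op_space P l; \<mu> \<in> op_space P m; \<nu> \<in> op_space P n; 1 \<le> i; i \<le> l; 1 \<le> j; j \<le> m\<rbrakk> \<Longrightarrow>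
        w (l + m - 1) n (i - 1 + j) (op_comp P l m i \<kappa> \<mu>) \<nu>
          + op_comp P (l + m - 1) n (i - 1 + j) (w l m i \<kappa> \<mu>) \<nu> =
        w l (m + n - 1) i \<kappa> (op_comp P m n j \<mu> \<nu>)
          + op_comp P l (m + n - 1) i \<kappa> (w m n j \<mu> \<nu>)"
    and Z2_parallel: "\<lbrakk>\<kappa> \<in> op_space P l; \<mu> \<in> op_space P m; \<nu> \<in> op_space P n; 1 \<le> i; i < k; k \<le> l\<rbrakk> \<Longrightarrow>
        w (l + m - 1) n (k - 1 + m) (op_comp P l m i \<kappa> \<mu>) \<nu>
          + op_comp P (l + m - 1) n (k - 1 + m) (w l m i \<kappa> \<mu>) \<nu> =
        w (l + n - 1) m i (op_comp P l n k \<kappa> \<nu>) \<mu>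
          + op_comp P (l + n - 1) m i (w l n k \<kappa> \<nu>) \<mu>"
    and Z2_inner: "\<lbrakk>\<mu> \<in> op_space P m; \<nu> \<in> op_space P n; 1 \<le> i; i \<le> m; \<sigma> permutes {1..n}\<rbrakk> \<Longrightarrow>
        w m n i \<mu> (op_act P n \<nu> \<sigma>) = op_act P (m + n - 1) (w m n i \<mu> \<nu>) (inner_perm n i \<sigma>)"
    and Z2_outer: "\<lbrakk>\<mu> \<in> op_space P m; \<nu> \<in> op_space P n; 1 \<le> i; i \<le> m; \<phi> permutes {1..m}\<rbrakk> \<Longrightarrow>
        w m n i (op_act P m \<mu> \<phi>) \<nu> = op_act P (m + n - 1) (w m n (\<phi> i) \<mu> \<nu>) (outer_perm n i \<phi>)"
proof -
  note parts = assms[unfolded Z2_def mem_Collect_eq, THEN conjunct2]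
  show "\<lbrakk>\<kappa> \<in> op_space P l; \<mu> \<in> op_space P m; \<nu> \<in> op_space P n; 1 \<le> i; i \<le> l; 1 \<le> j; j \<le> m\<rbrakk> \<Longrightarrow>
        w (l + m - 1) n (i - 1 + j) (op_comp P l m i \<kappa> \<mu>) \<nu>
          + op_comp P (l + m - 1) n (i - 1 + j) (w l m i \<kappa> \<mu>) \<nu> =
        w l (m + n - 1) i \<kappa> (op_comp P m n j \<mu> \<nu>)
          + op_comp P l (m + n - 1) i \<kappa> (w m n j \<mu> \<nu>)"
    using parts[THEN conjunct1] by blast
  show "\<lbrakk>\<kappa> \<in> op_space P l; \<mu> \<in> op_space P m; \<nu> \<in> op_space P n; 1 \<le> i; i < k; k \<le> l\<rbrakk> \<Longrightarrow>
        w (l + m - 1) n (k - 1 + m) (op_comp P l m i \<kappa> \<mu>) \<nu>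
          + op_comp P (l + m - 1) n (k - 1 + m) (w l m i \<kappa> \<mu>) \<nu> =
        w (l + n - 1) m i (op_comp P l n k \<kappa> \<nu>) \<mu>
          + op_comp P (l + n - 1) m i (w l n k \<kappa> \<nu>) \<mu>"
    using parts[THEN conjunct2, THEN conjunct1] by blast
  show "\<lbrakk>\<mu> \<in> op_space P m; \<nu> \<in> op_space P n; 1 \<le> i; i \<le> m; \<sigma> permutes {1..n}\<rbrakk> \<Longrightarrow>
        w m n i \<mu> (op_act P n \<nu> \<sigma>) = op_act P (m + n - 1) (w m n i \<mu> \<nu>) (inner_perm n i \<sigma>)"
    using parts[THEN conjunct2, THEN conjunct2, THEN conjunct1] by blast
  show "\<lbrakk>\<mu> \<in> op_space P m; \<nu> \<in> op_space P n; 1 \<le> i; i \<le> m; \<phi> permutes {1..m}\<rbrakk> \<Longrightarrow>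
        w m n i (op_act P m \<mu> \<phi>) \<nu> = op_act P (m + n - 1) (w m n (\<phi> i) \<mu> \<nu>) (outer_perm n i \<phi>)"
    using parts[THEN conjunct2, THEN conjunct2, THEN conjunct2] by blast
qed

text \<open>The operad \<open>P + \<epsilon>P\<close>, \<open>\<epsilon>\<^sup>2 = 0\<close>, with composition deformed by \<open>\<epsilon>w\<close>; its identity has to be
  corrected accordingly.  The cocycle condition says precisely that this is an operad.\<close>

definition deformed_operad ::
  "('k::field, 'p::ab_group_add) operad_data \<Rightarrow> 'p cochain2 \<Rightarrow> ('k, 'p \<times> 'p) operad_data" where
  "deformed_operad P w =
     \<lparr>op_scale = (\<lambda>c x. (op_scale P c (fst x), op_scale P c (snd x))),
      op_space = (\<lambda>n. op_space P n \<times> op_space P n),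
      op_act = (\<lambda>n x \<sigma>. (op_act P n (fst x) \<sigma>, op_act P n (snd x) \<sigma>)),
      op_id = (op_id P, - w 1 1 1 (op_id P) (op_id P)),
      op_comp = (\<lambda>m n i x y. (op_comp P m n i (fst x) (fst y),
        op_comp P m n i (snd x) (fst y) + op_comp P m n i (fst x) (snd y) + w m n i (fst x) (fst y)))\<rparr>"

lemma deformed_operad_simps [simp]:
  "op_scale (deformed_operad P w) c x = (op_scale P c (fst x), op_scale P c (snd x))"
  "op_space (deformed_operad P w) n = op_space P n \<times> op_space P n"
  "op_act (deformed_operad P w) n x \<sigma> = (op_act P n (fst x) \<sigma>, op_act P n (snd x) \<sigma>)"
  "op_id (deformed_operad P w) = (op_id P, - w 1 1 1 (op_id P) (op_id P))"
  "op_comp (deformed_operad P w) m n i x y = (op_comp P m n i (fst x) (fst y),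
    op_comp P m n i (snd x) (fst y) + op_comp P m n i (fst x) (snd y) + w m n i (fst x) (fst y))"
  by (simp_all add: deformed_operad_def)

context operad
begin

lemmas cocycle_closed = linear_between_closed[OF Z2_linear_left]

lemma space_uminus: "x \<in> op_space P n \<Longrightarrow> - x \<in> op_space P n"
  by (rule subspace_neg[OF space_subspace])

lemma comp_uminus_left:
  assumes "1 \<le> i" "i \<le> m" "\<mu> \<in> op_space P m" "\<nu> \<in> op_space P n"
  shows "op_comp P m n i (- \<mu>) \<nu> = - op_comp P m n i \<mu> \<nu>"
  using comp_scale_left[OF assms(1,2,4,3), of "- 1"] by (simp add: scale_minus_left)

lemma comp_uminus_right:
  assumes "1 \<le> i" "i \<le> m" "\<mu> \<in> op_space P m" "\<nu> \<in> op_space P n"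
  shows "op_comp P m n i \<mu> (- \<nu>) = - op_comp P m n i \<mu> \<nu>"
  using comp_scale_right[OF assms, of "- 1"] by (simp add: scale_minus_left)

text \<open>The cocycle condition for the triple identity, identity, \<open>\<nu>\<close>; it provides the identity
  element of the deformed operad, as does its mirror image below.\<close>

lemma cocycle_id_left:
  assumes w: "w \<in> Z2 P" and \<nu>: "\<nu> \<in> op_space P n"
  shows "op_comp P 1 n 1 (w 1 1 1 (op_id P) (op_id P)) \<nu> = w 1 n 1 (op_id P) \<nu>"
proof -
  have "w 1 n 1 (op_id P) \<nu> \<in> op_space P (1 + n - 1)"
    by (rule cocycle_closed[OF w _ _ \<nu> id_closed]) simp_all
  then have "op_comp P 1 n 1 (op_id P) (w 1 n 1 (op_id P) \<nu>) = w 1 n 1 (op_id P) \<nu>"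
    by (intro id_left) simp
  then show ?thesis
    using Z2_sequential[OF w id_closed id_closed \<nu>, of 1 1] id_left[OF id_closed] id_left[OF \<nu>] by simp
qed

lemma cocycle_id_right:
  assumes w: "w \<in> Z2 P" and \<mu>: "\<mu> \<in> op_space P m" and i: "1 \<le> i" "i \<le> m"
  shows "op_comp P m 1 i \<mu> (w 1 1 1 (op_id P) (op_id P)) = w m 1 i \<mu> (op_id P)"
proof -
  have "w m 1 i \<mu> (op_id P) \<in> op_space P (m + 1 - 1)"
    by (rule cocycle_closed[OF w i id_closed \<mu>])
  then have "op_comp P m 1 i (w m 1 i \<mu> (op_id P)) (op_id P) = w m 1 i \<mu> (op_id P)"
    by (intro id_right i) simp
  then show ?thesis
    using Z2_sequential[OF w \<mu> id_closed id_closed i, of 1] id_left[OF id_closed] id_right[OF i \<mu>] i by simp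
qed

theorem deformed_operad_is_operad:
  assumes w: "w \<in> Z2 P"
  shows "operad (deformed_operad P w)"
proof -
  interpret V: vector_space "op_scale (deformed_operad P w)"
    by standard (auto simp: scale_right_distrib scale_left_distrib plus_prod_def)
  have one: "w 1 1 1 (op_id P) (op_id P) \<in> op_space P 1"
    using cocycle_closed[OF w, of 1 1, OF _ _ id_closed id_closed] by simp
  note closed = act_closed comp_closed cocycle_closed[OF w]
  note w_add = linear_between_add[OF Z2_linear_left[OF w]] linear_between_add[OF Z2_linear_right[OF w]]
  note w_scale = linear_between_scale[OF Z2_linear_left[OF w]] linear_between_scale[OF Z2_linear_right[OF w]]
  note linear = comp_add_left comp_add_right comp_scale_left comp_scale_right w_add w_scale
  show ?thesis
  proof
    fix n :: nat
    show "V.subspace (op_space (deformed_operad P w) n)"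
      by (auto simp: V.subspace_def space_0 space_add space_scale zero_prod_def)
  next
    show "op_id (deformed_operad P w) \<in> op_space (deformed_operad P w) 1"
      using id_closed space_uminus[OF one] by simp
  next
    fix \<sigma> :: "nat \<Rightarrow> nat" and n assume "\<sigma> permutes {1..n}"
    then show "linear_between (op_scale (deformed_operad P w)) (op_scale (deformed_operad P w))
        (op_space (deformed_operad P w) n) (op_space (deformed_operad P w) n)
        (\<lambda>\<mu>. op_act (deformed_operad P w) n \<mu> \<sigma>)"
      by (auto simp: linear_between_def act_closed act_add act_scale)
  next
    fix \<mu> :: "'p \<times> 'p" and n assume "\<mu> \<in> op_space (deformed_operad P w) n"
    then show "op_act (deformed_operad P w) n \<mu> id = \<mu>" by (auto simp: act_id)
  next
    fix \<mu> :: "'p \<times> 'p" and n and \<sigma> \<tau> :: "nat \<Rightarrow> nat"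
    assume "\<mu> \<in> op_space (deformed_operad P w) n" "\<sigma> permutes {1..n}" "\<tau> permutes {1..n}"
    then show "op_act (deformed_operad P w) n (op_act (deformed_operad P w) n \<mu> \<sigma>) \<tau>
        = op_act (deformed_operad P w) n \<mu> (\<sigma> \<circ> \<tau>)"
      by (auto simp: act_act)
  next
    fix i m n :: nat and \<nu> :: "'p \<times> 'p"
    assume i: "1 \<le> i" "i \<le> m" and \<nu>: "\<nu> \<in> op_space (deformed_operad P w) n"
    show "linear_between (op_scale (deformed_operad P w)) (op_scale (deformed_operad P w))
        (op_space (deformed_operad P w) m) (op_space (deformed_operad P w) (m + n - 1))
        (\<lambda>\<mu>. op_comp (deformed_operad P w) m n i \<mu> \<nu>)"
      unfolding linear_between_def
    proof (intro conjI ballI allI image_subsetI)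
      fix x assume x: "x \<in> op_space (deformed_operad P w) m"
      then show "op_comp (deformed_operad P w) m n i x \<nu> \<in> op_space (deformed_operad P w) (m + n - 1)"
        using i \<nu> closed(2-) space_add by auto
      show "op_comp (deformed_operad P w) m n i (op_scale (deformed_operad P w) c x) \<nu>
          = op_scale (deformed_operad P w) c (op_comp (deformed_operad P w) m n i x \<nu>)" for c
        using i \<nu> x by (auto simp: linear scale_right_distrib)
      fix y assume y: "y \<in> op_space (deformed_operad P w) m"
      show "op_comp (deformed_operad P w) m n i (x + y) \<nu>
          = op_comp (deformed_operad P w) m n i x \<nu> + op_comp (deformed_operad P w) m n i y \<nu>"
        using i \<nu> x y by (auto simp: linear plus_prod_def algebra_simps)
    qed
  next
    fix i m n :: nat and \<mu> :: "'p \<times> 'p"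
    assume i: "1 \<le> i" "i \<le> m" and \<mu>: "\<mu> \<in> op_space (deformed_operad P w) m"
    show "linear_between (op_scale (deformed_operad P w)) (op_scale (deformed_operad P w))
        (op_space (deformed_operad P w) n) (op_space (deformed_operad P w) (m + n - 1))
        (\<lambda>\<nu>. op_comp (deformed_operad P w) m n i \<mu> \<nu>)"
      unfolding linear_between_def
    proof (intro conjI ballI allI image_subsetI)
      fix x assume x: "x \<in> op_space (deformed_operad P w) n"
      then show "op_comp (deformed_operad P w) m n i \<mu> x \<in> op_space (deformed_operad P w) (m + n - 1)"
        using i \<mu> closed(2-) space_add by auto
      show "op_comp (deformed_operad P w) m n i \<mu> (op_scale (deformed_operad P w) c x)
          = op_scale (deformed_operad P w) c (op_comp (deformed_operad P w) m n i \<mu> x)" for c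
        using i \<mu> x by (auto simp: linear scale_right_distrib)
      fix y assume y: "y \<in> op_space (deformed_operad P w) n"
      show "op_comp (deformed_operad P w) m n i \<mu> (x + y)
          = op_comp (deformed_operad P w) m n i \<mu> x + op_comp (deformed_operad P w) m n i \<mu> y"
        using i \<mu> x y by (auto simp: linear plus_prod_def algebra_simps)
    qed
  next
    fix \<nu> :: "'p \<times> 'p" and n assume "\<nu> \<in> op_space (deformed_operad P w) n"
    then have \<nu>: "fst \<nu> \<in> op_space P n" "snd \<nu> \<in> op_space P n" by auto
    show "op_comp (deformed_operad P w) 1 n 1 (op_id (deformed_operad P w)) \<nu> = \<nu>"
      using comp_uminus_left[OF _ _ one \<nu>(1), of 1] cocycle_id_left[OF w \<nu>(1)] id_left \<nu>
      by (simp add: prod_eq_iff)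
  next
    fix \<mu> :: "'p \<times> 'p" and i m :: nat assume i: "1 \<le> i" "i \<le> m" and "\<mu> \<in> op_space (deformed_operad P w) m"
    then have \<mu>: "fst \<mu> \<in> op_space P m" "snd \<mu> \<in> op_space P m" by auto
    show "op_comp (deformed_operad P w) m 1 i \<mu> (op_id (deformed_operad P w)) = \<mu>"
      using comp_uminus_right[OF i \<mu>(1) one] cocycle_id_right[OF w \<mu>(1) i] id_right[OF i] \<mu>
      by (simp add: prod_eq_iff)
  next
    fix \<kappa> \<mu> \<nu> :: "'p \<times> 'p" and l m n i j :: nat
    assume "\<kappa> \<in> op_space (deformed_operad P w) l" "\<mu> \<in> op_space (deformed_operad P w) m"
      "\<nu> \<in> op_space (deformed_operad P w) n" and ij: "1 \<le> i" "i \<le> l" "1 \<le> j" "j \<le> m"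
    then have \<kappa>: "fst \<kappa> \<in> op_space P l" "snd \<kappa> \<in> op_space P l"
      and \<mu>: "fst \<mu> \<in> op_space P m" "snd \<mu> \<in> op_space P m"
      and \<nu>: "fst \<nu> \<in> op_space P n" "snd \<nu> \<in> op_space P n" by auto
    have bounds: "1 \<le> i - 1 + j" "i - 1 + j \<le> l + m - 1" using ij by linarith+
    note A = assoc_sequential[OF _ _ _ ij]
    have C: "op_comp P l m i (fst \<kappa>) (fst \<mu>) \<in> op_space P (l + m - 1)"
      "op_comp P l m i (snd \<kappa>) (fst \<mu>) \<in> op_space P (l + m - 1)"
      "op_comp P l m i (fst \<kappa>) (snd \<mu>) \<in> op_space P (l + m - 1)"
      "w l m i (fst \<kappa>) (fst \<mu>) \<in> op_space P (l + m - 1)"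
      "op_comp P m n j (fst \<mu>) (fst \<nu>) \<in> op_space P (m + n - 1)"
      "op_comp P m n j (snd \<mu>) (fst \<nu>) \<in> op_space P (m + n - 1)"
      "op_comp P m n j (fst \<mu>) (snd \<nu>) \<in> op_space P (m + n - 1)"
      "w m n j (fst \<mu>) (fst \<nu>) \<in> op_space P (m + n - 1)"
      by (intro comp_closed cocycle_closed[OF w] ij \<kappa> \<mu> \<nu>)+
    have left: "op_comp P (l + m - 1) n (i - 1 + j)
        (op_comp P l m i (snd \<kappa>) (fst \<mu>) + op_comp P l m i (fst \<kappa>) (snd \<mu>) + w l m i (fst \<kappa>) (fst \<mu>)) (fst \<nu>)
      = op_comp P l (m + n - 1) i (snd \<kappa>) (op_comp P m n j (fst \<mu>) (fst \<nu>))
        + op_comp P l (m + n - 1) i (fst \<kappa>) (op_comp P m n j (snd \<mu>) (fst \<nu>))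
        + op_comp P (l + m - 1) n (i - 1 + j) (w l m i (fst \<kappa>) (fst \<mu>)) (fst \<nu>)"
      by (simp only: comp_add_left[OF bounds \<nu>(1)] C space_add A \<kappa> \<mu> \<nu>)
    have right: "op_comp P l (m + n - 1) i (fst \<kappa>)
        (op_comp P m n j (snd \<mu>) (fst \<nu>) + op_comp P m n j (fst \<mu>) (snd \<nu>) + w m n j (fst \<mu>) (fst \<nu>))
      = op_comp P l (m + n - 1) i (fst \<kappa>) (op_comp P m n j (snd \<mu>) (fst \<nu>))
        + op_comp P l (m + n - 1) i (fst \<kappa>) (op_comp P m n j (fst \<mu>) (snd \<nu>))
        + op_comp P l (m + n - 1) i (fst \<kappa>) (w m n j (fst \<mu>) (fst \<nu>))"
      by (simp only: comp_add_right[OF ij(1,2) \<kappa>(1)] C space_add)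
    show "op_comp (deformed_operad P w) (l + m - 1) n (i - 1 + j) (op_comp (deformed_operad P w) l m i \<kappa> \<mu>) \<nu>
        = op_comp (deformed_operad P w) l (m + n - 1) i \<kappa> (op_comp (deformed_operad P w) m n j \<mu> \<nu>)"
      unfolding deformed_operad_simps fst_conv snd_conv left right
      using Z2_sequential[OF w \<kappa>(1) \<mu>(1) \<nu>(1) ij] A[OF \<kappa>(1) \<mu>(1) \<nu>(1)] A[OF \<kappa>(1) \<mu>(1) \<nu>(2)]
      by (simp only: prod.inject) (simp only: add.assoc add.left_commute add.commute)
  next
    fix \<kappa> \<mu> \<nu> :: "'p \<times> 'p" and l m n i k :: nat
    assume "\<kappa> \<in> op_space (deformed_operad P w) l" "\<mu> \<in> op_space (deformed_operad P w) m"
      "\<nu> \<in> op_space (deformed_operad P w) n" and ik: "1 \<le> i" "i < k" "k \<le> l"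
    then have \<kappa>: "fst \<kappa> \<in> op_space P l" "snd \<kappa> \<in> op_space P l"
      and \<mu>: "fst \<mu> \<in> op_space P m" "snd \<mu> \<in> op_space P m"
      and \<nu>: "fst \<nu> \<in> op_space P n" "snd \<nu> \<in> op_space P n" by auto
    have bounds: "1 \<le> k - 1 + m" "k - 1 + m \<le> l + m - 1" "i \<le> l + n - 1" "i \<le> l" "1 \<le> k"
      using ik by linarith+
    note A = assoc_parallel[OF _ _ _ ik]
    have C: "op_comp P l m i (fst \<kappa>) (fst \<mu>) \<in> op_space P (l + m - 1)"
      "op_comp P l m i (snd \<kappa>) (fst \<mu>) \<in> op_space P (l + m - 1)"
      "op_comp P l m i (fst \<kappa>) (snd \<mu>) \<in> op_space P (l + m - 1)"
      "w l m i (fst \<kappa>) (fst \<mu>) \<in> op_space P (l + m - 1)"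
      "op_comp P l n k (fst \<kappa>) (fst \<nu>) \<in> op_space P (l + n - 1)"
      "op_comp P l n k (snd \<kappa>) (fst \<nu>) \<in> op_space P (l + n - 1)"
      "op_comp P l n k (fst \<kappa>) (snd \<nu>) \<in> op_space P (l + n - 1)"
      "w l n k (fst \<kappa>) (fst \<nu>) \<in> op_space P (l + n - 1)"
      by (intro comp_closed cocycle_closed[OF w] ik bounds \<kappa> \<mu> \<nu>)+
    have left: "op_comp P (l + m - 1) n (k - 1 + m)
        (op_comp P l m i (snd \<kappa>) (fst \<mu>) + op_comp P l m i (fst \<kappa>) (snd \<mu>) + w l m i (fst \<kappa>) (fst \<mu>)) (fst \<nu>)
      = op_comp P (l + n - 1) m i (op_comp P l n k (snd \<kappa>) (fst \<nu>)) (fst \<mu>)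
        + op_comp P (l + n - 1) m i (op_comp P l n k (fst \<kappa>) (fst \<nu>)) (snd \<mu>)
        + op_comp P (l + m - 1) n (k - 1 + m) (w l m i (fst \<kappa>) (fst \<mu>)) (fst \<nu>)"
      by (simp only: comp_add_left[OF bounds(1,2) \<nu>(1)] C space_add A \<kappa> \<mu> \<nu>)
    have right: "op_comp P (l + n - 1) m i
        (op_comp P l n k (snd \<kappa>) (fst \<nu>) + op_comp P l n k (fst \<kappa>) (snd \<nu>) + w l n k (fst \<kappa>) (fst \<nu>)) (fst \<mu>)
      = op_comp P (l + n - 1) m i (op_comp P l n k (snd \<kappa>) (fst \<nu>)) (fst \<mu>)
        + op_comp P (l + n - 1) m i (op_comp P l n k (fst \<kappa>) (snd \<nu>)) (fst \<mu>)
        + op_comp P (l + n - 1) m i (w l n k (fst \<kappa>) (fst \<nu>)) (fst \<mu>)"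
      by (simp only: comp_add_left[OF ik(1) bounds(3) \<mu>(1)] C space_add)
    show "op_comp (deformed_operad P w) (l + m - 1) n (k - 1 + m) (op_comp (deformed_operad P w) l m i \<kappa> \<mu>) \<nu>
        = op_comp (deformed_operad P w) (l + n - 1) m i (op_comp (deformed_operad P w) l n k \<kappa> \<nu>) \<mu>"
      unfolding deformed_operad_simps fst_conv snd_conv left right
      using Z2_parallel[OF w \<kappa>(1) \<mu>(1) \<nu>(1) ik] A[OF \<kappa>(1) \<mu>(1) \<nu>(1)] A[OF \<kappa>(1) \<mu>(1) \<nu>(2)]
      by (simp only: prod.inject) (simp only: add.assoc add.left_commute add.commute)
  next
    fix \<mu> \<nu> :: "'p \<times> 'p" and m n i :: nat and \<sigma> :: "nat \<Rightarrow> nat"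
    assume "\<mu> \<in> op_space (deformed_operad P w) m" "\<nu> \<in> op_space (deformed_operad P w) n"
      and i: "1 \<le> i" "i \<le> m" and \<sigma>: "\<sigma> permutes {1..n}"
    then have \<mu>: "fst \<mu> \<in> op_space P m" "snd \<mu> \<in> op_space P m"
      and \<nu>: "fst \<nu> \<in> op_space P n" "snd \<nu> \<in> op_space P n" by auto
    note E = equivariant_inner[OF _ _ i \<sigma>]
    show "op_comp (deformed_operad P w) m n i \<mu> (op_act (deformed_operad P w) n \<nu> \<sigma>)
        = op_act (deformed_operad P w) (m + n - 1) (op_comp (deformed_operad P w) m n i \<mu> \<nu>) (inner_perm n i \<sigma>)"
      unfolding deformed_operad_simps fst_conv snd_conv
      by (simp only: E \<mu> \<nu> Z2_inner[OF w \<mu>(1) \<nu>(1) i \<sigma>] act_add[OF inner_perm_permutes[OF \<sigma> i]]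
          comp_closed[OF i] cocycle_closed[OF w i] space_add)
  next
    fix \<mu> \<nu> :: "'p \<times> 'p" and m n i :: nat and \<phi> :: "nat \<Rightarrow> nat"
    assume "\<mu> \<in> op_space (deformed_operad P w) m" "\<nu> \<in> op_space (deformed_operad P w) n"
      and i: "1 \<le> i" "i \<le> m" and \<phi>: "\<phi> permutes {1..m}"
    then have \<mu>: "fst \<mu> \<in> op_space P m" "snd \<mu> \<in> op_space P m"
      and \<nu>: "fst \<nu> \<in> op_space P n" "snd \<nu> \<in> op_space P n" by auto
    have \<phi>i: "1 \<le> \<phi> i" "\<phi> i \<le> m" using permutes_in_image[OF \<phi>, of i] i by auto
    note E = equivariant_outer[OF _ _ i \<phi>]
    show "op_comp (deformed_operad P w) m n i (op_act (deformed_operad P w) m \<mu> \<phi>) \<nu>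
        = op_act (deformed_operad P w) (m + n - 1) (op_comp (deformed_operad P w) m n (\<phi> i) \<mu> \<nu>) (outer_perm n i \<phi>)"
      unfolding deformed_operad_simps fst_conv snd_conv
      by (simp only: E \<mu> \<nu> Z2_outer[OF w \<mu>(1) \<nu>(1) i \<phi>] act_add[OF outer_perm_permutes[OF \<phi> i]]
          comp_closed[OF \<phi>i] cocycle_closed[OF w \<phi>i] space_add)
  qed
qed

end

context generated_operad
begin

text \<open>The \<open>\<epsilon>\<close>-part of a lift of \<open>\<pi>\<close> to a homomorphism from the free operad to the operad deformed
  by \<open>w\<close>.\<close>

definition twisted_derivation :: "'p cochain2 \<Rightarrow> (nat \<Rightarrow> (tree \<Rightarrow>\<^sub>0 'k) \<Rightarrow> 'p) \<Rightarrow> bool" where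
  "twisted_derivation w \<delta> \<longleftrightarrow>
     (\<forall>n. linear_between (op_scale (free_operad g ar)) (op_scale P)
        (op_space (free_operad g ar) n) (op_space P n) (\<delta> n)) \<and>
     (\<forall>n. \<forall>p\<in>op_space (free_operad g ar) n. \<forall>\<sigma>. \<sigma> permutes {1..n} \<longrightarrow>
        \<delta> n (op_act (free_operad g ar) n p \<sigma>) = op_act P n (\<delta> n p) \<sigma>) \<and>
     (\<forall>m n i. \<forall>p\<in>op_space (free_operad g ar) m. \<forall>q\<in>op_space (free_operad g ar) n. 1 \<le> i \<and> i \<le> m \<longrightarrow>
        \<delta> (m + n - 1) (op_comp (free_operad g ar) m n i p q) =
        op_comp P m n i (\<delta> m p) (\<pi> n q) + op_comp P m n i (\<pi> m p) (\<delta> n q) + w m n i (\<pi> m p) (\<pi> n q))"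

lemma twisted_derivationD:
  assumes "twisted_derivation w \<delta>"
  shows "linear_between (op_scale (free_operad g ar)) (op_scale P)
        (op_space (free_operad g ar) n) (op_space P n) (\<delta> n)"
    and "\<lbrakk>p \<in> op_space (free_operad g ar) n; \<sigma> permutes {1..n}\<rbrakk>
      \<Longrightarrow> \<delta> n (op_act (free_operad g ar) n p \<sigma>) = op_act P n (\<delta> n p) \<sigma>"
    and "\<lbrakk>p \<in> op_space (free_operad g ar) m; q \<in> op_space (free_operad g ar) n; 1 \<le> i; i \<le> m\<rbrakk>
      \<Longrightarrow> \<delta> (m + n - 1) (op_comp (free_operad g ar) m n i p q) =
        op_comp P m n i (\<delta> m p) (\<pi> n q) + op_comp P m n i (\<pi> m p) (\<delta> n q) + w m n i (\<pi> m p) (\<pi> n q)"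
  using assms unfolding twisted_derivation_def by blast+

text \<open>The lift is the one that sends each generator to itself, with \<open>\<epsilon>\<close>-part 0.  Its first
  component is \<open>\<pi>\<close> by uniqueness, and its second component satisfies the twisted Leibniz rule by the
  definition of the deformed composition.\<close>

lemma twisted_derivation_exists:
  assumes w: "w \<in> Z2 P"
  obtains \<delta> where "twisted_derivation w \<delta>"
proof -
  interpret D: operad "deformed_operad P w" by (rule deformed_operad_is_operad[OF w])
  interpret D: operad_with_generators "deformed_operad P w" g ar "\<lambda>x. (gen x, 0)"
    by standard (simp add: gen_closed space_0)
  define f where "f = free_extension (deformed_operad P w) (\<lambda>x. (gen x, 0))"
  have f: "operad_hom (free_operad g ar) (deformed_operad P w) f"
    unfolding f_def by (rule D.free_extension_hom)
  have linear: "linear_between (op_scale (free_operad g ar)) (op_scale P)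
      (op_space (free_operad g ar) n) (op_space P n) (\<lambda>p. h (f n p))" if "h \<in> {fst, snd}" for n h
    using that operad_hom_linear[OF f, of n]
    unfolding linear_between_def by (auto simp: plus_prod_def mem_Times_iff image_subset_iff)
  have "operad_hom (free_operad g ar) P (\<lambda>n p. fst (f n p))"
    unfolding operad_hom_def
    using linear operad_hom_id[OF f] operad_hom_act[OF f] operad_hom_comp[OF f] by simp
  from free_hom_unique[OF this presentation_hom]
  have fst: "fst (f n p) = \<pi> n p" if "p \<in> op_space (free_operad g ar) n" for n p
    using that by (simp add: f_def D.free_extension_corolla flip: gen_def)
  have "twisted_derivation w (\<lambda>n p. snd (f n p))"
    unfolding twisted_derivation_def
    using linear operad_hom_act[OF f] operad_hom_comp[OF f] by (simp add: fst)
  with that show ?thesis by blast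
qed

lemma twisted_derivation_lincomb:
  assumes z: "twisted_derivation z \<delta>z" and v: "\<And>v. v \<in> S \<Longrightarrow> twisted_derivation v (\<delta> v)"
  shows "twisted_derivation (z - (\<Sum>v\<in>S. scale_cochain2 P (c v) v))
    (\<lambda>n p. \<delta>z n p - (\<Sum>v\<in>S. op_scale P (c v) (\<delta> v n p)))"
proof -
  note lin_z = twisted_derivationD(1)[OF z] and lin_v = twisted_derivationD(1)[OF v]
  note closed_z = linear_between_closed[OF lin_z] and closed_v = linear_between_closed[OF lin_v]
  have closed_sum: "(\<Sum>v\<in>S. op_scale P (c v) (\<delta> v n p)) \<in> op_space P n"
    if "p \<in> op_space (free_operad g ar) n" for n p
    using that by (intro space_sum space_scale closed_v)
  have linear: "linear_between (op_scale (free_operad g ar)) (op_scale P)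
      (op_space (free_operad g ar) n) (op_space P n) (\<lambda>p. \<delta>z n p - (\<Sum>v\<in>S. op_scale P (c v) (\<delta> v n p)))" for n
    unfolding linear_between_def
  proof (intro conjI image_subsetI ballI allI)
    fix p :: "tree \<Rightarrow>\<^sub>0 'k" assume p: "p \<in> op_space (free_operad g ar) n"
    show "\<delta>z n p - (\<Sum>v\<in>S. op_scale P (c v) (\<delta> v n p)) \<in> op_space P n"
      by (intro space_diff closed_z closed_sum p)
    show "\<delta>z n (op_scale (free_operad g ar) a p) - (\<Sum>v\<in>S. op_scale P (c v) (\<delta> v n (op_scale (free_operad g ar) a p)))
        = op_scale P a (\<delta>z n p - (\<Sum>v\<in>S. op_scale P (c v) (\<delta> v n p)))" for a
    proof -
      have "(\<Sum>v\<in>S. op_scale P (c v) (\<delta> v n (op_scale (free_operad g ar) a p)))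
          = (\<Sum>v\<in>S. op_scale P a (op_scale P (c v) (\<delta> v n p)))"
        by (intro sum.cong refl) (simp add: linear_between_scale[OF lin_v p] mult.commute)
      then show ?thesis
        by (simp add: linear_between_scale[OF lin_z p] scale_right_diff_distrib scale_sum_right)
    qed
    fix q :: "tree \<Rightarrow>\<^sub>0 'k" assume q: "q \<in> op_space (free_operad g ar) n"
    have "(\<Sum>v\<in>S. op_scale P (c v) (\<delta> v n (p + q)))
        = (\<Sum>v\<in>S. op_scale P (c v) (\<delta> v n p) + op_scale P (c v) (\<delta> v n q))"
      by (intro sum.cong refl) (simp only: linear_between_add[OF lin_v p q] scale_right_distrib)
    then show "\<delta>z n (p + q) - (\<Sum>v\<in>S. op_scale P (c v) (\<delta> v n (p + q)))
        = \<delta>z n p - (\<Sum>v\<in>S. op_scale P (c v) (\<delta> v n p)) + (\<delta>z n q - (\<Sum>v\<in>S. op_scale P (c v) (\<delta> v n q)))"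
      by (simp add: linear_between_add[OF lin_z p q] sum.distrib)
  qed
  moreover have "\<delta>z n (op_act (free_operad g ar) n p \<sigma>)
      - (\<Sum>v\<in>S. op_scale P (c v) (\<delta> v n (op_act (free_operad g ar) n p \<sigma>)))
      = op_act P n (\<delta>z n p - (\<Sum>v\<in>S. op_scale P (c v) (\<delta> v n p))) \<sigma>"
    if p: "p \<in> op_space (free_operad g ar) n" and \<sigma>: "\<sigma> permutes {1..n}" for n p \<sigma>
  proof -
    have "(\<Sum>v\<in>S. op_scale P (c v) (\<delta> v n (op_act (free_operad g ar) n p \<sigma>)))
        = (\<Sum>v\<in>S. op_scale P (c v) (op_act P n (\<delta> v n p) \<sigma>))"
      by (intro sum.cong refl) (simp only: twisted_derivationD(2)[OF v p \<sigma>])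
    also have "\<dots> = op_act P n (\<Sum>v\<in>S. op_scale P (c v) (\<delta> v n p)) \<sigma>"
      by (rule act_sum[symmetric, OF \<sigma> closed_v[OF _ p]])
    finally show ?thesis
      by (simp only: twisted_derivationD(2)[OF z p \<sigma>]
          linear_between_diff[OF act_linear[OF \<sigma>] space_subspace closed_z[OF p] closed_sum[OF p]])
  qed
  moreover have "\<delta>z (m + n - 1) (op_comp (free_operad g ar) m n i p q)
      - (\<Sum>v\<in>S. op_scale P (c v) (\<delta> v (m + n - 1) (op_comp (free_operad g ar) m n i p q)))
      = op_comp P m n i (\<delta>z m p - (\<Sum>v\<in>S. op_scale P (c v) (\<delta> v m p))) (\<pi> n q)
        + op_comp P m n i (\<pi> m p) (\<delta>z n q - (\<Sum>v\<in>S. op_scale P (c v) (\<delta> v n q)))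
        + (z - (\<Sum>v\<in>S. scale_cochain2 P (c v) v)) m n i (\<pi> m p) (\<pi> n q)"
    if p: "p \<in> op_space (free_operad g ar) m" and q: "q \<in> op_space (free_operad g ar) n"
      and i: "1 \<le> i" "i \<le> m" for m n i p q
  proof -
    note \<pi>p = presentation_closed[OF p] and \<pi>q = presentation_closed[OF q]
    have "(\<Sum>v\<in>S. op_scale P (c v) (\<delta> v (m + n - 1) (op_comp (free_operad g ar) m n i p q)))
        = (\<Sum>v\<in>S. op_scale P (c v) (op_comp P m n i (\<delta> v m p) (\<pi> n q)))
          + (\<Sum>v\<in>S. op_scale P (c v) (op_comp P m n i (\<pi> m p) (\<delta> v n q)))
          + (\<Sum>v\<in>S. op_scale P (c v) (v m n i (\<pi> m p) (\<pi> n q)))"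
      unfolding sum.distrib[symmetric]
      by (intro sum.cong refl) (simp only: twisted_derivationD(3)[OF v p q i] scale_right_distrib)
    also have "(\<Sum>v\<in>S. op_scale P (c v) (op_comp P m n i (\<delta> v m p) (\<pi> n q)))
        = op_comp P m n i (\<Sum>v\<in>S. op_scale P (c v) (\<delta> v m p)) (\<pi> n q)"
      by (rule comp_sum_left[symmetric, OF i \<pi>q closed_v[OF _ p]])
    also have "(\<Sum>v\<in>S. op_scale P (c v) (op_comp P m n i (\<pi> m p) (\<delta> v n q)))
        = op_comp P m n i (\<pi> m p) (\<Sum>v\<in>S. op_scale P (c v) (\<delta> v n q))"
      by (rule comp_sum_right[symmetric, OF i \<pi>p closed_v[OF _ q]])
    also have "(\<Sum>v\<in>S. op_scale P (c v) (v m n i (\<pi> m p) (\<pi> n q)))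
        = (\<Sum>v\<in>S. scale_cochain2 P (c v) v) m n i (\<pi> m p) (\<pi> n q)"
      by (simp add: sum_fun_apply scale_cochain2_def)
    finally show ?thesis
      by (simp add: twisted_derivationD(3)[OF z p q i, simplified]
          linear_between_diff[OF comp_linear_left[OF i \<pi>q] space_subspace closed_z[OF p] closed_sum[OF p]]
          linear_between_diff[OF comp_linear_right[OF i \<pi>p] space_subspace closed_z[OF q] closed_sum[OF q]])
  qed
  ultimately show ?thesis unfolding twisted_derivation_def by blast
qed

text \<open>If \<open>\<pi> x\<close> and \<open>\<delta> x\<close> are zero, then so are all three terms in the formula for \<open>\<delta>\<close> of a
  composite with \<open>x\<close>.\<close>

lemma twisted_derivation_vanishes_on_ideal:
  assumes \<delta>: "twisted_derivation w \<delta>"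
    and w: "\<And>m n i \<mu> \<nu>. \<lbrakk>1 \<le> i; i \<le> m; \<mu> \<in> op_space P m; \<nu> \<in> op_space P n; \<mu> = 0 \<or> \<nu> = 0\<rbrakk> \<Longrightarrow> w m n i \<mu> \<nu> = 0"
    and R: "\<forall>(n, r)\<in>R. r \<in> op_space (free_operad g ar) n"
    and \<pi>R: "\<And>n p. operad_ideal (free_operad g ar) R n p \<Longrightarrow> \<pi> n p = 0"
    and \<delta>R: "\<And>n r. (n, r) \<in> R \<Longrightarrow> \<delta> n r = 0"
    and p: "operad_ideal (free_operad g ar) R n p"
  shows "\<delta> n p = 0"
  using p
proof induction
  case (generator n r)
  then show ?case by (rule \<delta>R)
next
  case (zero n)
  show ?case by (rule linear_between_zero[OF twisted_derivationD(1)[OF \<delta>] free_space_0])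
next
  case (add n x y)
  note mem = free_ideal_in_space[OF R add.hyps(1)] free_ideal_in_space[OF R add.hyps(2)]
  show ?case using linear_between_add[OF twisted_derivationD(1)[OF \<delta>] mem] add.IH by simp
next
  case (scale n x c)
  show ?case
    using linear_between_scale[OF twisted_derivationD(1)[OF \<delta>] free_ideal_in_space[OF R scale.hyps]] scale.IH
    by simp
next
  case (act n x \<sigma>)
  have "op_act P n 0 \<sigma> = 0" by (rule linear_between_zero[OF act_linear[OF act.hyps(2)] space_0])
  then show ?case
    using twisted_derivationD(2)[OF \<delta> free_ideal_in_space[OF R act.hyps(1)] act.hyps(2)] act.IH by simp
next
  case (comp_left m x y n i)
  note x = free_ideal_in_space[OF R comp_left.hyps(1)] and y = comp_left.hyps(2) and i = comp_left.hyps(3,4)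
  note \<pi>y = presentation_closed[OF y] and \<delta>y = linear_between_closed[OF twisted_derivationD(1)[OF \<delta>] y]
  show ?case
    unfolding twisted_derivationD(3)[OF \<delta> x y i] \<pi>R[OF comp_left.hyps(1)] comp_left.IH
    using comp_zero_left[OF i \<pi>y] comp_zero_left[OF i \<delta>y] w[OF i space_0 \<pi>y] by simp
next
  case (comp_right x m n y i)
  note x = comp_right.hyps(1) and y = free_ideal_in_space[OF R comp_right.hyps(2)] and i = comp_right.hyps(3,4)
  note \<pi>x = presentation_closed[OF x] and \<delta>x = linear_between_closed[OF twisted_derivationD(1)[OF \<delta>] x]
  show ?case
    unfolding twisted_derivationD(3)[OF \<delta> x y i] \<pi>R[OF comp_right.hyps(2)] comp_right.IH
    using comp_zero_right[OF i \<pi>x] comp_zero_right[OF i \<delta>x] w[OF i \<pi>x space_0] by simp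
qed

text \<open>The map induced on \<open>P\<close> satisfies the twisted Leibniz rule, which says that its coboundary
  is \<open>w\<close>.\<close>

lemma twisted_derivation_descends:
  assumes \<delta>: "twisted_derivation w \<delta>"
    and kernel: "\<And>n p. \<lbrakk>p \<in> op_space (free_operad g ar) n; \<pi> n p = 0\<rbrakk> \<Longrightarrow> \<delta> n p = 0"
    and outside: "\<And>m n i \<mu> \<nu>. \<not> (1 \<le> i \<and> i \<le> m \<and> \<mu> \<in> op_space P m \<and> \<nu> \<in> op_space P n) \<Longrightarrow> w m n i \<mu> \<nu> = 0"
  shows "w \<in> B2 P"
proof -
  obtain D0 where D0: "\<And>n p. p \<in> op_space (free_operad g ar) n \<Longrightarrow> D0 n (\<pi> n p) = \<delta> n p"
    and D0_linear: "\<And>n. linear_between (op_scale P) (op_scale P) (op_space P n) (op_space P n) (D0 n)"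
    using descend_along_presentation[OF twisted_derivationD(1)[OF \<delta>] kernel] by blast
  define D where "D n \<mu> = (if \<mu> \<in> op_space P n then D0 n \<mu> else 0)" for n \<mu>
  have D: "D n (\<pi> n p) = \<delta> n p" if "p \<in> op_space (free_operad g ar) n" for n p
    using D0[OF that] presentation_closed[OF that] by (simp add: D_def)
  have "linear_between (op_scale P) (op_scale P) (op_space P n) (op_space P n) (D n)" for n
    using D0_linear[of n] space_add space_scale unfolding linear_between_def D_def by auto
  moreover have "D n (op_act P n \<mu> \<sigma>) = op_act P n (D n \<mu>) \<sigma>"
    if \<mu>: "\<mu> \<in> op_space P n" and \<sigma>: "\<sigma> permutes {1..n}" for n \<mu> \<sigma>
  proof -
    obtain p where p: "p \<in> op_space (free_operad g ar) n" and eq: "\<mu> = \<pi> n p"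
      using presentation_preimage[OF \<mu>] .
    show ?thesis
      unfolding eq operad_hom_act[OF presentation_hom p \<sigma>, symmetric]
      by (simp only: D[OF p] D[OF free_space_act[OF p \<sigma>]] twisted_derivationD(2)[OF \<delta> p \<sigma>])
  qed
  ultimately have "D \<in> equivariant_endo P" by (auto simp: equivariant_endo_def D_def)
  moreover have "w m n i \<mu> \<nu> = coboundary2 P D m n i \<mu> \<nu>" for m n i \<mu> \<nu>
  proof (cases "1 \<le> i \<and> i \<le> m \<and> \<mu> \<in> op_space P m \<and> \<nu> \<in> op_space P n")
    case True
    then have i: "1 \<le> i" "i \<le> m" and \<mu>: "\<mu> \<in> op_space P m" and \<nu>: "\<nu> \<in> op_space P n" by auto
    obtain p where p: "p \<in> op_space (free_operad g ar) m" and eq_p: "\<mu> = \<pi> m p"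
      using presentation_preimage[OF \<mu>] .
    obtain q where q: "q \<in> op_space (free_operad g ar) n" and eq_q: "\<nu> = \<pi> n q"
      using presentation_preimage[OF \<nu>] .
    have "D (m + n - 1) (op_comp P m n i \<mu> \<nu>)
        = op_comp P m n i (D m \<mu>) \<nu> + op_comp P m n i \<mu> (D n \<nu>) + w m n i \<mu> \<nu>"
      unfolding eq_p eq_q operad_hom_comp[OF presentation_hom p q i, symmetric]
      by (simp only: D[OF p] D[OF q] D[OF free_space_comp[OF p q i]] twisted_derivationD(3)[OF \<delta> p q i])
    then show ?thesis using True by (simp add: coboundary2_def)
  qed (use outside in \<open>auto simp: coboundary2_def\<close>)
  then have "w = coboundary2 P D" by (simp add: fun_eq_iff)
  ultimately show ?thesis by (auto simp: B2_def)
qed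

text \<open>The values of \<open>\<delta>\<close> on the relations are the only obstruction to being a coboundary.\<close>

theorem H2_finite_dimensional:
  assumes "locally_finite P" and "finite R"
    and R: "\<forall>(n, r)\<in>R. r \<in> op_space (free_operad g ar) n"
    and kernel: "\<And>n p. p \<in> op_space (free_operad g ar) n \<Longrightarrow> \<pi> n p = 0 \<longleftrightarrow> operad_ideal (free_operad g ar) R n p"
  shows "finite_dimensional_quotient (scale_cochain2 P) (Z2 P) (B2 P)"
proof -
  \<comment> \<open>Lifts are not unique; one is chosen for each cocycle.\<close>
  have "\<forall>w\<in>Z2 P. \<exists>\<delta>. twisted_derivation w \<delta>" using twisted_derivation_exists by metis
  then obtain \<delta> where \<delta>: "\<And>w. w \<in> Z2 P \<Longrightarrow> twisted_derivation w (\<delta> w)" by metis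
  show ?thesis
  proof (rule finite_dimensional_quotientI[where X = R and W = "\<lambda>x. op_space P (fst x)"
        and \<phi> = "\<lambda>w x. \<delta> w (fst x) (snd x)"])
    show "\<delta> w (fst x) (snd x) \<in> op_space P (fst x)" if "w \<in> Z2 P" "x \<in> R" for w x
      using linear_between_closed[OF twisted_derivationD(1)[OF \<delta>[OF that(1)]]] R that(2) by auto
    show "z - (\<Sum>v\<in>S. scale_cochain2 P (c v) v) \<in> B2 P"
      if z: "z \<in> Z2 P" and S: "S \<subseteq> Z2 P"
        and eq: "\<forall>x\<in>R. \<delta> z (fst x) (snd x) = (\<Sum>v\<in>S. op_scale P (c v) (\<delta> v (fst x) (snd x)))" for z S c
    proof -
      define w where "w = z - (\<Sum>v\<in>S. scale_cochain2 P (c v) v)"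
      define \<delta>w where "\<delta>w n p = \<delta> z n p - (\<Sum>v\<in>S. op_scale P (c v) (\<delta> v n p))" for n p
      have w_apply: "w m n i \<mu> \<nu> = z m n i \<mu> \<nu> - (\<Sum>v\<in>S. op_scale P (c v) (v m n i \<mu> \<nu>))" for m n i \<mu> \<nu>
        by (simp add: w_def sum_fun_apply scale_cochain2_def)
      have v: "v \<in> Z2 P" if "v \<in> S" for v using that S by blast
      have tw: "twisted_derivation w \<delta>w"
        unfolding w_def \<delta>w_def by (rule twisted_derivation_lincomb[OF \<delta>[OF z] \<delta>[OF v]])
      have outside: "w m n i \<mu> \<nu> = 0"
        if "\<not> (1 \<le> i \<and> i \<le> m \<and> \<mu> \<in> op_space P m \<and> \<nu> \<in> op_space P n)" for m n i \<mu> \<nu>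
      proof -
        have "(\<Sum>v\<in>S. op_scale P (c v) (v m n i \<mu> \<nu>)) = 0"
          by (intro sum.neutral ballI) (simp only: Z2_outside[OF v that] scale_zero_right)
        then show ?thesis by (simp add: w_apply Z2_outside[OF z that])
      qed
      have at_zero: "w m n i \<mu> \<nu> = 0"
        if i: "1 \<le> i" "i \<le> m" and \<mu>: "\<mu> \<in> op_space P m" and \<nu>: "\<nu> \<in> op_space P n" and "\<mu> = 0 \<or> \<nu> = 0"
        for m n i \<mu> \<nu>
      proof -
        have zero: "u m n i \<mu> \<nu> = 0" if "u \<in> Z2 P" for u
          using linear_between_zero[OF Z2_linear_left[OF that i \<nu>] space_0]
            linear_between_zero[OF Z2_linear_right[OF that i \<mu>] space_0] \<open>\<mu> = 0 \<or> \<nu> = 0\<close> by auto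
        have "(\<Sum>v\<in>S. op_scale P (c v) (v m n i \<mu> \<nu>)) = 0"
          by (intro sum.neutral ballI) (simp only: zero[OF v] scale_zero_right)
        then show ?thesis by (simp add: w_apply zero[OF z])
      qed
      have "w \<in> B2 P"
      proof (rule twisted_derivation_descends[OF tw _ outside])
        fix n p assume p: "p \<in> op_space (free_operad g ar) n" "\<pi> n p = 0"
        show "\<delta>w n p = 0"
        proof (rule twisted_derivation_vanishes_on_ideal[OF tw at_zero R])
          show "\<pi> n p = 0" if "operad_ideal (free_operad g ar) R n p" for n p
            using kernel free_ideal_in_space[OF R that] that by blast
          show "\<delta>w n r = 0" if "(n, r) \<in> R" for n r using bspec[OF eq that] by (simp add: \<delta>w_def)
          show "operad_ideal (free_operad g ar) R n p" using kernel p by blast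
        qed
      qed
      then show ?thesis by (simp only: w_def)
    qed
  qed (use assms(1,2) in \<open>auto simp: locally_finite_def\<close>)
qed

end

section \<open>The automorphism group\<close>

lemma Aut_carrier_iff: "f \<in> carrier (Aut P) \<longleftrightarrow> operad_hom P P f \<and>
    (\<forall>n. bij_betw (f n) (op_space P n) (op_space P n) \<and> f n \<in> extensional (op_space P n))"
  and Aut_mult: "f \<otimes>\<^bsub>Aut P\<^esub> h = (\<lambda>n. compose (op_space P n) (f n) (h n))"
  and Aut_one: "\<one>\<^bsub>Aut P\<^esub> = (\<lambda>n. \<lambda>x\<in>op_space P n. x)"
  by (simp_all add: Aut_def)

context operad
begin

lemma operad_hom_restrict:
  assumes f: "operad_hom P P f"
  shows "operad_hom P P (\<lambda>n. restrict (f n) (op_space P n))"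
proof -
  have "linear_between (op_scale P) (op_scale P) (op_space P n) (op_space P n) (restrict (f n) (op_space P n))" for n
    using operad_hom_linear[OF f, of n] space_add space_scale by (auto simp: linear_between_def)
  then show ?thesis
    unfolding operad_hom_def
    using operad_hom_id[OF f] operad_hom_act[OF f] operad_hom_comp[OF f] id_closed act_closed comp_closed
    by simp
qed

lemma operad_hom_compose:
  assumes f: "operad_hom P P f" and h: "operad_hom P P h"
  shows "operad_hom P P (\<lambda>n x. f n (h n x))"
proof -
  note lin_f = operad_hom_linear[OF f] and lin_h = operad_hom_linear[OF h]
  have "linear_between (op_scale P) (op_scale P) (op_space P n) (op_space P n) (\<lambda>x. f n (h n x))" for n
    unfolding linear_between_def
    by (auto simp: linear_between_closed[OF lin_f] linear_between_closed[OF lin_h]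
        linear_between_add[OF lin_f] linear_between_add[OF lin_h]
        linear_between_scale[OF lin_f] linear_between_scale[OF lin_h])
  then show ?thesis
    unfolding operad_hom_def
    using operad_hom_id[OF f] operad_hom_act[OF f] operad_hom_comp[OF f] linear_between_closed[OF lin_h]
      operad_hom_id[OF h] operad_hom_act[OF h] operad_hom_comp[OF h] by simp
qed

lemma operad_hom_inverse:
  assumes f: "operad_hom P P f" and inj: "\<And>n. inj_on (f n) (op_space P n)"
    and h: "\<And>n x. x \<in> op_space P n \<Longrightarrow> h n x \<in> op_space P n"
    and fh: "\<And>n x. x \<in> op_space P n \<Longrightarrow> f n (h n x) = x"
  shows "operad_hom P P h"
proof -
  have eq: "h n x = y" if "y \<in> op_space P n" "x = f n y" for n x y
  proof (rule inj_onD[OF inj[of n]])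
    have "x \<in> op_space P n" using operad_hom_closed[OF f that(1)] that(2) by simp
    then show "f n (h n x) = f n y" "h n x \<in> op_space P n" using fh h that(2) by auto
  qed (rule that)
  have "linear_between (op_scale P) (op_scale P) (op_space P n) (op_space P n) (h n)" for n
    unfolding linear_between_def
  proof (intro conjI image_subsetI ballI allI)
    fix x assume x: "x \<in> op_space P n"
    then show "h n x \<in> op_space P n" by (rule h)
    show "h n (op_scale P c x) = op_scale P c (h n x)" for c
      by (rule eq) (simp_all add: x h fh space_scale operad_hom_scale[OF f])
    fix y assume y: "y \<in> op_space P n"
    show "h n (x + y) = h n x + h n y"
      by (rule eq) (simp_all add: x y h fh space_add operad_hom_add[OF f])
  qed
  moreover have "h 1 (op_id P) = op_id P"
    by (rule eq) (simp_all only: id_closed operad_hom_id[OF f])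
  moreover have "h n (op_act P n \<mu> \<sigma>) = op_act P n (h n \<mu>) \<sigma>"
    if "\<mu> \<in> op_space P n" "\<sigma> permutes {1..n}" for n \<mu> \<sigma>
    by (rule eq) (simp_all only: that h fh act_closed operad_hom_act[OF f])
  moreover have "h (m + n - 1) (op_comp P m n i \<mu> \<nu>) = op_comp P m n i (h m \<mu>) (h n \<nu>)"
    if "\<mu> \<in> op_space P m" "\<nu> \<in> op_space P n" "1 \<le> i" "i \<le> m" for m n i \<mu> \<nu>
    by (rule eq) (simp_all only: that h fh comp_closed operad_hom_comp[OF f])
  ultimately show ?thesis unfolding operad_hom_def by blast
qed

lemma AutD:
  assumes "f \<in> carrier (Aut P)"
  shows "operad_hom P P f" "bij_betw (f n) (op_space P n) (op_space P n)" "f n \<in> extensional (op_space P n)"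
  using assms unfolding Aut_carrier_iff by blast+

lemma Aut_mult_closed:
  assumes f: "f \<in> carrier (Aut P)" and h: "h \<in> carrier (Aut P)"
  shows "f \<otimes>\<^bsub>Aut P\<^esub> h \<in> carrier (Aut P)"
  unfolding Aut_carrier_iff Aut_mult
proof (intro conjI allI)
  show "operad_hom P P (\<lambda>n. compose (op_space P n) (f n) (h n))"
    unfolding compose_def
    by (rule operad_hom_restrict[OF operad_hom_compose[OF AutD(1)[OF f] AutD(1)[OF h]]])
  show "bij_betw (compose (op_space P n) (f n) (h n)) (op_space P n) (op_space P n)" for n
    by (rule bij_betw_compose[OF AutD(2)[OF h] AutD(2)[OF f]])
qed simp

lemma Aut_group: "group (Aut P)"
proof (rule groupI)
  fix f h k assume f: "f \<in> carrier (Aut P)" and h: "h \<in> carrier (Aut P)" and k: "k \<in> carrier (Aut P)"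
  show "f \<otimes>\<^bsub>Aut P\<^esub> h \<in> carrier (Aut P)" by (rule Aut_mult_closed[OF f h])
  have "k n \<in> op_space P n \<rightarrow> op_space P n" for n by (rule bij_betw_imp_funcset[OF AutD(2)[OF k]])
  then show "f \<otimes>\<^bsub>Aut P\<^esub> h \<otimes>\<^bsub>Aut P\<^esub> k = f \<otimes>\<^bsub>Aut P\<^esub> (h \<otimes>\<^bsub>Aut P\<^esub> k)"
    by (simp add: Aut_mult compose_assoc[symmetric])
next
  have "operad_hom P P (\<lambda>n x. x)" by (auto simp: operad_hom_def linear_between_def)
  from operad_hom_restrict[OF this] show "\<one>\<^bsub>Aut P\<^esub> \<in> carrier (Aut P)"
    by (auto simp: Aut_carrier_iff Aut_one bij_betw_def inj_on_def)
next
  fix f assume f: "f \<in> carrier (Aut P)"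
  note bij = AutD(2)[OF f] and ext = AutD(3)[OF f]
  show "\<one>\<^bsub>Aut P\<^esub> \<otimes>\<^bsub>Aut P\<^esub> f = f"
    using bij ext by (auto simp: Aut_mult Aut_one fun_eq_iff compose_def extensional_def bij_betw_def)
  define h where "h n = restrict (inv_into (op_space P n) (f n)) (op_space P n)" for n
  have bij_h: "bij_betw (h n) (op_space P n) (op_space P n)" for n
    using bij_betw_inv_into[OF bij[of n]] by (simp add: h_def cong: bij_betw_cong)
  have "operad_hom P P h"
  proof (rule operad_hom_inverse[of f])
    show "h n x \<in> op_space P n" if "x \<in> op_space P n" for n x
      using bij_h[of n] that by (auto simp: bij_betw_def)
    show "f n (h n x) = x" if "x \<in> op_space P n" for n x
      using that bij[of n] by (simp add: h_def bij_betw_inv_into_right)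
  qed (rule AutD(1)[OF f] bij_betw_imp_inj_on[OF bij])+
  with bij_h have "h \<in> carrier (Aut P)" by (simp add: Aut_carrier_iff h_def)
  moreover have "h \<otimes>\<^bsub>Aut P\<^esub> f = \<one>\<^bsub>Aut P\<^esub>"
  proof -
    have "h n (f n x) = x" if x: "x \<in> op_space P n" for n x
    proof -
      have "f n x \<in> op_space P n" using bij[of n] x by (auto simp: bij_betw_def)
      then show ?thesis using bij_betw_inv_into_left[OF bij x] by (simp add: h_def)
    qed
    then show ?thesis by (auto simp: Aut_mult Aut_one compose_def fun_eq_iff)
  qed
  ultimately show "\<exists>y\<in>carrier (Aut P). y \<otimes>\<^bsub>Aut P\<^esub> f = \<one>\<^bsub>Aut P\<^esub>" by blast
qed

lemma homogeneous_basis_exists: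
  assumes "locally_finite P"
  obtains N d b where "homogeneous_basis P M N d b"
proof -
  have "\<exists>B. finite B \<and> independent B \<and> span B = op_space P n" for n
    using finite_basis_exists[of "op_space P n"] assms space_subspace by (metis locally_finite_def)
  then obtain B where B: "\<And>n. finite (B n)" "\<And>n. independent (B n)" "\<And>n. span (B n) = op_space P n"
    by metis
  have "finite (SIGMA n:{..M}. B n)" using B(1) by blast
  then obtain L where set_L: "set L = (SIGMA n:{..M}. B n)" and distinct_L: "distinct L"
    using finite_distinct_list by metis
  define N where "N = length L"
  define d where "d j = fst (L ! j)" for j
  define b where "b j = snd (L ! j)" for j
  have db: "(d j, b j) = L ! j" for j by (simp add: d_def b_def)
  have "homogeneous_basis P M N d b"
    unfolding homogeneous_basis_def
  proof (intro conjI allI impI)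
    fix j assume "j < N"
    then have "(d j, b j) \<in> set L" by (simp add: db N_def)
    then show "d j \<le> M" by (simp add: set_L)
  next
    fix n assume n: "n \<le> M"
    show "inj_on b {j. j < N \<and> d j = n}"
    proof (rule inj_onI)
      fix i j assume "i \<in> {j. j < N \<and> d j = n}" "j \<in> {j. j < N \<and> d j = n}" "b i = b j"
      then have "i < length L" "j < length L" "L ! i = L ! j" by (auto simp: N_def simp flip: db)
      then show "i = j" using distinct_L by (simp add: nth_eq_iff_index_eq)
    qed
    have "b ` {j. j < N \<and> d j = n} = B n"
    proof (intro equalityI subsetI)
      fix y assume "y \<in> b ` {j. j < N \<and> d j = n}"
      then obtain j where "j < N" "d j = n" "y = b j" by blast
      then have "(n, y) \<in> set L" using db[of j] by (auto simp: N_def)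
      then show "y \<in> B n" by (simp add: set_L)
    next
      fix y assume "y \<in> B n"
      then have "(n, y) \<in> set L" using n by (simp add: set_L)
      then obtain j where "j < N" "L ! j = (n, y)" unfolding in_set_conv_nth N_def by blast
      then have "j \<in> {j. j < N \<and> d j = n}" "y = b j" by (simp_all add: d_def b_def)
      then show "y \<in> b ` {j. j < N \<and> d j = n}" by blast
    qed
    then show "independent (b ` {j. j < N \<and> d j = n})" "span (b ` {j. j < N \<and> d j = n}) = op_space P n"
      using B by auto
  qed
  with that show ?thesis by blast
qed

end

subsection \<open>Families of elements depending polynomially on a matrix\<close>

text \<open>Sums of polynomial multiples of fixed elements.  This form is stable under bilinear operations,
  and the coordinates of such a family in any basis are polynomial functions.\<close>

inductive polynomial_family ::
  "('k::field, 'p::ab_group_add) operad_data \<Rightarrow> nat \<Rightarrow> nat \<Rightarrow> ('k mat \<Rightarrow> 'p) \<Rightarrow> bool"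
  for P N n where
    monomial: "\<lbrakk>p \<in> polynomial_functions N; x \<in> op_space P n\<rbrakk>
      \<Longrightarrow> polynomial_family P N n (\<lambda>A. op_scale P (p A) x)"
  | add: "\<lbrakk>polynomial_family P N n F; polynomial_family P N n G\<rbrakk>
      \<Longrightarrow> polynomial_family P N n (\<lambda>A. F A + G A)"

context operad
begin

lemma polynomial_family_closed: "polynomial_family P N n F \<Longrightarrow> F A \<in> op_space P n"
  by (induction rule: polynomial_family.induct) (auto intro: space_scale space_add)

lemma polynomial_family_const: "x \<in> op_space P n \<Longrightarrow> polynomial_family P N n (\<lambda>A. x)"
  using polynomial_family.monomial[OF polynomial_functions.const[of 1]] by force

lemma polynomial_family_sum:
  "(\<And>x. x \<in> X \<Longrightarrow> polynomial_family P N n (F x)) \<Longrightarrow> polynomial_family P N n (\<lambda>A. \<Sum>x\<in>X. F x A)"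
  by (induction X rule: infinite_finite_induct)
    (auto simp: polynomial_family_const space_0 intro: polynomial_family.add)

lemma polynomial_family_scale_by:
  assumes F: "polynomial_family P N n F" and q: "q \<in> polynomial_functions N"
  shows "polynomial_family P N n (\<lambda>A. op_scale P (q A) (F A))"
  using F
proof (induction rule: polynomial_family.induct)
  case (monomial p x)
  have "polynomial_family P N n (\<lambda>A. op_scale P (q A * p A) x)"
    by (intro polynomial_family.monomial polynomial_functions.mult q monomial)
  then show ?case by simp
next
  case (add F G)
  have "polynomial_family P N n (\<lambda>A. op_scale P (q A) (F A) + op_scale P (q A) (G A))"
    by (intro polynomial_family.add add.IH)
  then show ?case by (simp add: scale_right_distrib)
qed

lemma polynomial_family_linear:
  assumes F: "polynomial_family P N m F"
    and f: "linear_between (op_scale P) (op_scale P) (op_space P m) (op_space P n) f"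
  shows "polynomial_family P N n (\<lambda>A. f (F A))"
  using F
proof (induction rule: polynomial_family.induct)
  case (monomial p x)
  have "polynomial_family P N n (\<lambda>A. op_scale P (p A) (f x))"
    by (intro polynomial_family.monomial linear_between_closed[OF f] monomial)
  then show ?case by (simp only: linear_between_scale[OF f monomial(2)])
next
  case (add F G)
  have "polynomial_family P N n (\<lambda>A. f (F A) + f (G A))" by (intro polynomial_family.add add.IH)
  then show ?case
    by (simp only: linear_between_add[OF f polynomial_family_closed[OF add(1)] polynomial_family_closed[OF add(2)]])
qed

lemma polynomial_family_comp:
  assumes F: "polynomial_family P N m F" and G: "polynomial_family P N n G" and i: "1 \<le> i" "i \<le> m"
  shows "polynomial_family P N (m + n - 1) (\<lambda>A. op_comp P m n i (F A) (G A))"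
  using F
proof (induction rule: polynomial_family.induct)
  case (monomial p x)
  have "polynomial_family P N (m + n - 1) (\<lambda>A. op_scale P (p A) (op_comp P m n i x (G A)))"
    using monomial by (intro polynomial_family_scale_by polynomial_family_linear[OF G] comp_linear_right i)
  then show ?case by (simp only: comp_scale_left[OF i polynomial_family_closed[OF G] monomial(2)])
next
  case (add F1 F2)
  have "polynomial_family P N (m + n - 1) (\<lambda>A. op_comp P m n i (F1 A) (G A) + op_comp P m n i (F2 A) (G A))"
    by (intro polynomial_family.add add.IH)
  then show ?case
    by (simp only: comp_add_left[OF i polynomial_family_closed[OF G]
        polynomial_family_closed[OF add(1)] polynomial_family_closed[OF add(2)]])
qed

lemma polynomial_family_coordinate:
  assumes F: "polynomial_family P N n F" and B: "independent B" "span B = op_space P n"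
  shows "(\<lambda>A. representation B (F A) y) \<in> polynomial_functions N"
  using F
proof (induction rule: polynomial_family.induct)
  case (monomial p x)
  have "(\<lambda>A. p A * representation B x y) \<in> polynomial_functions N"
    by (intro polynomial_functions.mult polynomial_functions.const monomial)
  then show ?case using monomial by (simp add: representation_scale[OF B(1)] B(2))
next
  case (add F G)
  have "(\<lambda>A. representation B (F A) y + representation B (G A) y) \<in> polynomial_functions N"
    by (intro polynomial_functions.add add.IH)
  then show ?case
    using polynomial_family_closed[OF add(1)] polynomial_family_closed[OF add(2)]
    by (simp add: representation_add[OF B(1)] B(2))
qed

end

section \<open>The automorphism group as a Zariski closed matrix group\<close>

lemma GL_iff: "A \<in> carrier (GL N :: 'k::field mat monoid) \<longleftrightarrow>
    A \<in> carrier_mat N N \<and> (\<exists>B\<in>carrier_mat N N. B * A = 1\<^sub>m N \<and> A * B = 1\<^sub>m N)"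
  and GL_mult: "A \<otimes>\<^bsub>GL N\<^esub> B = A * B"
  by (auto simp: GL_def units_of_def Units_def ring_mat_simps)

lemma polynomial_functions_diff:
  assumes "p \<in> polynomial_functions N" "q \<in> polynomial_functions N"
  shows "(\<lambda>A. p A - q A) \<in> polynomial_functions N"
proof -
  have "(\<lambda>A. p A + (- 1) * q A) \<in> polynomial_functions N"
    by (intro polynomial_functions.intros assms)
  then show ?thesis by simp
qed

locale operad_with_basis = generated_operad P g ar \<pi>
  for P :: "('k::field, 'p::ab_group_add) operad_data" and g ar \<pi> +
  fixes M N :: nat and d :: "nat \<Rightarrow> nat" and b :: "nat \<Rightarrow> 'p"
  assumes basis: "homogeneous_basis P M N d b"
    and generator_arity: "x < g \<Longrightarrow> ar x \<le> M"
    and locally_finite: "locally_finite P"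
begin

definition block :: "nat \<Rightarrow> nat set" where
  "block n = {j. j < N \<and> d j = n}"

definition coord :: "nat \<Rightarrow> 'p \<Rightarrow> nat \<Rightarrow> 'k" where
  "coord n x j = representation (b ` block n) x (b j)"

lemma finite_block: "finite (block n)"
  by (simp add: block_def)

lemma block_basis:
  assumes "n \<le> M"
  shows "inj_on b (block n)" "independent (b ` block n)" "span (b ` block n) = op_space P n"
  using basis assms by (auto simp: homogeneous_basis_def block_def)

lemma block_arity: "j < N \<Longrightarrow> d j \<le> M" "j < N \<Longrightarrow> j \<in> block (d j)" "j \<in> block n \<Longrightarrow> j < N \<and> d j = n"
  using basis by (auto simp: homogeneous_basis_def block_def)

lemma basis_closed: "\<lbrakk>n \<le> M; j \<in> block n\<rbrakk> \<Longrightarrow> b j \<in> op_space P n"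
  using block_basis(3)[of n] span_base[of "b j" "b ` block n"] by blast

lemma coord_sum:
  assumes "n \<le> M" "x \<in> op_space P n"
  shows "(\<Sum>i\<in>block n. op_scale P (coord n x i) (b i)) = x"
proof -
  note B = block_basis[OF assms(1)]
  have "(\<Sum>y\<in>b ` block n. op_scale P (representation (b ` block n) x y) y) = x"
    using B assms(2) finite_block by (intro sum_representation_eq) auto
  then show ?thesis by (simp add: sum.reindex[OF B(1)] coord_def)
qed

lemma coord_lincomb:
  assumes n: "n \<le> M" and y: "\<And>l. l \<in> X \<Longrightarrow> y l \<in> op_space P n"
  shows "coord n (\<Sum>l\<in>X. op_scale P (c l) (y l)) i = (\<Sum>l\<in>X. c l * coord n (y l) i)"
proof -
  note B = block_basis[OF n]
  have "representation (b ` block n) (\<Sum>l\<in>X. op_scale P (c l) (y l))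
      = (\<lambda>z. \<Sum>l\<in>X. representation (b ` block n) (op_scale P (c l) (y l)) z)"
    by (rule representation_sum[OF B(2)]) (simp only: B(3) space_scale y)
  then show ?thesis
    unfolding coord_def by (simp add: representation_scale[OF B(2)] B(3) y)
qed

lemma coord_of_sum:
  assumes n: "n \<le> M" and j: "j \<in> block n"
  shows "coord n (\<Sum>i\<in>block n. op_scale P (c i) (b i)) j = c j"
proof -
  note B = block_basis[OF n]
  have "coord n (\<Sum>i\<in>block n. op_scale P (c i) (b i)) j
      = (\<Sum>i\<in>block n. c i * representation (b ` block n) (b i) (b j))"
    using coord_lincomb[OF n basis_closed[OF n], of "block n" "\<lambda>i. i" c j] by (simp only: coord_def)
  also have "\<dots> = (\<Sum>i\<in>block n. if i = j then c j else 0)"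
  proof (intro sum.cong refl)
    fix i assume "i \<in> block n"
    then show "c i * representation (b ` block n) (b i) (b j) = (if i = j then c j else 0)"
      using B(1) j by (auto simp: representation_basis[OF B(2)] inj_on_def)
  qed
  finally show ?thesis using j finite_block by simp
qed

lemma coord_basis: "\<lbrakk>n \<le> M; i \<in> block n; j \<in> block n\<rbrakk> \<Longrightarrow> coord n (b j) i = (if i = j then 1 else 0)"
  using coord_of_sum[of n i "\<lambda>k. if k = j then 1 else 0"] finite_block[of n]
  by (simp add: if_distrib[of "\<lambda>c. op_scale P c _"] cong: if_cong)

lemma basis_linear_eq:
  assumes n: "n \<le> M" and x: "x \<in> op_space P n"
    and f: "linear_between (op_scale P) (op_scale P) (op_space P n) (op_space P n) f"
  shows "f x = (\<Sum>j\<in>block n. op_scale P (coord n x j) (f (b j)))"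
  using linear_between_sum[OF f space_subspace basis_closed[OF n], of "block n" "\<lambda>j. j" "coord n x"]
    coord_sum[OF n x] by simp

abbreviation matrix_of :: "(nat \<Rightarrow> 'p \<Rightarrow> 'p) \<Rightarrow> 'k mat" where
  "matrix_of \<equiv> action_matrix P N d b"

lemma matrix_entry:
  "\<lbrakk>i < N; j < N\<rbrakk> \<Longrightarrow> matrix_of f $$ (i, j) = (if d i = d j then coord (d j) (f (d j) (b j)) i else 0)"
  by (simp add: action_matrix_def coord_def block_def)

lemma matrix_dim: "matrix_of f \<in> carrier_mat N N"
  by (simp add: action_matrix_def)

lemma block_matrix_action:
  assumes n: "n \<le> M" and j: "j \<in> block n" and f: "operad_hom P P f"
  shows "f n (b j) = (\<Sum>i\<in>block n. op_scale P (matrix_of f $$ (i, j)) (b i))"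
proof -
  have "matrix_of f $$ (i, j) = coord n (f n (b j)) i" if "i \<in> block n" for i
    using that j block_arity(3) by (simp add: matrix_entry)
  then show ?thesis using coord_sum[OF n operad_hom_closed[OF f basis_closed[OF n j]]] by simp
qed

lemma matrix_mult:
  assumes f: "operad_hom P P f" and h: "operad_hom P P h"
    and k: "\<And>n x. x \<in> op_space P n \<Longrightarrow> k n x = f n (h n x)"
  shows "matrix_of k = matrix_of f * matrix_of h"
proof (rule eq_matI)
  fix i j assume "i < dim_row (matrix_of f * matrix_of h)" "j < dim_col (matrix_of f * matrix_of h)"
  then have ij: "i < N" "j < N" by (simp_all add: action_matrix_def)
  define n where "n = d j"
  have n: "n \<le> M" and j: "j \<in> block n" using block_arity ij n_def by auto
  have entry: "(matrix_of f * matrix_of h) $$ (i, j) = (\<Sum>l\<in>{0..<N}. matrix_of f $$ (i, l) * matrix_of h $$ (l, j))"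
    using ij matrix_dim[of f] matrix_dim[of h] by (simp add: scalar_prod_def)
  show "matrix_of k $$ (i, j) = (matrix_of f * matrix_of h) $$ (i, j)"
  proof (cases "d i = n")
    case True
    then have i: "i \<in> block n" using block_arity(2)[OF ij(1)] by simp
    have "k n (b j) = f n (\<Sum>l\<in>block n. op_scale P (matrix_of h $$ (l, j)) (b l))"
      by (simp only: k[OF basis_closed[OF n j]] block_matrix_action[OF n j h])
    also have "\<dots> = (\<Sum>l\<in>block n. op_scale P (matrix_of h $$ (l, j)) (f n (b l)))"
      by (rule linear_between_sum[OF operad_hom_linear[OF f] space_subspace basis_closed[OF n]])
    finally have "matrix_of k $$ (i, j)
        = coord n (\<Sum>l\<in>block n. op_scale P (matrix_of h $$ (l, j)) (f n (b l))) i"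
      using True ij by (simp add: matrix_entry n_def)
    also have "\<dots> = (\<Sum>l\<in>block n. matrix_of h $$ (l, j) * coord n (f n (b l)) i)"
      by (rule coord_lincomb[OF n operad_hom_closed[OF f basis_closed[OF n]]])
    also have "\<dots> = (\<Sum>l\<in>block n. matrix_of f $$ (i, l) * matrix_of h $$ (l, j))"
    proof (intro sum.cong refl)
      fix l assume l: "l \<in> block n"
      have "matrix_of f $$ (i, l) = coord n (f n (b l)) i"
        using ij True block_arity(3)[OF l] by (simp add: matrix_entry)
      then show "matrix_of h $$ (l, j) * coord n (f n (b l)) i = matrix_of f $$ (i, l) * matrix_of h $$ (l, j)"
        by simp
    qed
    also have "\<dots> = (\<Sum>l\<in>{0..<N}. matrix_of f $$ (i, l) * matrix_of h $$ (l, j))"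
    proof (rule sum.mono_neutral_left)
      show "\<forall>l\<in>{0..<N} - block n. matrix_of f $$ (i, l) * matrix_of h $$ (l, j) = 0"
      proof
        fix l assume "l \<in> {0..<N} - block n"
        then have "l < N" "d l \<noteq> d j" by (auto simp: block_def n_def)
        then show "matrix_of f $$ (i, l) * matrix_of h $$ (l, j) = 0" using ij by (simp add: matrix_entry)
      qed
    qed (auto simp: block_def)
    finally show ?thesis by (simp only: entry)
  next
    case False
    have "(\<Sum>l\<in>{0..<N}. matrix_of f $$ (i, l) * matrix_of h $$ (l, j)) = 0"
    proof (intro sum.neutral ballI)
      fix l assume "l \<in> {0..<N}"
      then have "l < N" "d i \<noteq> d l \<or> d l \<noteq> d j" using False by (auto simp: n_def)
      then show "matrix_of f $$ (i, l) * matrix_of h $$ (l, j) = 0"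
        using ij by (elim disjE) (simp_all add: matrix_entry)
    qed
    then show ?thesis using ij False by (simp only: entry) (simp add: matrix_entry n_def)
  qed
qed (simp_all add: action_matrix_def)

lemma matrix_one: "matrix_of \<one>\<^bsub>Aut P\<^esub> = 1\<^sub>m N"
proof (rule eq_matI)
  fix i j assume "i < dim_row (1\<^sub>m N)" "j < dim_col (1\<^sub>m N)"
  then have ij: "i < N" "j < N" by simp_all
  note n = block_arity(1)[OF ij(2)] and j = block_arity(2)[OF ij(2)]
  show "matrix_of \<one>\<^bsub>Aut P\<^esub> $$ (i, j) = 1\<^sub>m N $$ (i, j)"
  proof (cases "d i = d j")
    case True
    then have "i \<in> block (d j)" using block_arity(2)[OF ij(1)] by simp
    from coord_basis[OF n this j] show ?thesis
      using ij True basis_closed[OF n j] by (simp add: matrix_entry Aut_one)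
  next
    case False
    then show ?thesis using ij by (auto simp: matrix_entry)
  qed
qed (simp_all add: action_matrix_def)

lemma matrix_hom: "matrix_of \<in> hom (Aut P) (GL N)"
proof (rule homI)
  interpret G: group "Aut P" by (rule Aut_group)
  have mult: "matrix_of (f \<otimes>\<^bsub>Aut P\<^esub> h) = matrix_of f * matrix_of h"
    if "f \<in> carrier (Aut P)" "h \<in> carrier (Aut P)" for f h
    by (rule matrix_mult[OF AutD(1)[OF that(1)] AutD(1)[OF that(2)]]) (simp add: Aut_mult compose_eq)
  fix f h assume f: "f \<in> carrier (Aut P)" and h: "h \<in> carrier (Aut P)"
  show "matrix_of (f \<otimes>\<^bsub>Aut P\<^esub> h) = matrix_of f \<otimes>\<^bsub>GL N\<^esub> matrix_of h"
    using mult[OF f h] by (simp only: GL_mult)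
  obtain k where k: "k \<in> carrier (Aut P)" "k \<otimes>\<^bsub>Aut P\<^esub> f = \<one>\<^bsub>Aut P\<^esub>" "f \<otimes>\<^bsub>Aut P\<^esub> k = \<one>\<^bsub>Aut P\<^esub>"
    using G.l_inv[OF f] G.r_inv[OF f] G.inv_closed[OF f] by blast
  have "matrix_of k * matrix_of f = 1\<^sub>m N" "matrix_of f * matrix_of k = 1\<^sub>m N"
    using mult[OF k(1) f] mult[OF f k(1)] k(2,3) matrix_one by simp_all
  then show "matrix_of f \<in> carrier (GL N)" using matrix_dim by (auto simp: GL_iff)
qed

text \<open>The generators have arity at most \<open>M\<close>, so the matrix determines their images.\<close>

lemma matrix_inj: "inj_on matrix_of (carrier (Aut P))"
proof (rule inj_onI)
  fix f h assume f: "f \<in> carrier (Aut P)" and h: "h \<in> carrier (Aut P)" and eq: "matrix_of f = matrix_of h"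
  note hf = AutD(1)[OF f] and hh = AutD(1)[OF h]
  have "f n x = h n x" if "x \<in> op_space P n" for n x
    using that
  proof (induction rule: generated_induct)
    case (zero n)
    show ?case using operad_hom_zero[OF hf space_0] operad_hom_zero[OF hh space_0] by simp
  next
    case (gen x)
    note n = generator_arity[OF gen]
    have "f (ar x) (b j) = h (ar x) (b j)" if "j \<in> block (ar x)" for j
      by (simp only: block_matrix_action[OF n that hf] block_matrix_action[OF n that hh] eq)
    then show ?case
      unfolding basis_linear_eq[OF n gen_closed[OF gen] operad_hom_linear[OF hf]]
        basis_linear_eq[OF n gen_closed[OF gen] operad_hom_linear[OF hh]]
      by (intro sum.cong refl) simp
  next
    case (comp m n i \<mu> \<nu>)
    then show ?case by (simp only: operad_hom_comp[OF hf] operad_hom_comp[OF hh])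
  next
    case (act n \<mu> \<sigma>)
    then show ?case by (simp only: operad_hom_act[OF hf] operad_hom_act[OF hh])
  next
    case id
    show ?case by (simp only: operad_hom_id[OF hf] operad_hom_id[OF hh])
  next
    case (add n \<mu> \<nu>)
    then show ?case by (simp only: operad_hom_add[OF hf] operad_hom_add[OF hh])
  next
    case (scale n c \<mu>)
    then show ?case by (simp only: operad_hom_scale[OF hf] operad_hom_scale[OF hh])
  qed
  then have "f n = h n" for n by (rule extensionalityI[OF AutD(3)[OF f] AutD(3)[OF h]])
  then show "f = h" by (rule ext)
qed

subsection \<open>The homomorphism attached to a matrix\<close>

text \<open>The images of the generators under the linear map with matrix \<open>A\<close>.  They are defined
  for every matrix, through its diagonal blocks, and depend linearly on \<open>A\<close>.\<close>

definition moved_gen :: "'k mat \<Rightarrow> nat \<Rightarrow> 'p" where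
  "moved_gen A x = (\<Sum>j\<in>block (ar x). op_scale P (coord (ar x) (gen x) j)
     (\<Sum>i\<in>block (ar x). op_scale P (A $$ (i, j)) (b i)))"

lemma moved_gen_closed: "x < g \<Longrightarrow> moved_gen A x \<in> op_space P (ar x)"
  unfolding moved_gen_def by (intro space_sum space_scale basis_closed generator_arity)

definition moved_hom :: "'k mat \<Rightarrow> nat \<Rightarrow> (tree \<Rightarrow>\<^sub>0 'k) \<Rightarrow> 'p" where
  "moved_hom A = free_extension P (moved_gen A)"

lemma moved_hom: "operad_hom (free_operad g ar) P (moved_hom A)"
  and moved_hom_corolla: "x < g \<Longrightarrow> moved_hom A (ar x) (tree_monomial (corolla ar x)) = moved_gen A x"
proof -
  interpret operad_with_generators P g ar "moved_gen A" by standard (rule moved_gen_closed)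
  show "operad_hom (free_operad g ar) P (moved_hom A)"
    unfolding moved_hom_def by (rule free_extension_hom)
  show "x < g \<Longrightarrow> moved_hom A (ar x) (tree_monomial (corolla ar x)) = moved_gen A x"
    unfolding moved_hom_def by (rule free_extension_corolla)
qed

lemma moved_hom_polynomial:
  "p \<in> op_space (free_operad g ar) n \<Longrightarrow> polynomial_family P N n (\<lambda>A. moved_hom A n p)"
proof (induction rule: free_operad_induct)
  case (zero n)
  show ?case using polynomial_family_const[OF space_0] by (simp only: operad_hom_zero[OF moved_hom free_space_0])
next
  case (add n p q)
  then show ?case by (simp only: operad_hom_add[OF moved_hom] polynomial_family.add)
next
  case (scale n c p)
  then show ?case
    using polynomial_family_scale_by[OF scale.IH polynomial_functions.const]
    by (simp only: operad_hom_scale[OF moved_hom])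
next
  case id
  show ?case using polynomial_family_const[OF id_closed] by (simp only: operad_hom_id[OF moved_hom])
next
  case (corolla x)
  have "polynomial_family P N (ar x) (\<lambda>A. moved_gen A x)"
    unfolding moved_gen_def
    by (intro polynomial_family_sum polynomial_family_scale_by polynomial_functions.const
        polynomial_family.monomial polynomial_functions.entry basis_closed generator_arity corolla)
      (use block_arity(3) in blast)+
  then show ?case by (simp only: moved_hom_corolla[OF corolla])
next
  case (act n p \<sigma>)
  then show ?case
    using polynomial_family_linear[OF act.IH act_linear[OF act.hyps(2)]]
    by (simp only: operad_hom_act[OF moved_hom])
next
  case (comp m n i p q)
  then show ?case
    using polynomial_family_comp[OF comp.IH comp.hyps(3,4)]
    by (simp only: operad_hom_comp[OF moved_hom])
qed

lemma moved_hom_automorphism: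
  assumes f: "operad_hom P P f" and p: "p \<in> op_space (free_operad g ar) n"
  shows "moved_hom (matrix_of f) n p = f n (\<pi> n p)"
proof -
  have hom: "operad_hom (free_operad g ar) P (\<lambda>n p. f n (\<pi> n p))"
    unfolding operad_hom_def linear_between_def
    using operad_hom_closed[OF f] presentation_closed operad_hom_add[OF f] operad_hom_scale[OF f]
      operad_hom_id[OF f] operad_hom_act[OF f] operad_hom_comp[OF f]
      operad_hom_add[OF presentation_hom] operad_hom_scale[OF presentation_hom]
      operad_hom_id[OF presentation_hom] operad_hom_act[OF presentation_hom]
      operad_hom_comp[OF presentation_hom]
    by (simp add: image_subset_iff)
  show ?thesis
  proof (rule free_hom_unique[OF moved_hom hom _ p])
    fix x assume x: "x < g"
    have "f (ar x) (gen x) = moved_gen (matrix_of f) x"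
      unfolding moved_gen_def basis_linear_eq[OF generator_arity[OF x] gen_closed[OF x] operad_hom_linear[OF f]]
      by (intro sum.cong refl) (simp add: block_matrix_action[OF generator_arity[OF x] _ f])
    then show "moved_hom (matrix_of f) (ar x) (tree_monomial (corolla ar x))
        = f (ar x) (\<pi> (ar x) (tree_monomial (corolla ar x)))"
      by (simp only: moved_hom_corolla[OF x] gen_def)
  qed
qed

text \<open>The defining equations are all polynomials that vanish on the image.  So whatever holds for
  the matrices of automorphisms and is a polynomial condition may be used for an invertible matrix \<open>A\<close>
  that satisfies the equations: \<open>A\<close> is block diagonal, \<open>moved_hom A\<close> kills the kernel of \<open>\<pi>\<close>, and the
  induced endomorphism has matrix \<open>A\<close>.  A closed set may be cut out by infinitely many equations,
  such as those that come from the kernel.\<close>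

theorem matrix_image_closed: "zariski_closed_in_GL N (matrix_of ` carrier (Aut P))"
proof -
  define S where "S = {p \<in> polynomial_functions N. \<forall>A\<in>matrix_of ` carrier (Aut P). p A = 0}"
  have in_GL: "matrix_of ` carrier (Aut P) \<subseteq> carrier (GL N)" using matrix_hom by (auto simp: hom_def)
  have realized: "A \<in> matrix_of ` carrier (Aut P)" if A: "A \<in> carrier (GL N)" and S: "\<forall>p\<in>S. p A = 0" for A
  proof -
    have dim: "A \<in> carrier_mat N N" using A by (simp add: GL_iff)
    have vanish: "p A = 0"
      if "p \<in> polynomial_functions N" "\<And>f. f \<in> carrier (Aut P) \<Longrightarrow> p (matrix_of f) = 0" for p
      using that S by (auto simp: S_def)
    have off_block: "A $$ (i, j) = 0" if "i < N" "j < N" "d i \<noteq> d j" for i j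
      by (rule vanish[OF polynomial_functions.entry]) (use that in \<open>auto simp: matrix_entry\<close>)
    have kernel: "moved_hom A n p = 0" if p: "p \<in> op_space (free_operad g ar) n" "\<pi> n p = 0" for n p
    proof -
      obtain B where B: "finite B" "independent B" "span B = op_space P n"
        using finite_basis_exists[of "op_space P n"] locally_finite space_subspace
        by (auto simp: locally_finite_def)
      have "representation B (moved_hom A n p) y = 0" for y
      proof (rule vanish)
        show "(\<lambda>A. representation B (moved_hom A n p) y) \<in> polynomial_functions N"
          by (rule polynomial_family_coordinate[OF moved_hom_polynomial[OF p(1)] B(2,3)])
        fix f assume "f \<in> carrier (Aut P)"
        then have "moved_hom (matrix_of f) n p = 0"
          using moved_hom_automorphism[OF _ p(1)] p(2) operad_hom_zero[OF _ space_0] AutD(1) by metis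
        then show "representation B (moved_hom (matrix_of f) n p) y = 0" by (simp add: representation_zero)
      qed
      moreover have "moved_hom A n p \<in> span B" using operad_hom_closed[OF moved_hom p(1)] B(3) by simp
      ultimately show ?thesis using sum_representation_eq[OF B(2) _ B(1) subset_refl, of "moved_hom A n p"] by simp
    qed
    obtain F where F: "\<And>n p. p \<in> op_space (free_operad g ar) n \<Longrightarrow> F n (\<pi> n p) = moved_hom A n p"
      and F_linear: "\<And>n. linear_between (op_scale P) (op_scale P) (op_space P n) (op_space P n) (F n)"
      using descend_along_presentation[OF operad_hom_linear[OF moved_hom] kernel] by blast
    have F_hom: "operad_hom P P F"
    proof -
      have "F 1 (op_id P) = op_id P"
      proof -
        have "op_id (free_operad g ar) \<in> op_space (free_operad g ar) 1"
          by (auto simp: free_operad_def trees_def)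
        from F[OF this] show ?thesis by (simp only: operad_hom_id[OF presentation_hom] operad_hom_id[OF moved_hom])
      qed
      moreover have "F n (op_act P n \<mu> \<sigma>) = op_act P n (F n \<mu>) \<sigma>"
        if \<mu>: "\<mu> \<in> op_space P n" and \<sigma>: "\<sigma> permutes {1..n}" for n \<mu> \<sigma>
      proof -
        obtain p where p: "p \<in> op_space (free_operad g ar) n" and eq: "\<mu> = \<pi> n p"
          using presentation_preimage[OF \<mu>] .
        show ?thesis unfolding eq operad_hom_act[OF presentation_hom p \<sigma>, symmetric]
          by (simp only: F[OF p] F[OF free_space_act[OF p \<sigma>]] operad_hom_act[OF moved_hom p \<sigma>])
      qed
      moreover have "F (m + n - 1) (op_comp P m n i \<mu> \<nu>) = op_comp P m n i (F m \<mu>) (F n \<nu>)"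
        if \<mu>: "\<mu> \<in> op_space P m" and \<nu>: "\<nu> \<in> op_space P n" and i: "1 \<le> i" "i \<le> m" for m n i \<mu> \<nu>
      proof -
        obtain p where p: "p \<in> op_space (free_operad g ar) m" and eq_p: "\<mu> = \<pi> m p"
          using presentation_preimage[OF \<mu>] .
        obtain q where q: "q \<in> op_space (free_operad g ar) n" and eq_q: "\<nu> = \<pi> n q"
          using presentation_preimage[OF \<nu>] .
        show ?thesis unfolding eq_p eq_q operad_hom_comp[OF presentation_hom p q i, symmetric]
          by (simp only: F[OF p] F[OF q] F[OF free_space_comp[OF p q i]] operad_hom_comp[OF moved_hom p q i])
      qed
      ultimately show ?thesis unfolding operad_hom_def using F_linear by blast
    qed
    have entry: "coord n (F n (b j)) i = A $$ (i, j)" if n: "n \<le> M" and j: "j \<in> block n" and i: "i \<in> block n" for n i j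
    proof -
      obtain p where p: "p \<in> op_space (free_operad g ar) n" and eq: "b j = \<pi> n p"
        using presentation_preimage[OF basis_closed[OF n j]] .
      have "coord n (moved_hom A n p) i - A $$ (i, j) = 0"
      proof (rule vanish[OF polynomial_functions_diff[OF _ polynomial_functions.entry]])
        show "(\<lambda>A. coord n (moved_hom A n p) i) \<in> polynomial_functions N"
          unfolding coord_def
          by (rule polynomial_family_coordinate[OF moved_hom_polynomial[OF p] block_basis(2,3)[OF n]])
        show "i < N" "j < N" using block_arity(3) i j by auto
        fix f assume "f \<in> carrier (Aut P)"
        then have "moved_hom (matrix_of f) n p = f n (b j)"
          using moved_hom_automorphism[OF AutD(1) p] eq by simp
        then show "coord n (moved_hom (matrix_of f) n p) i - matrix_of f $$ (i, j) = 0"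
          using block_arity(3)[OF i] block_arity(3)[OF j] by (simp add: matrix_entry)
      qed
      then show ?thesis by (simp add: eq F[OF p])
    qed
    obtain B where B: "B \<in> carrier_mat N N" "A * B = 1\<^sub>m N" using A by (auto simp: GL_iff)
    \<comment> \<open>A right inverse of \<open>A\<close> provides preimages of the basis vectors; block-diagonality of \<open>A\<close>
      makes the sum over one block equal to the full matrix product.\<close>
    have basis_in_image: "b j \<in> F n ` op_space P n" if n: "n \<le> M" and j: "j \<in> block n" for n j
    proof -
      have F_b: "F n (b k) = (\<Sum>i\<in>block n. op_scale P (A $$ (i, k)) (b i))" if "k \<in> block n" for k
        using coord_sum[OF n linear_between_closed[OF F_linear basis_closed[OF n that]]] entry[OF n that]
        by simp
      have "F n (\<Sum>k\<in>block n. op_scale P (B $$ (k, j)) (b k))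
          = (\<Sum>k\<in>block n. op_scale P (B $$ (k, j)) (F n (b k)))"
        by (rule linear_between_sum[OF F_linear space_subspace basis_closed[OF n]])
      also have "\<dots> = (\<Sum>k\<in>block n. \<Sum>i\<in>block n. op_scale P (A $$ (i, k) * B $$ (k, j)) (b i))"
        by (intro sum.cong refl) (simp add: F_b scale_sum_right mult.commute)
      also have "\<dots> = (\<Sum>i\<in>block n. op_scale P (\<Sum>k\<in>block n. A $$ (i, k) * B $$ (k, j)) (b i))"
        by (subst sum.swap) (simp add: scale_sum_left)
      also have "\<dots> = (\<Sum>i\<in>block n. op_scale P (if i = j then 1 else 0) (b i))"
      proof (intro sum.cong refl arg_cong2[where f = "op_scale P"])
        fix i assume i: "i \<in> block n"
        have "(\<Sum>k\<in>block n. A $$ (i, k) * B $$ (k, j)) = (\<Sum>k\<in>{0..<N}. A $$ (i, k) * B $$ (k, j))"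
        proof (rule sum.mono_neutral_left)
          show "\<forall>k\<in>{0..<N} - block n. A $$ (i, k) * B $$ (k, j) = 0"
          proof
            fix k assume "k \<in> {0..<N} - block n"
            then have "k < N" "d i \<noteq> d k" using block_arity(3)[OF i] by (auto simp: block_def)
            then show "A $$ (i, k) * B $$ (k, j) = 0" using off_block block_arity(3)[OF i] by simp
          qed
        qed (auto simp: block_def)
        also have "\<dots> = (A * B) $$ (i, j)"
          using dim B(1) block_arity(3)[OF i] block_arity(3)[OF j] by (simp add: scalar_prod_def)
        also have "\<dots> = (if i = j then 1 else 0)"
          using block_arity(3)[OF i] block_arity(3)[OF j] by (simp add: B(2))
        finally show "(\<Sum>k\<in>block n. A $$ (i, k) * B $$ (k, j)) = (if i = j then 1 else 0)" .
      qed
      also have "\<dots> = b j"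
        using j finite_block by (simp add: if_distrib[of "\<lambda>c. op_scale P c _"] cong: if_cong)
      finally have "F n (\<Sum>k\<in>block n. op_scale P (B $$ (k, j)) (b k)) = b j" .
      moreover have "(\<Sum>k\<in>block n. op_scale P (B $$ (k, j)) (b k)) \<in> op_space P n"
        by (intro space_sum space_scale basis_closed[OF n])
      ultimately show ?thesis by (rule image_eqI[OF sym])
    qed
    have image_add: "x + y \<in> F n ` op_space P n" if "x \<in> F n ` op_space P n" "y \<in> F n ` op_space P n" for n x y
    proof -
      obtain x' y' where x': "x' \<in> op_space P n" "x = F n x'" and y': "y' \<in> op_space P n" "y = F n y'"
        using \<open>x \<in> _\<close> \<open>y \<in> _\<close> by blast
      show ?thesis unfolding x'(2) y'(2) operad_hom_add[OF F_hom x'(1) y'(1), symmetric]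
        by (rule imageI[OF space_add[OF x'(1) y'(1)]])
    qed
    have image_scale: "op_scale P c x \<in> F n ` op_space P n" if "x \<in> F n ` op_space P n" for n c x
    proof -
      obtain x' where x': "x' \<in> op_space P n" "x = F n x'" using \<open>x \<in> _\<close> by blast
      show ?thesis unfolding x'(2) operad_hom_scale[OF F_hom x'(1), symmetric]
        by (rule imageI[OF space_scale[OF x'(1)]])
    qed
    have image_zero: "0 \<in> F n ` op_space P n" for n
      by (rule image_eqI[of _ _ 0]) (simp_all only: operad_hom_zero[OF F_hom space_0] space_0)
    have image_sum: "sum h X \<in> F n ` op_space P n" if "\<And>x. x \<in> X \<Longrightarrow> h x \<in> F n ` op_space P n"
      for h and X :: "nat set" and n
      using that by (induction X rule: infinite_finite_induct) (simp_all add: image_zero image_add)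
    have surj: "\<mu> \<in> F n ` op_space P n" if "\<mu> \<in> op_space P n" for n \<mu>
      using that
    proof (induction rule: generated_induct)
      case (gen x)
      note n = generator_arity[OF gen]
      have "(\<Sum>j\<in>block (ar x). op_scale P (coord (ar x) (gen x) j) (b j)) \<in> F (ar x) ` op_space P (ar x)"
        by (intro image_sum image_scale basis_in_image[OF n])
      then show ?case by (simp only: coord_sum[OF n gen_closed[OF gen]])
    next
      case id
      show ?case by (rule image_eqI[of _ _ "op_id P"]) (simp_all only: operad_hom_id[OF F_hom] id_closed)
    next
      case (act n \<mu> \<sigma>)
      then obtain x where x: "x \<in> op_space P n" "\<mu> = F n x" by blast
      show ?case unfolding x(2) operad_hom_act[OF F_hom x(1) act.hyps(2), symmetric]
        by (rule imageI[OF act_closed[OF act.hyps(2) x(1)]])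
    next
      case (comp m n i \<mu> \<nu>)
      then obtain x y where x: "x \<in> op_space P m" "\<mu> = F m x" and y: "y \<in> op_space P n" "\<nu> = F n y" by blast
      show ?case unfolding x(2) y(2) operad_hom_comp[OF F_hom x(1) y(1) comp.hyps(3,4), symmetric]
        by (rule imageI[OF comp_closed[OF comp.hyps(3,4) x(1) y(1)]])
    next
      case (zero n)
      show ?case by (rule image_zero)
    next
      case (add n \<mu> \<nu>)
      show ?case by (rule image_add[OF add.IH])
    next
      case (scale n c \<mu>)
      show ?case by (rule image_scale[OF scale.IH])
    qed
    have "inj_on (F n) (op_space P n)" for n
      by (rule surjective_endomorphism_injective[OF F_linear space_subspace])
        (use locally_finite surj in \<open>auto simp: locally_finite_def\<close>)
    moreover have "F n ` op_space P n = op_space P n" for n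
      using surj linear_between_closed[OF F_linear] by blast
    ultimately have bij: "bij_betw (F n) (op_space P n) (op_space P n)" for n by (simp add: bij_betw_def)
    define f where "f n = restrict (F n) (op_space P n)" for n
    have "operad_hom P P f" unfolding f_def by (rule operad_hom_restrict[OF F_hom])
    with bij have "f \<in> carrier (Aut P)" by (simp add: Aut_carrier_iff f_def)
    moreover have "A = matrix_of f"
    proof (rule eq_matI)
      fix i j assume "i < dim_row (matrix_of f)" "j < dim_col (matrix_of f)"
      then have ij: "i < N" "j < N" by (simp_all add: action_matrix_def)
      show "A $$ (i, j) = matrix_of f $$ (i, j)"
      proof (cases "d i = d j")
        case True
        note n = block_arity(1)[OF ij(2)] and j = block_arity(2)[OF ij(2)]
        have "i \<in> block (d j)" using block_arity(2)[OF ij(1)] True by simp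
        then show ?thesis
          using entry[OF n j] basis_closed[OF n j] ij True by (simp add: matrix_entry f_def)
      qed (use ij off_block in \<open>simp add: matrix_entry\<close>)
    qed (use dim in \<open>auto simp: action_matrix_def\<close>)
    ultimately show ?thesis by blast
  qed
  show ?thesis
    unfolding zariski_closed_in_GL_def
  proof (intro exI[of _ S] conjI equalityI subsetI)
    fix A assume "A \<in> matrix_of ` carrier (Aut P)"
    then show "A \<in> {A \<in> carrier (GL N). \<forall>p\<in>S. p A = 0}" using in_GL unfolding S_def by blast
  next
    fix A assume "A \<in> {A \<in> carrier (GL N). \<forall>p\<in>S. p A = 0}"
    then show "A \<in> matrix_of ` carrier (Aut P)" using realized by blast
  qed (simp add: S_def)
qed

theorem Aut_closed_linear_embedding: "closed_linear_embedding (Aut P) N matrix_of"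
  unfolding closed_linear_embedding_def
  using Aut_group matrix_hom matrix_inj matrix_image_closed by blast

end

section \<open>Finitely presented operads\<close>

theorem theorem0p8:
  fixes P :: "('k::field, 'p::ab_group_add) operad_data"
  assumes "operad P"
    and "locally_finite P"
    and "finitely_presented P"
  shows "(\<exists>M N d b. homogeneous_basis P M N d b \<and>
            closed_linear_embedding (Aut P) N (action_matrix P N d b))
       \<and> finite_dimensional (op_scale P) (H0 P)
       \<and> finite_dimensional_quotient (scale_endo P) (der P) (inner_der P)
       \<and> finite_dimensional_quotient (scale_cochain2 P) (Z2 P) (B2 P)"
proof -
  interpret operad P by fact
  obtain g ar and R :: "(nat \<times> (tree \<Rightarrow>\<^sub>0 'k)) set" and \<pi> where R: "finite R"
      "\<forall>(n, r)\<in>R. r \<in> op_space (free_operad g ar) n"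
    and \<pi>: "operad_hom (free_operad g ar) P \<pi>"
      "\<forall>n. \<pi> n ` op_space (free_operad g ar) n = op_space P n"
    and kernel: "\<forall>n. \<forall>p\<in>op_space (free_operad g ar) n.
      \<pi> n p = 0 \<longleftrightarrow> operad_ideal (free_operad g ar) R n p"
    using assms(3) unfolding finitely_presented_def by blast
  interpret generated_operad P g ar \<pi> by standard (use \<pi> in auto)
  \<comment> \<open>A common bound for the arities of the generators.\<close>
  define M where "M = (\<Sum>x<g. ar x)"
  have M: "ar x \<le> M" if "x < g" for x
    unfolding M_def using that by (intro member_le_sum) auto
  obtain N d b where basis: "homogeneous_basis P M N d b"
    using homogeneous_basis_exists[OF assms(2)] .
  interpret operad_with_basis P g ar \<pi> M N d b
    by standard (use basis M assms(2) in auto)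
  have "finite_dimensional_quotient (scale_cochain2 P) (Z2 P) (B2 P)"
    by (rule H2_finite_dimensional[OF assms(2) R]) (use kernel in blast)
  then show ?thesis
    using basis Aut_closed_linear_embedding H0_finite_dimensional[OF assms(2)] H1_finite_dimensional[OF assms(2)]
    by blast
qed

end
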